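(* Let $H$ be a Hopf algebra over $\mathbb{K}$ with invertible antipode, $A$ a right $H$-comodule algebra, $B=A^{coH}$, and $\gamma:H\otimes H\to\mathbb{K}$ a 2-cocycle. If $B\subset A$ is an $H$-Hopf-Galois extension, then its twist deformation $B=(A_\gamma)^{coH_\gamma}\subset A_\gamma$ is an $H_\gamma$-Hopf-Galois extension.
   Context: $\mathbb{K}$ denotes $\mathbb{C}$ or $\mathbb{C}[[\hbar]]$. Sweedler notation (sums understood): $\Delta(h)=h_{(1)}\otimes h_{(2)}$, and $\delta^A(a)=a_{(0)}\otimes a_{(1)}$; $S$ antipode, $\varepsilon$ counit. A right $H$-comodule algebra is a unital associative algebra $A$ with a right $H$-coaction $\delta^A:A\to A\otimes H$ that is a unital algebra map; $A^{coH}=\{b\in A:\delta^A(b)=b\otimes 1_H\}$. The extension $B=A^{coH}\subset A$ is an $H$-Hopf-Galois extension if the canonical map $\chi:A\otimes_B A\to A\otimes H$, $a\otimes_B a'\mapsto a\,a'_{(0)}\otimes a'_{(1)}$, is bijective. A 2-cocycle is a linear $\gamma:H\otimes H\to\mathbb{K}$ with $\gamma(g_{(1)}\otimes h_{(1)})\gamma(g_{(2)}h_{(2)}\otimes k)=\gamma(h_{(1)}\otimes k_{(1)})\gamma(g\otimes h_{(2)}k_{(2)})$ for all $g,h,k\in H$, convolution invertible with inverse $\bar\gamma$, and $\gamma(h\otimes1)=\varepsilon(h)=\gamma(1\otimes h)$. The twisted Hopf algebra $H_\gamma$ is $H$ with the same coalgebra structure and unit, product $h\cdot_\gamma k=\gamma(h_{(1)}\otimes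 k_{(1)})h_{(2)}k_{(2)}\bar\gamma(h_{(3)}\otimes k_{(3)})$ and antipode $S_\gamma(h)=u_\gamma(h_{(1)})S(h_{(2)})\bar u_\gamma(h_{(3)})$, with $u_\gamma(h)=\gamma(h_{(1)}\otimes S(h_{(2)}))$, $\bar u_\gamma(h)=\bar\gamma(S(h_{(1)})\otimes h_{(2)})$. $A_\gamma$ is the right $H_\gamma$-comodule algebra with the same underlying space, coaction and unit as $A$, and product $a\bullet_\gamma a'=a_{(0)}a'_{(0)}\,\bar\gamma(a_{(1)}\otimes a'_{(1)})$. Its coinvariants $(A_\gamma)^{coH_\gamma}$ coincide with $B$ (as algebra). *)

theory Defs
  imports
    Complex_Main
    "HOL-Library.Poly_Mapping"
    "HOL-Computational_Algebra.Formal_Power_Series"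
begin

section \<open>The ground ring\<close>

definition ring_isomorphism :: "('a::comm_ring_1 \<Rightarrow> 'b::comm_ring_1) \<Rightarrow> bool" where
  "ring_isomorphism f \<longleftrightarrow>
     bij f \<and> f 1 = 1 \<and> (\<forall>x y. f (x + y) = f x + f y) \<and> (\<forall>x y. f (x * y) = f x * f y)"

definition complex_or_complex_fps :: "'k::comm_ring_1 itself \<Rightarrow> bool" where
  "complex_or_complex_fps _ \<longleftrightarrow>
     (\<exists>f :: 'k \<Rightarrow> complex. ring_isomorphism f) \<or>
     (\<exists>f :: 'k \<Rightarrow> complex fps. ring_isomorphism f)"


section \<open>Tensor products\<close>

text \<open>
  A module over the ground ring is a type of class \<^class>\<open>ab_group_add\<close> with a scalar
  multiplication satisfying the library locale \<^locale>\<open>module\<close>.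

  Tensor products are constructed as usual, as quotients of free modules.  The free module
  on a type \<open>'i\<close> is \<open>'i \<Rightarrow>\<^sub>0 'k\<close>, and an element of the quotient by a submodule \<open>N\<close> is a
  coset, that is, a set of formal sums.  So \<open>M \<otimes> N\<close> is the set
  \<open>tspace (tensor_null sM sN)\<close> of cosets of type \<open>('m \<times> 'n \<Rightarrow>\<^sub>0 'k) set\<close>.
\<close>

definition fscale :: "'k::comm_ring_1 \<Rightarrow> ('i \<Rightarrow>\<^sub>0 'k) \<Rightarrow> ('i \<Rightarrow>\<^sub>0 'k)" where
  "fscale c p = Poly_Mapping.map (\<lambda>x. c * x) p"

lemma lookup_fscale [simp]: "Poly_Mapping.lookup (fscale c p) i = c * Poly_Mapping.lookup p i"
  by (simp add: fscale_def Poly_Mapping.map.rep_eq when_def)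

lemma module_fscale: "module fscale"
  by unfold_locales (auto intro!: poly_mapping_eqI simp: lookup_add algebra_simps)

abbreviation gen :: "'i \<Rightarrow> ('i \<Rightarrow>\<^sub>0 'k::comm_ring_1)" where
  "gen i \<equiv> Poly_Mapping.single i 1"

definition tensor_rels ::
  "('k::comm_ring_1 \<Rightarrow> 'm::ab_group_add \<Rightarrow> 'm) \<Rightarrow> ('k \<Rightarrow> 'n::ab_group_add \<Rightarrow> 'n)
     \<Rightarrow> ('m \<times> 'n \<Rightarrow>\<^sub>0 'k) set" where
  "tensor_rels sM sN =
     {gen (x + x', y) - gen (x, y) - gen (x', y) | x x' y. True} \<union>
     {gen (x, y + y') - gen (x, y) - gen (x, y') | x y y'. True} \<union>
     {gen (sM c x, y) - fscale c (gen (x, y)) | c x y. True} \<union>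
     {gen (x, sN c y) - fscale c (gen (x, y)) | c x y. True}"

definition tensor_null ::
  "('k::comm_ring_1 \<Rightarrow> 'm::ab_group_add \<Rightarrow> 'm) \<Rightarrow> ('k \<Rightarrow> 'n::ab_group_add \<Rightarrow> 'n)
     \<Rightarrow> ('m \<times> 'n \<Rightarrow>\<^sub>0 'k) set" where
  "tensor_null sM sN = module.span fscale (tensor_rels sM sN)"

text \<open>The threefold tensor product, used to state coassociativity.\<close>

definition tensor3_null ::
  "('k::comm_ring_1 \<Rightarrow> 'l::ab_group_add \<Rightarrow> 'l) \<Rightarrow> ('k \<Rightarrow> 'm::ab_group_add \<Rightarrow> 'm)
     \<Rightarrow> ('k \<Rightarrow> 'n::ab_group_add \<Rightarrow> 'n) \<Rightarrow> ('l \<times> 'm \<times> 'n \<Rightarrow>\<^sub>0 'k) set" where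
  "tensor3_null sL sM sN = module.span fscale (
     {gen (x + x', y, z) - gen (x, y, z) - gen (x', y, z) | x x' y z. True} \<union>
     {gen (x, y + y', z) - gen (x, y, z) - gen (x, y', z) | x y y' z. True} \<union>
     {gen (x, y, z + z') - gen (x, y, z) - gen (x, y, z') | x y z z'. True} \<union>
     {gen (sL c x, y, z) - fscale c (gen (x, y, z)) | c x y z. True} \<union>
     {gen (x, sM c y, z) - fscale c (gen (x, y, z)) | c x y z. True} \<union>
     {gen (x, y, sN c z) - fscale c (gen (x, y, z)) | c x y z. True})"

definition tclass :: "('i \<Rightarrow>\<^sub>0 'k::comm_ring_1) set \<Rightarrow> ('i \<Rightarrow>\<^sub>0 'k) \<Rightarrow> ('i \<Rightarrow>\<^sub>0 'k) set" where
  "tclass N p = {q. q - p \<in> N}"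

definition tspace :: "('i \<Rightarrow>\<^sub>0 'k::comm_ring_1) set \<Rightarrow> ('i \<Rightarrow>\<^sub>0 'k) set set" where
  "tspace N = range (tclass N)"

definition trep :: "('i \<Rightarrow>\<^sub>0 'k::comm_ring_1) set \<Rightarrow> ('i \<Rightarrow>\<^sub>0 'k)" where
  "trep t = (SOME p. p \<in> t)"

text \<open>
  \<open>tsum s t f\<close> is the value of \<open>f\<close>, extended linearly, at a formal sum representing
  the tensor \<open>t\<close>; here \<open>s\<close> is the scalar multiplication of the target.  In Sweedler
  notation, \<open>tsum s (\<Delta> h) (\<lambda>h1 h2. f h1 h2)\<close> is the sum of the \<open>f h\<^sub>(\<^sub>1\<^sub>) h\<^sub>(\<^sub>2\<^sub>)\<close>.
  For \<open>f\<close> bilinear (and balanced, where applicable) it does not depend on the chosen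
  representative.  Where the target is a tensor product, \<open>f\<close> takes values in the free
  module, is bilinear only modulo the relations, and \<open>tclass\<close> is applied to the sum.
\<close>

definition tsum ::
  "('k::comm_ring_1 \<Rightarrow> 'v::ab_group_add \<Rightarrow> 'v) \<Rightarrow> ('m \<times> 'n \<Rightarrow>\<^sub>0 'k) set
     \<Rightarrow> ('m \<Rightarrow> 'n \<Rightarrow> 'v) \<Rightarrow> 'v" where
  "tsum s t f = (\<Sum>(x, y)\<in>Poly_Mapping.keys (trep t). s (Poly_Mapping.lookup (trep t) (x, y)) (f x y))"

definition tlinear ::
  "('k::comm_ring_1 \<Rightarrow> 'm::ab_group_add \<Rightarrow> 'm) \<Rightarrow> ('i \<Rightarrow>\<^sub>0 'k) set
     \<Rightarrow> ('m \<Rightarrow> ('i \<Rightarrow>\<^sub>0 'k) set) \<Rightarrow> bool" where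
  "tlinear s N D \<longleftrightarrow>
     (\<forall>x. D x \<in> tspace N) \<and>
     (\<forall>x y. D (x + y) = tclass N (trep (D x) + trep (D y))) \<and>
     (\<forall>c x. D (s c x) = tclass N (fscale c (trep (D x))))"

text \<open>Linear maps out of a tensor product are given as bilinear maps.\<close>

definition bilinear_map ::
  "('k::comm_ring_1 \<Rightarrow> 'l::ab_group_add \<Rightarrow> 'l) \<Rightarrow> ('k \<Rightarrow> 'm::ab_group_add \<Rightarrow> 'm)
     \<Rightarrow> ('k \<Rightarrow> 'n::ab_group_add \<Rightarrow> 'n) \<Rightarrow> ('l \<Rightarrow> 'm \<Rightarrow> 'n) \<Rightarrow> bool" where
  "bilinear_map sL sM sN f \<longleftrightarrow>
     (\<forall>x. module_hom sM sN (f x)) \<and> (\<forall>y. module_hom sL sN (\<lambda>x. f x y))"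


section \<open>Algebras, Hopf algebras, comodule algebras\<close>

record ('k, 'a) alg =
  scl :: "'k \<Rightarrow> 'a \<Rightarrow> 'a"
  mult :: "'a \<Rightarrow> 'a \<Rightarrow> 'a"
  unity :: 'a

record (overloaded) ('k::zero, 'h) hopf = "('k, 'h) alg" +
  comult :: "'h \<Rightarrow> ('h \<times> 'h \<Rightarrow>\<^sub>0 'k) set"
  counit :: "'h \<Rightarrow> 'k"
  antipode :: "'h \<Rightarrow> 'h"

record (overloaded) ('k::zero, 'a, 'h) comod_alg = "('k, 'a) alg" +
  coact :: "'a \<Rightarrow> ('a \<times> 'h \<Rightarrow>\<^sub>0 'k) set"

locale K_algebra =
  fixes A :: "('k::comm_ring_1, 'a::ab_group_add, 'e) alg_scheme"
  assumes module_scl: "module (scl A)"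
    and mult_bilinear: "bilinear_map (scl A) (scl A) (scl A) (mult A)"
    and mult_assoc: "mult A (mult A x y) z = mult A x (mult A y z)"
    and unity_left: "mult A (unity A) x = x"
    and unity_right: "mult A x (unity A) = x"

locale hopf_algebra = K_algebra H
  for H :: "('k::comm_ring_1, 'h::ab_group_add) hopf" +
  assumes comult_linear: "tlinear (scl H) (tensor_null (scl H) (scl H)) (comult H)"
    and counit_linear: "module_hom (scl H) (*) (counit H)"
    and antipode_linear: "module_hom (scl H) (scl H) (antipode H)"
    and coassoc:
      "tclass (tensor3_null (scl H) (scl H) (scl H))
         (tsum fscale (comult H h) (\<lambda>x y. tsum fscale (comult H x) (\<lambda>x1 x2. gen (x1, x2, y)))) =
       tclass (tensor3_null (scl H) (scl H) (scl H))
         (tsum fscale (comult H h) (\<lambda>x y. tsum fscale (comult H y) (\<lambda>y1 y2. gen (x, y1, y2))))"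
    and counit_left: "tsum (scl H) (comult H h) (\<lambda>h1 h2. scl H (counit H h1) h2) = h"
    and counit_right: "tsum (scl H) (comult H h) (\<lambda>h1 h2. scl H (counit H h2) h1) = h"
    and comult_mult:
      "comult H (mult H g h) = tclass (tensor_null (scl H) (scl H))
         (tsum fscale (comult H g) (\<lambda>g1 g2. tsum fscale (comult H h) (\<lambda>h1 h2.
            gen (mult H g1 h1, mult H g2 h2))))"
    and comult_unity:
      "comult H (unity H) = tclass (tensor_null (scl H) (scl H)) (gen (unity H, unity H))"
    and counit_mult: "counit H (mult H g h) = counit H g * counit H h"
    and counit_unity: "counit H (unity H) = 1"
    and antipode_left:
      "tsum (scl H) (comult H h) (\<lambda>h1 h2. mult H (antipode H h1) h2) = scl H (counit H h) (unity H)"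
    and antipode_right:
      "tsum (scl H) (comult H h) (\<lambda>h1 h2. mult H h1 (antipode H h2)) = scl H (counit H h) (unity H)"

locale comodule_algebra = H: hopf_algebra H + A: K_algebra A
  for H :: "('k::comm_ring_1, 'h::ab_group_add) hopf"
    and A :: "('k, 'a::ab_group_add, 'h) comod_alg" +
  assumes coact_linear: "tlinear (scl A) (tensor_null (scl A) (scl H)) (coact A)"
    and coact_coassoc:
      "tclass (tensor3_null (scl A) (scl H) (scl H))
         (tsum fscale (coact A a) (\<lambda>x h. tsum fscale (coact A x) (\<lambda>x0 x1. gen (x0, x1, h)))) =
       tclass (tensor3_null (scl A) (scl H) (scl H))
         (tsum fscale (coact A a) (\<lambda>x h. tsum fscale (comult H h) (\<lambda>h1 h2. gen (x, h1, h2))))"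
    and coact_counit: "tsum (scl A) (coact A a) (\<lambda>a0 a1. scl A (counit H a1) a0) = a"
    and coact_mult:
      "coact A (mult A a b) = tclass (tensor_null (scl A) (scl H))
         (tsum fscale (coact A a) (\<lambda>a0 a1. tsum fscale (coact A b) (\<lambda>b0 b1.
            gen (mult A a0 b0, mult H a1 b1))))"
    and coact_unity:
      "coact A (unity A) = tclass (tensor_null (scl A) (scl H)) (gen (unity A, unity H))"


section \<open>Hopf--Galois extensions\<close>

definition coinvariants ::
  "('k::comm_ring_1, 'h::ab_group_add) hopf \<Rightarrow> ('k, 'a::ab_group_add, 'h) comod_alg \<Rightarrow> 'a set" where
  "coinvariants H A =
     {b. coact A b = tclass (tensor_null (scl A) (scl H)) (gen (b, unity H))}"

text \<open>The tensor product of \<open>A\<close> with itself, balanced over a subalgebra \<open>B\<close>.\<close>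

definition balanced_null ::
  "('k::comm_ring_1, 'a::ab_group_add, 'e) alg_scheme \<Rightarrow> 'a set \<Rightarrow> ('a \<times> 'a \<Rightarrow>\<^sub>0 'k) set" where
  "balanced_null A B = module.span fscale (tensor_rels (scl A) (scl A) \<union>
     {gen (mult A a b, a') - gen (a, mult A b a') | a b a'. b \<in> B})"

definition canonical_map ::
  "('k::comm_ring_1, 'h::ab_group_add) hopf \<Rightarrow> ('k, 'a::ab_group_add, 'h) comod_alg
     \<Rightarrow> ('a \<times> 'a \<Rightarrow>\<^sub>0 'k) set \<Rightarrow> ('a \<times> 'h \<Rightarrow>\<^sub>0 'k) set" where
  "canonical_map H A t = tclass (tensor_null (scl A) (scl H))
     (tsum fscale t (\<lambda>a a'. tsum fscale (coact A a') (\<lambda>a0 a1. gen (mult A a a0, a1))))"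

locale hopf_galois_extension = comodule_algebra H A
  for H :: "('k::comm_ring_1, 'h::ab_group_add) hopf"
    and A :: "('k, 'a::ab_group_add, 'h) comod_alg" +
  assumes canonical_map_bij:
    "bij_betw (canonical_map H A)
       (tspace (balanced_null A (coinvariants H A))) (tspace (tensor_null (scl A) (scl H)))"


section \<open>2-cocycles and twists\<close>

text \<open>\<open>\<gamma>'\<close> is the convolution inverse of \<open>\<gamma>\<close>; it is uniquely determined by \<open>\<gamma>\<close>.\<close>

locale two_cocycle =
  fixes H :: "('k::comm_ring_1, 'h::ab_group_add) hopf"
    and \<gamma> \<gamma>' :: "'h \<Rightarrow> 'h \<Rightarrow> 'k"
  assumes bilinear: "bilinear_map (scl H) (scl H) (*) \<gamma>"
    and inverse_bilinear: "bilinear_map (scl H) (scl H) (*) \<gamma>'"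
    and inverse_right:
      "tsum (*) (comult H g) (\<lambda>g1 g2. tsum (*) (comult H h) (\<lambda>h1 h2. \<gamma> g1 h1 * \<gamma>' g2 h2)) =
         counit H g * counit H h"
    and inverse_left:
      "tsum (*) (comult H g) (\<lambda>g1 g2. tsum (*) (comult H h) (\<lambda>h1 h2. \<gamma>' g1 h1 * \<gamma> g2 h2)) =
         counit H g * counit H h"
    and cocycle:
      "tsum (*) (comult H g) (\<lambda>g1 g2. tsum (*) (comult H h) (\<lambda>h1 h2.
         \<gamma> g1 h1 * \<gamma> (mult H g2 h2) k)) =
       tsum (*) (comult H h) (\<lambda>h1 h2. tsum (*) (comult H k) (\<lambda>k1 k2.
         \<gamma> h1 k1 * \<gamma> g (mult H h2 k2)))"
    and unital_left: "\<gamma> (unity H) h = counit H h"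
    and unital_right: "\<gamma> h (unity H) = counit H h"

definition tsum3 ::
  "('k::comm_ring_1, 'h::ab_group_add) hopf \<Rightarrow> ('k \<Rightarrow> 'v::ab_group_add \<Rightarrow> 'v) \<Rightarrow> 'h
     \<Rightarrow> ('h \<Rightarrow> 'h \<Rightarrow> 'h \<Rightarrow> 'v) \<Rightarrow> 'v" where
  "tsum3 H s h f = tsum s (comult H h) (\<lambda>x h3. tsum s (comult H x) (\<lambda>h1 h2. f h1 h2 h3))"

definition twist_mult ::
  "('k::comm_ring_1, 'h::ab_group_add) hopf \<Rightarrow> ('h \<Rightarrow> 'h \<Rightarrow> 'k) \<Rightarrow> ('h \<Rightarrow> 'h \<Rightarrow> 'k)
     \<Rightarrow> 'h \<Rightarrow> 'h \<Rightarrow> 'h" where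
  "twist_mult H \<gamma> \<gamma>' h k =
     tsum3 H (scl H) h (\<lambda>h1 h2 h3. tsum3 H (scl H) k (\<lambda>k1 k2 k3.
       scl H (\<gamma> h1 k1 * \<gamma>' h3 k3) (mult H h2 k2)))"

definition twist_antipode ::
  "('k::comm_ring_1, 'h::ab_group_add) hopf \<Rightarrow> ('h \<Rightarrow> 'h \<Rightarrow> 'k) \<Rightarrow> ('h \<Rightarrow> 'h \<Rightarrow> 'k)
     \<Rightarrow> 'h \<Rightarrow> 'h" where
  "twist_antipode H \<gamma> \<gamma>' h =
     (let u = (\<lambda>x. tsum (*) (comult H x) (\<lambda>x1 x2. \<gamma> x1 (antipode H x2)));
          u' = (\<lambda>x. tsum (*) (comult H x) (\<lambda>x1 x2. \<gamma>' (antipode H x1) x2))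
      in tsum3 H (scl H) h (\<lambda>h1 h2 h3. scl H (u h1 * u' h3) (antipode H h2)))"

definition twist_hopf ::
  "('k::comm_ring_1, 'h::ab_group_add) hopf \<Rightarrow> ('h \<Rightarrow> 'h \<Rightarrow> 'k) \<Rightarrow> ('h \<Rightarrow> 'h \<Rightarrow> 'k)
     \<Rightarrow> ('k, 'h) hopf" where
  "twist_hopf H \<gamma> \<gamma>' =
     H\<lparr>mult := twist_mult H \<gamma> \<gamma>', antipode := twist_antipode H \<gamma> \<gamma>'\<rparr>"

definition twist_comod_alg ::
  "('h \<Rightarrow> 'h \<Rightarrow> 'k::comm_ring_1) \<Rightarrow> ('k, 'a::ab_group_add, 'h::ab_group_add) comod_alg
     \<Rightarrow> ('k, 'a, 'h) comod_alg" where
  "twist_comod_alg \<gamma>' A =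
     A\<lparr>mult := \<lambda>a b. tsum (scl A) (coact A a) (\<lambda>a0 a1. tsum (scl A) (coact A b) (\<lambda>b0 b1.
         scl A (\<gamma>' a1 b1) (mult A a0 b0)))\<rparr>"

end

theory Submission
  imports Defs
begin

text \<open>
  Why the theorem holds.  The twist changes only products, and a product with a coinvariant
  element is not changed at all, because \<open>\<gamma>'\<close> is unital.  So both extensions have the same
  coinvariants \<open>B\<close> and literally the same balanced tensor product \<open>A \<otimes>\<^sub>B A\<close>, and the two canonical
  maps \<open>\<chi>\<close> and \<open>\<chi>\<^sub>\<gamma>\<close> have the same domain and codomain.  Writing \<open>z \<otimes> h\<close> for
  \<open>\<chi> (a \<otimes> a') = a a'\<^sub>0 \<otimes> a'\<^sub>1\<close>, one recovers \<open>a\<^sub>1\<close> as \<open>z\<^sub>1 S(h\<^sub>1)\<close>; hence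
  \<open>\<chi>\<^sub>\<gamma> (a \<otimes> a') = \<gamma>'(a\<^sub>1, a'\<^sub>1) a\<^sub>0 a'\<^sub>0 \<otimes> a'\<^sub>2\<close> is \<open>V (\<chi> (a \<otimes> a'))\<close> for the linear map
  \<open>V (z \<otimes> h) = \<gamma>'(z\<^sub>1 S(h\<^sub>1), h\<^sub>2) z\<^sub>0 \<otimes> h\<^sub>3\<close> on \<open>A \<otimes> H\<close> (\<open>canonical_map_twist\<close>).

  It remains to see that \<open>V\<close> is bijective.  The cocycle identity gives
  \<open>\<gamma>'(z S(h\<^sub>1), h\<^sub>2) = \<gamma>(z, S(h\<^sub>1)) u'(h\<^sub>2)\<close> with \<open>u'(h) = \<gamma>'(S(h\<^sub>1), h\<^sub>2)\<close>
  (\<open>cocycle_antipode_right\<close>), which factors \<open>V\<close> into an action of \<open>\<gamma>(_, S(_))\<close> and an action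
  of \<open>u'\<close>.  Both are invertible: the first because \<open>S\<close> reverses the coproduct, so that
  \<open>\<gamma>'(_, S(_))\<close> acts as its inverse, and the second because \<open>u'\<close> is the convolution inverse of
  \<open>u(h) = \<gamma>(h\<^sub>1, S(h\<^sub>2))\<close> (\<open>bij_galois_twist\<close>).

  That the twisted objects are a Hopf algebra and a comodule algebra is a computation in
  convolution monoids.  On pairs, the twisted product is \<open>\<gamma> * m * \<gamma>'\<close>, respectively
  \<open>m\<^sub>A * \<gamma>'\<close>; multiplicativity of coproduct and coaction is the cancellation \<open>\<gamma>' * \<gamma> = \<epsilon>\<close>, and
  associativity is the cocycle identity on triples.

  Two devices make Sweedler calculations with cosets of formal sums possible.  All quotients of a
  free module embed into one module type, so that tensor identities become identities between
  values of multilinear maps.  And a coalgebra is treated through formal sums modulo relations,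
  so that pairs and triples are again coalgebras of the same kind, and one theory of convolution
  serves elements, pairs and triples.
\<close>

section \<open>Linear extension\<close>

text \<open>
  The linear extension of \<open>f\<close> to the free module, with arguments in the order that makes
  \<open>lext s f\<close> a linear map; \<open>tsum\<close> is this map applied to the chosen representative.
\<close>

definition lext :: "('k::comm_ring_1 \<Rightarrow> 'v::ab_group_add \<Rightarrow> 'v) \<Rightarrow> ('i \<Rightarrow> 'v) \<Rightarrow> ('i \<Rightarrow>\<^sub>0 'k) \<Rightarrow> 'v" where
  "lext s f p = (\<Sum>i\<in>Poly_Mapping.keys p. s (Poly_Mapping.lookup p i) (f i))"

lemma tsum_eq_lext: "tsum s t f = lext s (\<lambda>(x, y). f x y) (trep t)"
  by (simp add: tsum_def lext_def split_def)

lemma lext_superset: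
  assumes "module s" "finite I" "Poly_Mapping.keys p \<subseteq> I"
  shows "lext s f p = (\<Sum>i\<in>I. s (Poly_Mapping.lookup p i) (f i))"
proof -
  interpret module s by fact
  show ?thesis unfolding lext_def
    using assms(2,3) by (intro sum.mono_neutral_left) (auto simp: in_keys_iff)
qed

lemma lext_add:
  assumes "module s"
  shows "lext s f (p + q) = lext s f p + lext s f q"
proof -
  interpret module s by fact
  let ?I = "Poly_Mapping.keys p \<union> Poly_Mapping.keys q"
  have "Poly_Mapping.keys (p + q) \<subseteq> ?I" by (rule Poly_Mapping.keys_add)
  then show ?thesis
    by (simp add: lext_superset[OF assms, of ?I] lookup_add scale_left_distrib sum.distrib)
qed

lemma keys_fscale: "Poly_Mapping.keys (fscale c p) \<subseteq> Poly_Mapping.keys p"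
  by (auto simp: in_keys_iff)

lemma lext_fscale:
  assumes "module s"
  shows "lext s f (fscale c p) = s c (lext s f p)"
proof -
  interpret module s by fact
  show ?thesis
    by (simp add: lext_superset[OF assms, of "Poly_Mapping.keys p"] keys_fscale scale_sum_right)
qed

lemma module_hom_lext:
  assumes "module s"
  shows "module_hom fscale s (lext s f)"
  by (simp add: module_hom_iff module_fscale assms lext_add lext_fscale)

lemma lext_diff:
  assumes "module s"
  shows "lext s f (p - q) = lext s f p - lext s f q"
  by (rule module_hom.diff[OF module_hom_lext[OF assms]])

lemma lext_gen [simp]:
  assumes "module s"
  shows "lext s f (gen i) = f i"
proof -
  interpret module s by fact
  show ?thesis by (simp add: lext_def)
qed

lemma lext_zero [simp]: "lext s f 0 = 0"
  by (simp add: lext_def)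

lemma lext_gen_id: "lext fscale gen p = p"
proof -
  have "Poly_Mapping.lookup (lext fscale gen p) j = Poly_Mapping.lookup p j" for j
    by (simp add: lext_def lookup_sum lookup_single when_def in_keys_iff if_distrib cong: if_cong)
  then show ?thesis by (intro poly_mapping_eqI)
qed

lemma module_hom_lext_eq:
  assumes "module_hom s t L"
  shows "L (lext s f p) = lext t (\<lambda>i. L (f i)) p"
proof -
  interpret module_hom s t L by fact
  show ?thesis by (simp add: lext_def sum scale)
qed

lemma lext_lext:
  assumes "module s"
  shows "lext s f (lext fscale g p) = lext s (\<lambda>i. lext s f (g i)) p"
  by (rule module_hom_lext_eq[OF module_hom_lext[OF assms]])

text \<open>
  Sums over two independent formal sums commute whether or not \<open>f\<close> respects any relations,
  since representatives are fixed.  This is what allows the legs of different elements to be reordered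
  freely in Sweedler calculations.
\<close>

lemma lext_swap:
  assumes "module s"
  shows "lext s (\<lambda>i. lext s (\<lambda>j. f i j) q) p = lext s (\<lambda>j. lext s (\<lambda>i. f i j) p) q"
proof -
  interpret module s by fact
  show ?thesis
    unfolding lext_def
    by (simp add: scale_sum_right sum.swap[of _ "Poly_Mapping.keys p"] mult.commute)
qed

lemma lext_scale_fun:
  assumes "module s"
  shows "lext s (\<lambda>i. s c (f i)) p = s c (lext s f p)"
proof -
  interpret module s by fact
  show ?thesis by (simp add: lext_def scale_sum_right mult.commute)
qed

lemma module_mult: "module ((*) :: 'k::comm_ring_1 \<Rightarrow> 'k \<Rightarrow> 'k)"
  by unfold_locales (auto simp: algebra_simps)

lemma scale_lext:
  assumes "module s"
  shows "s (lext (*) f p) v = lext s (\<lambda>i. s (f i) v) p"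
proof -
  interpret module s by fact
  show ?thesis by (simp add: lext_def scale_sum_left)
qed

lemma lext_span_zero:
  assumes "module s" "\<And>r. r \<in> R \<Longrightarrow> lext s f r = 0" "p \<in> module.span fscale R"
  shows "lext s f p = 0"
proof -
  interpret module_hom fscale s "lext s f" by (rule module_hom_lext) fact
  show ?thesis using eq_0_on_span[of R p] assms by blast
qed

section \<open>Quotients of a free module inside one module\<close>

lemma subspace_diff_trans:
  fixes p q r :: "'i \<Rightarrow>\<^sub>0 'k::comm_ring_1"
  assumes "module.subspace fscale N" "p - q \<in> N" "q - r \<in> N"
  shows "p - r \<in> N"
  using module.subspace_add[OF module_fscale assms] by simp

text \<open>
  The product of the quotients \<open>V / N\<close> of the free module \<open>V\<close> over all its submodules \<open>N\<close>.  A
  quotient by a submodule given by a term is not a type; but each one embeds as a factor of this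
  product, which is a type.  Submodules do not occur in the type, so one type serves all tensor
  products over the same index type.
\<close>

quotient_type (overloaded) ('i, 'k) all_quotients =
  "('i \<Rightarrow>\<^sub>0 'k::comm_ring_1) set \<Rightarrow> ('i \<Rightarrow>\<^sub>0 'k)" /
  "\<lambda>f g. \<forall>N. module.subspace fscale N \<longrightarrow> f N - g N \<in> N"
proof (rule equivpI)
  interpret module "fscale :: 'k \<Rightarrow> ('i \<Rightarrow>\<^sub>0 'k) \<Rightarrow> _" by (rule module_fscale)
  let ?E = "\<lambda>f g. \<forall>N. subspace N \<longrightarrow> f N - (g N :: 'i \<Rightarrow>\<^sub>0 'k) \<in> N"
  show "reflp ?E" by (auto intro!: reflpI simp: subspace_0)
  show "symp ?E"
    by (auto intro!: sympI) (metis minus_diff_eq subspace_neg)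
  show "transp ?E"
    by (auto intro!: transpI intro: subspace_diff_trans)
qed

instantiation all_quotients :: (type, comm_ring_1) ab_group_add
begin

lift_definition zero_all_quotients :: "('a, 'b) all_quotients" is "\<lambda>N. 0" .

lift_definition plus_all_quotients ::
  "('a, 'b) all_quotients \<Rightarrow> ('a, 'b) all_quotients \<Rightarrow> ('a, 'b) all_quotients"
  is "\<lambda>f g N. f N + g N"
  using module.subspace_add[OF module_fscale] by (fastforce simp: add_diff_add)

lift_definition uminus_all_quotients :: "('a, 'b) all_quotients \<Rightarrow> ('a, 'b) all_quotients"
  is "\<lambda>f N. - f N"
  using module.subspace_neg[OF module_fscale] by fastforce

lift_definition minus_all_quotients ::
  "('a, 'b) all_quotients \<Rightarrow> ('a, 'b) all_quotients \<Rightarrow> ('a, 'b) all_quotients"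
  is "\<lambda>f g N. f N - g N"
  using module.subspace_diff[OF module_fscale] by (fastforce simp: algebra_simps)

instance
  by standard (transfer; simp add: algebra_simps module.subspace_0[OF module_fscale])+

end

lift_definition qscale :: "'k::comm_ring_1 \<Rightarrow> ('i, 'k) all_quotients \<Rightarrow> ('i, 'k) all_quotients"
  is "\<lambda>c f N. fscale c (f N)"
  by (simp add: module.scale_right_diff_distrib[OF module_fscale, symmetric]
      module.subspace_scale[OF module_fscale])

lemma module_qscale: "module qscale"
proof -
  interpret module fscale by (rule module_fscale)
  show ?thesis
    by unfold_locales
      (transfer; simp add: scale_right_distrib scale_left_distrib subspace_0)+
qed

text \<open>
  The embedding of \<open>V / N\<close> as a factor of the product, composed with \<open>V \<rightarrow> V / N\<close>.
\<close>

definition qclass :: "('i \<Rightarrow>\<^sub>0 'k::comm_ring_1) set \<Rightarrow> ('i \<Rightarrow>\<^sub>0 'k) \<Rightarrow> ('i, 'k) all_quotients" where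
  "qclass N p = abs_all_quotients (\<lambda>N'. if N' = N then p else 0)"

lemma module_hom_qclass: "module_hom fscale qscale (qclass N)"
proof -
  interpret module fscale by (rule module_fscale)
  have "qclass N (p + q) = qclass N p + qclass N q" for p q
    by (simp add: qclass_def plus_all_quotients.abs_eq all_quotients.abs_eq_iff subspace_0)
  moreover have "qclass N (fscale c p) = qscale c (qclass N p)" for c p
    by (simp add: qclass_def qscale.abs_eq all_quotients.abs_eq_iff subspace_0)
  ultimately show ?thesis
    by (simp add: module_hom_iff module_fscale module_qscale)
qed

lemma qclass_eq_iff:
  assumes "module.subspace fscale N"
  shows "qclass N p = qclass N q \<longleftrightarrow> p - q \<in> N"
  using assms by (auto simp: qclass_def all_quotients.abs_eq_iff module.subspace_0[OF module_fscale])

lemma qclass_lext: "qclass N (lext fscale f p) = lext qscale (\<lambda>i. qclass N (f i)) p"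
  by (rule module_hom_lext_eq[OF module_hom_qclass])

lemma qclass_eq_lext: "qclass N p = lext qscale (\<lambda>i. qclass N (gen i)) p"
  using qclass_lext[of N gen p] by (simp add: lext_gen_id)

lemma tclass_eq_iff_diff:
  assumes "module.subspace fscale N"
  shows "tclass N p = tclass N q \<longleftrightarrow> p - q \<in> N"
proof
  assume "tclass N p = tclass N q"
  moreover have "p \<in> tclass N p"
    using module.subspace_0[OF module_fscale assms] by (simp add: tclass_def)
  ultimately show "p - q \<in> N" by (simp add: tclass_def)
next
  assume pq: "p - q \<in> N"
  then have qp: "q - p \<in> N"
    using module.subspace_neg[OF module_fscale assms] by fastforce
  show "tclass N p = tclass N q"
    using subspace_diff_trans[OF assms _ pq] subspace_diff_trans[OF assms _ qp]
    by (auto simp: tclass_def)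
qed

lemma tclass_eq_iff:
  assumes "module.subspace fscale N"
  shows "tclass N p = tclass N q \<longleftrightarrow> qclass N p = qclass N q"
  by (simp add: assms tclass_eq_iff_diff qclass_eq_iff)

lemma trep_tclass:
  assumes "module.subspace fscale N"
  shows "trep (tclass N p) - p \<in> N"
proof -
  have "p \<in> tclass N p"
    using module.subspace_0[OF module_fscale assms] by (simp add: tclass_def)
  then have "trep (tclass N p) \<in> tclass N p"
    unfolding trep_def by (rule someI)
  then show ?thesis by (simp add: tclass_def)
qed

lemma tclass_trep:
  assumes "module.subspace fscale N" "t \<in> tspace N"
  shows "tclass N (trep t) = t"
proof -
  obtain p where "t = tclass N p" using assms(2) by (auto simp: tspace_def)
  then show ?thesis
    using trep_tclass[OF assms(1), of p] by (simp add: tclass_eq_iff_diff[OF assms(1)])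
qed

section \<open>Multilinear maps as functions that respect relations\<close>

text \<open>
  If \<open>R\<close> presents a module on generators of type \<open>'i\<close>, these are the functions on generators that
  extend to linear maps on the presented module.  For a tensor product they are the bilinear
  maps.
\<close>

definition compatible ::
  "('i \<Rightarrow>\<^sub>0 'k::comm_ring_1) set \<Rightarrow> ('k \<Rightarrow> 'v::ab_group_add \<Rightarrow> 'v) \<Rightarrow> ('i \<Rightarrow> 'v) \<Rightarrow> bool" where
  "compatible R s f \<longleftrightarrow> (\<forall>r\<in>R. lext s f r = 0)"

lemma compatible_span_eq:
  assumes "module s" "compatible R s f" "p - q \<in> module.span fscale R"
  shows "lext s f p = lext s f q"
proof -
  have "lext s f (p - q) = 0"
    using assms(2) by (intro lext_span_zero[OF assms(1) _ assms(3)]) (simp add: compatible_def)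
  then show ?thesis by (simp add: lext_diff[OF assms(1)])
qed

lemma compatible_compose:
  assumes "compatible R s f" "module_hom s t L"
  shows "compatible R t (\<lambda>i. L (f i))"
proof -
  interpret module_hom s t L by fact
  show ?thesis
    using assms(1) by (simp add: compatible_def module_hom_lext_eq[OF assms(2), symmetric] zero)
qed

lemma compatible_lext:
  assumes "module s" "\<And>j. compatible R s (\<lambda>i. f i j)"
  shows "compatible R s (\<lambda>i. lext s (f i) q)"
proof -
  interpret module s by fact
  show ?thesis
    using assms(2) unfolding compatible_def
    by (simp add: lext_swap[OF assms(1), of f]) (simp add: lext_def)
qed

text \<open>
  The relations of the tensor product of two presented modules.  On pairs, compatibility then
  means compatibility in each variable separately.
\<close>

definition rel_prod ::
  "('i \<Rightarrow>\<^sub>0 'k::comm_ring_1) set \<Rightarrow> ('j \<Rightarrow>\<^sub>0 'k) set \<Rightarrow> ('i \<times> 'j \<Rightarrow>\<^sub>0 'k) set" where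
  "rel_prod R1 R2 =
     {lext fscale (\<lambda>x. gen (x, y)) r | r y. r \<in> R1} \<union>
     {lext fscale (\<lambda>y. gen (x, y)) r | r x. r \<in> R2}"

lemma compatible_rel_prod:
  assumes "module s"
  shows "compatible (rel_prod R1 R2) s f \<longleftrightarrow>
    (\<forall>y. compatible R1 s (\<lambda>x. f (x, y))) \<and> (\<forall>x. compatible R2 s (\<lambda>y. f (x, y)))"
proof -
  have "(\<forall>r\<in>rel_prod R1 R2. lext s f r = 0) \<longleftrightarrow>
    (\<forall>y. \<forall>r\<in>R1. lext s f (lext fscale (\<lambda>x. gen (x, y)) r) = 0) \<and>
    (\<forall>x. \<forall>r\<in>R2. lext s f (lext fscale (\<lambda>y. gen (x, y)) r) = 0)"
    unfolding rel_prod_def by blast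
  then show ?thesis by (simp add: compatible_def lext_lext[OF assms] assms)
qed

lemma subspace_span: "module.subspace fscale (module.span fscale R)"
  by (rule module.subspace_span[OF module_fscale])

text \<open>
  The universal compatible map.  By \<open>qclass_eq_iff\<close> its extension vanishes only on the span of
  \<open>R\<close>, so it tests membership there.
\<close>

lemma compatible_qclass: "compatible R qscale (\<lambda>i. qclass (module.span fscale R) (gen i))"
proof -
  have "qclass (module.span fscale R) r = 0" if "r \<in> R" for r
    using that qclass_eq_iff[OF subspace_span, of R r 0] module.span_base[OF module_fscale that]
      module_hom.zero[OF module_hom_qclass]
    by simp
  then show ?thesis by (simp add: compatible_def qclass_eq_lext[symmetric])
qed

lemma in_span_iff_qclass:
  "p - q \<in> module.span fscale R \<longleftrightarrow>
     lext qscale (\<lambda>i. qclass (module.span fscale R) (gen i)) p =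
     lext qscale (\<lambda>i. qclass (module.span fscale R) (gen i)) q"
  by (simp add: qclass_eq_iff[OF subspace_span, symmetric] qclass_eq_lext[symmetric])

lemma lext_swap_prod:
  assumes "module s"
  shows "lext s (\<lambda>(x, y). lext s (\<lambda>(u, v). F x y u v) q) p =
         lext s (\<lambda>(u, v). lext s (\<lambda>(x, y). F x y u v) p) q"
  using lext_swap[OF assms, of "\<lambda>i j. F (fst i) (snd i) (fst j) (snd j)"]
  by (simp add: split_def)

lemma lext_cong_prod: "(\<And>x y. F x y = G x y) \<Longrightarrow> lext s (\<lambda>(x, y). F x y) p = lext s (\<lambda>(x, y). G x y) p"
  by (simp add: lext_def)

section \<open>Comodules and coalgebras in terms of formal sums\<close>

text \<open>
  The axioms of a right comodule whose module and coalgebra are presented by relations \<open>RM\<close> and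
  \<open>RC\<close>, with coaction and coproduct given by representing formal sums on generators.  Equalities of
  tensors are membership of a difference in a span of relations; this is a statement about one type,
  from which \<open>coassoc\<close> and \<open>counit\<close> follow for values in every module type.
\<close>

locale formal_comodule =
  fixes RM :: "('m \<Rightarrow>\<^sub>0 'k::comm_ring_1) set" and \<delta> :: "'m \<Rightarrow> ('m \<times> 'c \<Rightarrow>\<^sub>0 'k)"
    and RC :: "('c \<Rightarrow>\<^sub>0 'k) set" and \<Delta> :: "'c \<Rightarrow> ('c \<times> 'c \<Rightarrow>\<^sub>0 'k)" and \<epsilon> :: "'c \<Rightarrow> 'k"
  assumes coact_in_span: "r \<in> RM \<Longrightarrow> lext fscale \<delta> r \<in> module.span fscale (rel_prod RM RC)"
    and coassoc_in_span:
      "lext fscale (\<lambda>(x, c). lext fscale (\<lambda>(x0, x1). gen (x0, x1, c)) (\<delta> x)) (\<delta> m) -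
       lext fscale (\<lambda>(x, c). lext fscale (\<lambda>(c1, c2). gen (x, c1, c2)) (\<Delta> c)) (\<delta> m)
         \<in> module.span fscale (rel_prod RM (rel_prod RC RC))"
    and counit_in_span:
      "lext fscale (\<lambda>(x, c). fscale (\<epsilon> c) (gen x)) (\<delta> m) - gen m \<in> module.span fscale RM"
begin

lemma compatible_coact:
  assumes "module s" "\<And>c. compatible RM s (\<lambda>x. F x c)" "\<And>x. compatible RC s (F x)"
  shows "compatible RM s (\<lambda>m. lext s (\<lambda>(x, c). F x c) (\<delta> m))"
proof -
  have "compatible (rel_prod RM RC) s (\<lambda>(x, c). F x c)"
    using assms by (simp add: compatible_rel_prod)
  then show ?thesis
    using lext_span_zero[OF assms(1) _ coact_in_span, of "\<lambda>(x, c). F x c"]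
    by (simp add: compatible_def lext_lext[OF assms(1), symmetric])
qed

lemma coassoc:
  assumes s: "module s"
    and "\<And>c d. compatible RM s (\<lambda>x. F x c d)" "\<And>x d. compatible RC s (\<lambda>c. F x c d)"
      "\<And>x c. compatible RC s (F x c)"
  shows "lext s (\<lambda>(x, c). lext s (\<lambda>(x0, x1). F x0 x1 c) (\<delta> x)) (\<delta> m) =
         lext s (\<lambda>(x, c). lext s (\<lambda>(c1, c2). F x c1 c2) (\<Delta> c)) (\<delta> m)"
proof -
  have "compatible (rel_prod RM (rel_prod RC RC)) s (\<lambda>(x, c, d). F x c d)"
    using assms by (simp add: compatible_rel_prod)
  from compatible_span_eq[OF s this coassoc_in_span[of m]] show ?thesis
    by (simp add: lext_lext[OF s] split_def s)
qed

lemma counit: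
  assumes s: "module s" and f: "compatible RM s f"
  shows "lext s (\<lambda>(x, c). s (\<epsilon> c) (f x)) (\<delta> m) = f m"
  using compatible_span_eq[OF s f counit_in_span[of m]]
  by (simp add: lext_lext[OF s] split_def s lext_fscale[OF s])

end

text \<open>
  Conversely, it suffices to test the axioms on multilinear maps with values in the universal
  type, because these detect membership in a span.
\<close>

lemma formal_comoduleI:
  fixes RM :: "('m \<Rightarrow>\<^sub>0 'k::comm_ring_1) set" and RC :: "('c \<Rightarrow>\<^sub>0 'k) set"
  assumes coact: "\<And>F :: 'm \<Rightarrow> 'c \<Rightarrow> ('m \<times> 'c, 'k) all_quotients.
      (\<And>c. compatible RM qscale (\<lambda>x. F x c)) \<Longrightarrow> (\<And>x. compatible RC qscale (F x)) \<Longrightarrow>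
      compatible RM qscale (\<lambda>m. lext qscale (\<lambda>(x, c). F x c) (\<delta> m))"
    and coassoc: "\<And>(F :: 'm \<Rightarrow> 'c \<Rightarrow> 'c \<Rightarrow> ('m \<times> 'c \<times> 'c, 'k) all_quotients) m.
      (\<And>c d. compatible RM qscale (\<lambda>x. F x c d)) \<Longrightarrow> (\<And>x d. compatible RC qscale (\<lambda>c. F x c d)) \<Longrightarrow>
      (\<And>x c. compatible RC qscale (F x c)) \<Longrightarrow>
      lext qscale (\<lambda>(x, c). lext qscale (\<lambda>(x0, x1). F x0 x1 c) (\<delta> x)) (\<delta> m) =
      lext qscale (\<lambda>(x, c). lext qscale (\<lambda>(c1, c2). F x c1 c2) (\<Delta> c)) (\<delta> m)"
    and counit: "\<And>(f :: 'm \<Rightarrow> ('m, 'k) all_quotients) m. compatible RM qscale f \<Longrightarrow>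
      lext qscale (\<lambda>(x, c). qscale (\<epsilon> c) (f x)) (\<delta> m) = f m"
  shows "formal_comodule RM \<delta> RC \<Delta> \<epsilon>"
proof
  note q = module_qscale
  fix r assume r: "r \<in> RM"
  let ?R = "rel_prod RM RC"
  let ?g = "\<lambda>x c. qclass (module.span fscale ?R) (gen (x, c))"
  have "compatible ?R qscale (\<lambda>(x, c). ?g x c)"
    using compatible_qclass[of ?R] by (simp add: split_def)
  then have "compatible RM qscale (\<lambda>m. lext qscale (\<lambda>(x, c). ?g x c) (\<delta> m))"
    by (intro coact) (simp_all add: compatible_rel_prod[OF q])
  then have "lext fscale \<delta> r - 0 \<in> module.span fscale ?R"
    unfolding in_span_iff_qclass using r by (simp add: compatible_def lext_lext[OF q] split_def)
  then show "lext fscale \<delta> r \<in> module.span fscale ?R" by simp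
next
  note q = module_qscale
  fix m
  let ?R = "rel_prod RM (rel_prod RC RC)"
  let ?g = "\<lambda>x c d. qclass (module.span fscale ?R) (gen (x, c, d))"
  have "compatible ?R qscale (\<lambda>(x, c, d). ?g x c d)"
    using compatible_qclass[of ?R] by (simp add: split_def)
  from coassoc[of ?g m] this
  show "lext fscale (\<lambda>(x, c). lext fscale (\<lambda>(x0, x1). gen (x0, x1, c)) (\<delta> x)) (\<delta> m) -
        lext fscale (\<lambda>(x, c). lext fscale (\<lambda>(c1, c2). gen (x, c1, c2)) (\<Delta> c)) (\<delta> m)
         \<in> module.span fscale ?R"
    unfolding in_span_iff_qclass
    by (simp add: compatible_rel_prod[OF q] lext_lext[OF q] split_def q)
next
  note q = module_qscale
  fix m
  from counit[OF compatible_qclass, of m]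
  show "lext fscale (\<lambda>(x, c). fscale (\<epsilon> c) (gen x)) (\<delta> m) - gen m \<in> module.span fscale RM"
    unfolding in_span_iff_qclass
    by (simp add: lext_lext[OF q] split_def q lext_fscale[OF q])
qed

definition prod_coact ::
  "('m \<Rightarrow> ('m \<times> 'c \<Rightarrow>\<^sub>0 'k::comm_ring_1)) \<Rightarrow> ('n \<Rightarrow> ('n \<times> 'd \<Rightarrow>\<^sub>0 'k))
     \<Rightarrow> 'm \<times> 'n \<Rightarrow> (('m \<times> 'n) \<times> ('c \<times> 'd) \<Rightarrow>\<^sub>0 'k)" where
  "prod_coact \<delta>1 \<delta>2 = (\<lambda>(m, n). lext fscale (\<lambda>(m0, m1).
     lext fscale (\<lambda>(n0, n1). gen ((m0, n0), (m1, n1))) (\<delta>2 n)) (\<delta>1 m))"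

lemma lext_prod_coact:
  assumes "module s"
  shows "lext s F (prod_coact \<delta>1 \<delta>2 (m, n)) =
    lext s (\<lambda>(m0, m1). lext s (\<lambda>(n0, n1). F ((m0, n0), (m1, n1))) (\<delta>2 n)) (\<delta>1 m)"
  by (simp add: prod_coact_def lext_lext[OF assms] split_def assms)

lemma compatible_lext_prod:
  assumes "module s" "\<And>x y. compatible R s (\<lambda>i. F i x y)"
  shows "compatible R s (\<lambda>i. lext s (\<lambda>(x, y). F i x y) q)"
  using compatible_lext[OF assms(1), of R "\<lambda>i j. F i (fst j) (snd j)"] assms(2)
  by (simp add: split_def)

text \<open>
  Coassociativity for pairs is coassociativity in each component; in between, the two inner
  splittings, which belong to different components, are exchanged.
\<close>

theorem formal_comodule_prod:
  fixes \<delta>1 :: "'m \<Rightarrow> ('m \<times> 'c \<Rightarrow>\<^sub>0 'k::comm_ring_1)" and \<delta>2 :: "'n \<Rightarrow> ('n \<times> 'd \<Rightarrow>\<^sub>0 'k)"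
  assumes "formal_comodule RM1 \<delta>1 RC1 \<Delta>1 \<epsilon>1" "formal_comodule RM2 \<delta>2 RC2 \<Delta>2 \<epsilon>2"
  shows "formal_comodule (rel_prod RM1 RM2) (prod_coact \<delta>1 \<delta>2)
    (rel_prod RC1 RC2) (prod_coact \<Delta>1 \<Delta>2) (\<lambda>(c, d). \<epsilon>1 c * \<epsilon>2 d)"
proof -
  interpret M1: formal_comodule RM1 \<delta>1 RC1 \<Delta>1 \<epsilon>1 by fact
  interpret M2: formal_comodule RM2 \<delta>2 RC2 \<Delta>2 \<epsilon>2 by fact
  note q = module_qscale
  note rp = compatible_rel_prod[OF q] lext_prod_coact[OF q]
  show ?thesis
  proof (rule formal_comoduleI)
    fix F :: "_ \<Rightarrow> _ \<Rightarrow> (_, _) all_quotients"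
    assume "\<And>c. compatible (rel_prod RM1 RM2) qscale (\<lambda>x. F x c)"
      "\<And>x. compatible (rel_prod RC1 RC2) qscale (F x)"
    then show "compatible (rel_prod RM1 RM2) qscale
      (\<lambda>m. lext qscale (\<lambda>(x, c). F x c) (prod_coact \<delta>1 \<delta>2 m))"
      by (simp add: rp)
        (intro allI conjI M1.compatible_coact M2.compatible_coact compatible_lext_prod q; simp)
  next
    fix F :: "_ \<Rightarrow> _ \<Rightarrow> _ \<Rightarrow> (_, _) all_quotients" and m :: "'m \<times> 'n"
    assume F: "\<And>c d. compatible (rel_prod RM1 RM2) qscale (\<lambda>x. F x c d)"
      "\<And>x d. compatible (rel_prod RC1 RC2) qscale (\<lambda>c. F x c d)"
      "\<And>x c. compatible (rel_prod RC1 RC2) qscale (F x c)"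
    obtain m1 m2 where m: "m = (m1, m2)" by (cases m)
    have "lext qscale (\<lambda>(x, c). lext qscale (\<lambda>(y, d). lext qscale (\<lambda>(x0, x1).
            lext qscale (\<lambda>(y0, y1). F (x0, y0) (x1, y1) (c, d)) (\<delta>2 y)) (\<delta>1 x)) (\<delta>2 m2)) (\<delta>1 m1) =
          lext qscale (\<lambda>(x, c). lext qscale (\<lambda>(x0, x1). lext qscale (\<lambda>(y, d).
            lext qscale (\<lambda>(y0, y1). F (x0, y0) (x1, y1) (c, d)) (\<delta>2 y)) (\<delta>2 m2)) (\<delta>1 x)) (\<delta>1 m1)"
      by (intro lext_cong_prod lext_swap_prod q)
    also have "\<dots> =
          lext qscale (\<lambda>(x, c). lext qscale (\<lambda>(x0, x1). lext qscale (\<lambda>(y, d).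
            lext qscale (\<lambda>(d1, d2). F (x0, y) (x1, d1) (c, d2)) (\<Delta>2 d)) (\<delta>2 m2)) (\<delta>1 x)) (\<delta>1 m1)"
      using F by (intro lext_cong_prod M2.coassoc q) (simp_all add: rp)
    also have "\<dots> =
          lext qscale (\<lambda>(x, c). lext qscale (\<lambda>(c1, c2). lext qscale (\<lambda>(y, d).
            lext qscale (\<lambda>(d1, d2). F (x, y) (c1, d1) (c2, d2)) (\<Delta>2 d)) (\<delta>2 m2)) (\<Delta>1 c)) (\<delta>1 m1)"
      using F by (intro M1.coassoc q compatible_lext_prod) (simp_all add: rp)
    also have "\<dots> =
          lext qscale (\<lambda>(x, c). lext qscale (\<lambda>(y, d). lext qscale (\<lambda>(c1, c2).
            lext qscale (\<lambda>(d1, d2). F (x, y) (c1, d1) (c2, d2)) (\<Delta>2 d)) (\<Delta>1 c)) (\<delta>2 m2)) (\<delta>1 m1)"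
      by (intro lext_cong_prod lext_swap_prod q)
    finally show "lext qscale (\<lambda>(x, c). lext qscale (\<lambda>(x0, x1). F x0 x1 c)
        (prod_coact \<delta>1 \<delta>2 x)) (prod_coact \<delta>1 \<delta>2 m) =
      lext qscale (\<lambda>(x, c). lext qscale (\<lambda>(c1, c2). F x c1 c2)
        (prod_coact \<Delta>1 \<Delta>2 c)) (prod_coact \<delta>1 \<delta>2 m)"
      by (simp add: m rp)
  next
    fix f :: "_ \<Rightarrow> (_, _) all_quotients" and m :: "'m \<times> 'n"
    assume f: "compatible (rel_prod RM1 RM2) qscale f"
    obtain m1 m2 where m: "m = (m1, m2)" by (cases m)
    have "lext qscale (\<lambda>(x, c). lext qscale (\<lambda>(y, d). qscale (\<epsilon>1 c * \<epsilon>2 d) (f (x, y)))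
        (\<delta>2 m2)) (\<delta>1 m1) =
      lext qscale (\<lambda>(x, c). qscale (\<epsilon>1 c) (lext qscale (\<lambda>(y, d). qscale (\<epsilon>2 d) (f (x, y)))
        (\<delta>2 m2))) (\<delta>1 m1)"
      by (simp add: lext_scale_fun[OF q, symmetric] split_def module.scale_scale[OF q])
    also have "\<dots> = f (m1, m2)"
      using f by (simp add: rp M1.counit[OF q] M2.counit[OF q])
    finally show "lext qscale (\<lambda>(x, c). qscale (case c of (c, d) \<Rightarrow> \<epsilon>1 c * \<epsilon>2 d) (f x))
        (prod_coact \<delta>1 \<delta>2 m) = f m"
      by (simp add: m rp)
  qed
qed

section \<open>Convolution\<close>

text \<open>
  \<open>f(m\<^sub>0) \<cdot> g(m\<^sub>1)\<close> for a pairing \<open>B\<close>.  With \<open>B\<close> the product of scalars this is the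
  convolution product of functionals; with a scalar multiplication, in either order, it is the action
  of functionals on vector valued maps from the left or from the right.
\<close>

definition conv ::
  "('k::comm_ring_1 \<Rightarrow> 'v::ab_group_add \<Rightarrow> 'v) \<Rightarrow> ('a \<Rightarrow> 'b \<Rightarrow> 'v) \<Rightarrow> ('m \<Rightarrow> ('m \<times> 'c \<Rightarrow>\<^sub>0 'k))
     \<Rightarrow> ('m \<Rightarrow> 'a) \<Rightarrow> ('c \<Rightarrow> 'b) \<Rightarrow> 'm \<Rightarrow> 'v" where
  "conv s B \<delta> f g m = lext s (\<lambda>(x, c). B (f x) (g c)) (\<delta> m)"

lemma bilinear_mapD:
  assumes "bilinear_map s t u B"
  shows "module_hom t u (B x)" "module_hom s u (\<lambda>x. B x y)"
    "module s" "module t" "module u"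
  using assms by (auto simp: bilinear_map_def module_hom_iff)

lemma bilinear_scale:
  assumes "module s"
  shows "bilinear_map (*) s s s"
proof -
  interpret module s by fact
  show ?thesis
    by (simp add: bilinear_map_def module_hom_iff module_mult assms
        scale_right_distrib scale_left_distrib mult.commute)
qed

lemma bilinear_scale_flip:
  assumes "module s"
  shows "bilinear_map s (*) s (\<lambda>v c. s c v)"
proof -
  interpret module s by fact
  show ?thesis
    by (simp add: bilinear_map_def module_hom_iff module_mult assms
        scale_right_distrib scale_left_distrib mult.commute)
qed

lemmas bilinear_mult = bilinear_scale[OF module_mult]

context formal_comodule
begin

text \<open>
  The single source of all associativity rules below: the pairings may differ, as long as
  bracketing three values in the two ways gives the same result.
\<close>

lemma conv_assoc:
  assumes B: "bilinear_map t s3 s B" "bilinear_map s1 s2 t B'"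
      "bilinear_map s1 u s C" "bilinear_map s2 s3 u C'"
    and eq: "\<And>a b c. B (B' a b) c = C a (C' b c)"
    and f: "compatible RM s1 f" and g: "compatible RC s2 g" and h: "compatible RC s3 h"
  shows "conv s B \<delta> (conv t B' \<delta> f g) h m = conv s C \<delta> f (conv u C' \<Delta> g h) m"
proof -
  have "conv s B \<delta> (conv t B' \<delta> f g) h m =
    lext s (\<lambda>(x, c). lext s (\<lambda>(x0, x1). B (B' (f x0) (g x1)) (h c)) (\<delta> x)) (\<delta> m)"
    unfolding conv_def
    by (intro lext_cong_prod) (simp add: module_hom_lext_eq[OF bilinear_mapD(2)[OF B(1)]] split_def)
  also have "\<dots> = lext s (\<lambda>(x, c). lext s (\<lambda>(c1, c2). B (B' (f x) (g c1)) (h c2)) (\<Delta> c)) (\<delta> m)"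
  proof (rule coassoc)
    show "module s" by (rule bilinear_mapD(5)[OF B(1)])
    show "compatible RM s (\<lambda>x. B (B' (f x) (g c)) (h d))" for c d
      by (rule compatible_compose[OF compatible_compose[OF f bilinear_mapD(2)[OF B(2)]]
            bilinear_mapD(2)[OF B(1)]])
    show "compatible RC s (\<lambda>c. B (B' (f x) (g c)) (h d))" for x d
      by (rule compatible_compose[OF compatible_compose[OF g bilinear_mapD(1)[OF B(2)]]
            bilinear_mapD(2)[OF B(1)]])
    show "compatible RC s (\<lambda>d. B (B' (f x) (g c)) (h d))" for x c
      by (rule compatible_compose[OF h bilinear_mapD(1)[OF B(1)]])
  qed
  also have "\<dots> = conv s C \<delta> f (conv u C' \<Delta> g h) m"
    unfolding conv_def
    by (intro lext_cong_prod)
      (simp add: module_hom_lext_eq[OF bilinear_mapD(1)[OF B(3)]] split_def eq)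
  finally show ?thesis .
qed

lemma compatible_conv:
  assumes B: "bilinear_map s1 s2 s B" and f: "compatible RM s1 f" and g: "compatible RC s2 g"
  shows "compatible RM s (conv s B \<delta> f g)"
  unfolding conv_def[abs_def]
proof (rule compatible_coact)
  show "module s" by (rule bilinear_mapD(5)[OF B])
  show "compatible RM s (\<lambda>x. B (f x) (g c))" for c
    by (rule compatible_compose[OF f bilinear_mapD(2)[OF B]])
  show "compatible RC s (\<lambda>c. B (f x) (g c))" for x
    by (rule compatible_compose[OF g bilinear_mapD(1)[OF B]])
qed

lemma conv_scale_right:
  assumes s: "module s" and R: "compatible RM s f" "compatible RC (*) a" "compatible RC (*) b"
  shows "conv s (\<lambda>v c. s c v) \<delta> (conv s (\<lambda>v c. s c v) \<delta> f a) b m =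
         conv s (\<lambda>v c. s c v) \<delta> f (conv (*) (*) \<Delta> a b) m"
  by (rule conv_assoc[OF bilinear_scale_flip[OF s] bilinear_scale_flip[OF s]
        bilinear_scale_flip[OF s] bilinear_mult _ R])
    (simp add: module.scale_scale[OF s] mult.commute)

lemma conv_scale_pull_right:
  assumes B: "bilinear_map s1 s2 s B"
    and R: "compatible RM s1 f" "compatible RC s2 g" "compatible RC (*) b"
  shows "conv s B \<delta> f (conv s2 (\<lambda>v c. s2 c v) \<Delta> g b) m =
         conv s (\<lambda>v c. s c v) \<delta> (conv s B \<delta> f g) b m"
  using bilinear_mapD[OF B]
  by (intro conv_assoc[symmetric, OF bilinear_scale_flip B B bilinear_scale_flip _ R])
    (auto simp: module_hom_iff)

lemma conv_counit_right:
  assumes "module s" "compatible RM s f"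
  shows "conv s (\<lambda>v c. s c v) \<delta> f \<epsilon> m = f m"
  unfolding conv_def by (rule counit[OF assms])

end

text \<open>
  A coalgebra is a comodule over itself that also has a left counit.
\<close>

locale formal_coalgebra = formal_comodule R \<Delta> R \<Delta> \<epsilon>
  for R :: "('c \<Rightarrow>\<^sub>0 'k::comm_ring_1) set" and \<Delta> \<epsilon> +
  assumes compatible_counit: "compatible R (*) \<epsilon>"
    and counit_left_in_span:
      "lext fscale (\<lambda>(x, y). fscale (\<epsilon> x) (gen y)) (\<Delta> c) - gen c \<in> module.span fscale R"
begin

lemma counit_left:
  assumes s: "module s" and f: "compatible R s f"
  shows "lext s (\<lambda>(x, y). s (\<epsilon> x) (f y)) (\<Delta> c) = f c"
  using compatible_span_eq[OF s f counit_left_in_span[of c]]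
  by (simp add: lext_lext[OF s] split_def s lext_fscale[OF s])

lemma conv_counit_left:
  assumes "module s" "compatible R s f"
  shows "conv s s \<Delta> \<epsilon> f c = f c"
  unfolding conv_def by (rule counit_left[OF assms])

lemma conv_scale_left:
  assumes s: "module s" and R: "compatible R (*) a" "compatible R (*) b" "compatible R s f"
  shows "conv s s \<Delta> (conv (*) (*) \<Delta> a b) f c = conv s s \<Delta> a (conv s s \<Delta> b f) c"
  by (rule conv_assoc[OF bilinear_scale[OF s] bilinear_mult bilinear_scale[OF s]
        bilinear_scale[OF s] _ R])
    (simp add: module.scale_scale[OF s])

lemma conv_scale_middle:
  assumes s: "module s" and R: "compatible R (*) a" "compatible R s f" "compatible R (*) b"
  shows "conv s (\<lambda>v c. s c v) \<Delta> (conv s s \<Delta> a f) b c =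
         conv s s \<Delta> a (conv s (\<lambda>v c. s c v) \<Delta> f b) c"
  by (rule conv_assoc[OF bilinear_scale_flip[OF s] bilinear_scale[OF s] bilinear_scale[OF s]
        bilinear_scale_flip[OF s] _ R])
    (simp add: module.scale_left_commute[OF s])

lemma conv_scale_pull_left:
  assumes B: "bilinear_map s1 s2 s B"
    and R: "compatible R (*) a" "compatible R s1 f" "compatible R s2 g"
  shows "conv s B \<Delta> (conv s1 s1 \<Delta> a f) g c = conv s s \<Delta> a (conv s B \<Delta> f g) c"
  using bilinear_mapD[OF B]
  by (intro conv_assoc[OF B bilinear_scale bilinear_scale B _ R])
    (auto simp: module_hom_iff)

text \<open>
  Conjugating \<open>f\<close> by \<open>b\<close> and then by \<open>a\<close> is conjugating it by \<open>a b\<close>.  Both ways to bracket a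
  twisted triple product have the form on the left.
\<close>

lemma conv_sandwich:
  assumes s: "module s"
    and R: "compatible R (*) a" "compatible R (*) b" "compatible R (*) a'" "compatible R (*) b'"
      "compatible R s f"
  shows "conv s s \<Delta> a (conv s (\<lambda>v c. s c v) \<Delta>
           (conv s s \<Delta> b (conv s (\<lambda>v c. s c v) \<Delta> f b')) a') c =
         conv s s \<Delta> (conv (*) (*) \<Delta> a b)
           (conv s (\<lambda>v c. s c v) \<Delta> f (conv (*) (*) \<Delta> b' a')) c"
proof -
  have b': "compatible R s (conv s (\<lambda>v c. s c v) \<Delta> f x)" if "compatible R (*) x" for x
    by (rule compatible_conv[OF bilinear_scale_flip[OF s] R(5) that])
  have ba: "compatible R (*) (conv (*) (*) \<Delta> b' a')"
    by (rule compatible_conv[OF bilinear_mult R(4,3)])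
  have "conv s (\<lambda>v c. s c v) \<Delta> (conv s s \<Delta> b (conv s (\<lambda>v c. s c v) \<Delta> f b')) a' =
    conv s s \<Delta> b (conv s (\<lambda>v c. s c v) \<Delta> f (conv (*) (*) \<Delta> b' a'))"
    by (intro ext) (simp add: conv_scale_middle[OF s R(2) b'[OF R(4)] R(3)]
        ext[OF conv_scale_right[OF s R(5,4,3)]])
  then show ?thesis
    by (simp add: conv_scale_left[OF s R(1,2) b'[OF ba]])
qed

text \<open>
  The rule \<open>a b = c d \<Longrightarrow> b d\<inverse> = a\<inverse> c\<close> in the convolution monoid.  It turns the cocycle
  identity into its mixed forms and into the identity for the inverse.
\<close>

lemma conv_cross:
  assumes R: "compatible R (*) a" "compatible R (*) b" "compatible R (*) c" "compatible R (*) d"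
      "compatible R (*) a'" "compatible R (*) d'"
    and eq: "conv (*) (*) \<Delta> a b = conv (*) (*) \<Delta> c d"
    and inv: "conv (*) (*) \<Delta> a' a = \<epsilon>" "conv (*) (*) \<Delta> d d' = \<epsilon>"
  shows "conv (*) (*) \<Delta> b d' = conv (*) (*) \<Delta> a' c"
proof -
  let ?c = "conv (*) (*) \<Delta>"
  have assoc: "?c (?c f g) h = ?c f (?c g h)"
    if "compatible R (*) f" "compatible R (*) g" "compatible R (*) h" for f g h
    using that
    by (intro ext conv_assoc[OF bilinear_mult bilinear_mult bilinear_mult bilinear_mult])
      (simp_all add: mult.assoc)
  have closed: "compatible R (*) (?c f g)" if "compatible R (*) f" "compatible R (*) g" for f g
    by (rule compatible_conv[OF bilinear_mult that])
  have left: "?c \<epsilon> f = f" if "compatible R (*) f" for f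
    using that by (intro ext conv_counit_left module_mult)
  have right: "?c f \<epsilon> = f" if "compatible R (*) f" for f
    using conv_counit_right[OF module_mult that] by (intro ext) (simp add: conv_def mult.commute)
  have "?c b d' = ?c (?c a' a) (?c b d')"
    by (simp add: inv left closed R)
  also have "\<dots> = ?c a' (?c (?c a b) d')"
    by (simp add: assoc closed R)
  also have "\<dots> = ?c a' (?c c (?c d d'))"
    by (simp add: eq assoc closed R)
  also have "\<dots> = ?c a' c"
    by (simp add: inv right R)
  finally show ?thesis .
qed

end

theorem formal_coalgebra_prod:
  fixes \<Delta>1 :: "'c \<Rightarrow> ('c \<times> 'c \<Rightarrow>\<^sub>0 'k::comm_ring_1)" and \<Delta>2 :: "'d \<Rightarrow> ('d \<times> 'd \<Rightarrow>\<^sub>0 'k)"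
  assumes "formal_coalgebra R1 \<Delta>1 \<epsilon>1" "formal_coalgebra R2 \<Delta>2 \<epsilon>2"
  shows "formal_coalgebra (rel_prod R1 R2) (prod_coact \<Delta>1 \<Delta>2) (\<lambda>(c, d). \<epsilon>1 c * \<epsilon>2 d)"
proof -
  interpret M1: formal_coalgebra R1 \<Delta>1 \<epsilon>1 by fact
  interpret M2: formal_coalgebra R2 \<Delta>2 \<epsilon>2 by fact
  note q = module_qscale
  note rp = compatible_rel_prod[OF q] lext_prod_coact[OF q]
  interpret P: formal_comodule "rel_prod R1 R2" "prod_coact \<Delta>1 \<Delta>2" "rel_prod R1 R2"
    "prod_coact \<Delta>1 \<Delta>2" "\<lambda>(c, d). \<epsilon>1 c * \<epsilon>2 d"
    by (intro formal_comodule_prod M1.formal_comodule_axioms M2.formal_comodule_axioms)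
  show ?thesis
  proof
    have "compatible R1 (*) (\<lambda>x. \<epsilon>1 x * \<epsilon>2 y)" for y
      by (rule compatible_compose[OF M1.compatible_counit bilinear_mapD(2)[OF bilinear_mult]])
    moreover have "compatible R2 (*) (\<lambda>y. \<epsilon>1 x * \<epsilon>2 y)" for x
      by (rule compatible_compose[OF M2.compatible_counit bilinear_mapD(1)[OF bilinear_mult]])
    ultimately show "compatible (rel_prod R1 R2) (*) (\<lambda>(c, d). \<epsilon>1 c * \<epsilon>2 d)"
      by (simp add: compatible_rel_prod module_mult)
  next
    fix c :: "'c \<times> 'd"
    obtain c1 c2 where c: "c = (c1, c2)" by (cases c)
    let ?f = "\<lambda>i. qclass (module.span fscale (rel_prod R1 R2)) (gen i)"
    have f: "compatible (rel_prod R1 R2) qscale ?f"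
      by (rule compatible_qclass)
    have "lext qscale (\<lambda>(x, u). lext qscale (\<lambda>(y, v). qscale (\<epsilon>1 x * \<epsilon>2 y) (?f (u, v)))
        (\<Delta>2 c2)) (\<Delta>1 c1) =
      lext qscale (\<lambda>(x, u). qscale (\<epsilon>1 x) (lext qscale (\<lambda>(y, v). qscale (\<epsilon>2 y) (?f (u, v)))
        (\<Delta>2 c2))) (\<Delta>1 c1)"
      by (simp add: lext_scale_fun[OF q, symmetric] split_def module.scale_scale[OF q])
    also have "\<dots> = ?f (c1, c2)"
      using f by (simp add: rp M1.counit_left[OF q] M2.counit_left[OF q])
    finally show "lext fscale (\<lambda>(x, y). fscale (case x of (c, d) \<Rightarrow> \<epsilon>1 c * \<epsilon>2 d) (gen y))
        (prod_coact \<Delta>1 \<Delta>2 c) - gen c \<in> module.span fscale (rel_prod R1 R2)"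
      unfolding in_span_iff_qclass
      by (simp add: c rp lext_lext[OF q] lext_fscale[OF q] split_def q)
  qed
qed

text \<open>
  \<open>(f a') (a g) = f g\<close>: the reason why a twist that multiplies by \<open>\<gamma>'\<close> on the right of one
  factor and by \<open>\<gamma>\<close> on the left of the next one is compatible with coproducts and
  coactions.
\<close>

lemma conv_cancel_middle:
  assumes "formal_comodule RM \<delta> RC \<Delta> \<epsilon>" "formal_coalgebra RC \<Delta> \<epsilon>"
    and B: "bilinear_map s1 s2 s B"
    and R: "compatible RM s1 f" "compatible RC (*) a'" "compatible RC (*) a" "compatible RC s2 g"
    and inv: "conv (*) (*) \<Delta> a' a = \<epsilon>"
  shows "conv s B \<delta> (conv s1 (\<lambda>v c. s1 c v) \<delta> f a') (conv s2 s2 \<Delta> a g) m = conv s B \<delta> f g m"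
proof -
  interpret M: formal_comodule RM \<delta> RC \<Delta> \<epsilon> by fact
  interpret C: formal_coalgebra RC \<Delta> \<epsilon> by fact
  note B' = bilinear_mapD[OF B]
  have "conv s2 s2 \<Delta> a' (conv s2 s2 \<Delta> a g) = g"
    using C.conv_scale_left[OF B'(4) R(2,3,4)] C.conv_counit_left[OF B'(4) R(4)]
    by (intro ext) (simp add: inv)
  moreover have "conv s B \<delta> (conv s1 (\<lambda>v c. s1 c v) \<delta> f a') (conv s2 s2 \<Delta> a g) m =
    conv s B \<delta> f (conv s2 s2 \<Delta> a' (conv s2 s2 \<Delta> a g)) m"
    using bilinear_mapD(1,2)[OF B]
    by (intro M.conv_assoc[OF B bilinear_scale_flip B bilinear_scale _ R(1,2)]
        C.compatible_conv[OF bilinear_scale R(3,4)] B'(3,4))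
      (auto simp: module_hom_iff)
  ultimately show ?thesis by simp
qed

section \<open>Hopf algebras and comodule algebras in terms of formal sums\<close>

text \<open>
  The relations that present a module on the set of all its elements; compatible functions are
  the linear maps.
\<close>

definition linear_rels :: "('k::comm_ring_1 \<Rightarrow> 'm::ab_group_add \<Rightarrow> 'm) \<Rightarrow> ('m \<Rightarrow>\<^sub>0 'k) set" where
  "linear_rels s = {gen (x + y) - gen x - gen y | x y. True} \<union>
     {gen (s c x) - fscale c (gen x) | c x. True}"

lemma compatible_linear_rels:
  assumes "module s" "module t"
  shows "compatible (linear_rels s) t f \<longleftrightarrow> module_hom s t f"
proof -
  have "compatible (linear_rels s) t f \<longleftrightarrow>
    (\<forall>x y. lext t f (gen (x + y) - gen x - gen y) = 0) \<and>
    (\<forall>c x. lext t f (gen (s c x) - fscale c (gen x)) = 0)"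
    unfolding compatible_def linear_rels_def by blast
  also have "\<dots> \<longleftrightarrow> module_hom s t f"
    by (simp add: module_hom_iff assms lext_diff lext_fscale diff_diff_eq lext_add)
  finally show ?thesis .
qed

text \<open>
  A submodule is determined by the maps that kill it.
\<close>

lemma span_eqI:
  fixes R R' :: "('i \<Rightarrow>\<^sub>0 'k::comm_ring_1) set"
  assumes "\<And>f :: 'i \<Rightarrow> ('i, 'k) all_quotients. compatible R qscale f \<longleftrightarrow> compatible R' qscale f"
  shows "module.span fscale R = module.span fscale R'"
proof -
  have *: "p \<in> module.span fscale R2"
    if sub: "\<And>f :: 'i \<Rightarrow> ('i, 'k) all_quotients. compatible R2 qscale f \<Longrightarrow> compatible R1 qscale f"
      and p: "p \<in> module.span fscale R1" for R1 R2 p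
    using lext_span_zero[OF module_qscale _ p, of "\<lambda>i. qclass (module.span fscale R2) (gen i)"]
      sub[OF compatible_qclass] in_span_iff_qclass[of p 0 R2]
    by (simp add: compatible_def)
  show ?thesis using *[of R R'] *[of R' R] assms by blast
qed

lemma compatible_Un: "compatible (R \<union> R') s f \<longleftrightarrow> compatible R s f \<and> compatible R' s f"
  by (auto simp: compatible_def)

lemma compatible_Collect4:
  "compatible {F x y z w | x y z w. True} s f \<longleftrightarrow> (\<forall>x y z w. lext s f (F x y z w) = 0)"
  unfolding compatible_def by blast

lemma compatible_tensor_rels:
  assumes "module sM" "module sN" "module s"
  shows "compatible (tensor_rels sM sN) s f \<longleftrightarrow>
    compatible (rel_prod (linear_rels sM) (linear_rels sN)) s f"
proof -
  have "compatible (tensor_rels sM sN) s f \<longleftrightarrow>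
    (\<forall>x x' y. lext s f (gen (x + x', y) - gen (x, y) - gen (x', y)) = 0) \<and>
    (\<forall>x y y'. lext s f (gen (x, y + y') - gen (x, y) - gen (x, y')) = 0) \<and>
    (\<forall>c x y. lext s f (gen (sM c x, y) - fscale c (gen (x, y))) = 0) \<and>
    (\<forall>c x y. lext s f (gen (x, sN c y) - fscale c (gen (x, y))) = 0)"
    unfolding tensor_rels_def compatible_Un unfolding compatible_def by blast
  also have "\<dots> \<longleftrightarrow> compatible (rel_prod (linear_rels sM) (linear_rels sN)) s f"
    by (auto simp: compatible_rel_prod compatible_linear_rels assms module_hom_iff lext_diff
        lext_fscale diff_diff_eq lext_add)
  finally show ?thesis .
qed

lemma tensor_null_eq:
  assumes "module sM" "module sN"
  shows "tensor_null sM sN = module.span fscale (rel_prod (linear_rels sM) (linear_rels sN))"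
  unfolding tensor_null_def
  by (intro span_eqI compatible_tensor_rels assms module_qscale)

lemma tensor3_null_eq:
  assumes "module sL" "module sM" "module sN"
  shows "tensor3_null sL sM sN =
     module.span fscale (rel_prod (linear_rels sL) (rel_prod (linear_rels sM) (linear_rels sN)))"
  unfolding tensor3_null_def
proof (intro span_eqI, unfold compatible_Un)
  fix f :: "'b \<times> 'c \<times> 'd \<Rightarrow> ('b \<times> 'c \<times> 'd, 'a) all_quotients"
  note q = module_qscale
  let ?e = "lext qscale f"
  have "(compatible {gen (x + x', y, z) - gen (x, y, z) - gen (x', y, z) | x x' y z. True} qscale f \<and>
      compatible {gen (x, y + y', z) - gen (x, y, z) - gen (x, y', z) | x y y' z. True} qscale f \<and>
      compatible {gen (x, y, z + z') - gen (x, y, z) - gen (x, y, z') | x y z z'. True} qscale f \<and>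
      compatible {gen (sL c x, y, z) - fscale c (gen (x, y, z)) | c x y z. True} qscale f \<and>
      compatible {gen (x, sM c y, z) - fscale c (gen (x, y, z)) | c x y z. True} qscale f \<and>
      compatible {gen (x, y, sN c z) - fscale c (gen (x, y, z)) | c x y z. True} qscale f) \<longleftrightarrow>
    (\<forall>x x' y z. ?e (gen (x + x', y, z) - gen (x, y, z) - gen (x', y, z)) = 0) \<and>
    (\<forall>x y y' z. ?e (gen (x, y + y', z) - gen (x, y, z) - gen (x, y', z)) = 0) \<and>
    (\<forall>x y z z'. ?e (gen (x, y, z + z') - gen (x, y, z) - gen (x, y, z')) = 0) \<and>
    (\<forall>c x y z. ?e (gen (sL c x, y, z) - fscale c (gen (x, y, z))) = 0) \<and>
    (\<forall>c x y z. ?e (gen (x, sM c y, z) - fscale c (gen (x, y, z))) = 0) \<and>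
    (\<forall>c x y z. ?e (gen (x, y, sN c z) - fscale c (gen (x, y, z))) = 0)"
    by (simp only: compatible_Collect4)
  also have "\<dots> \<longleftrightarrow>
    compatible (rel_prod (linear_rels sL) (rel_prod (linear_rels sM) (linear_rels sN))) qscale f"
    by (auto simp: compatible_rel_prod q compatible_linear_rels assms module_hom_iff lext_diff
        lext_fscale diff_diff_eq lext_add)
  finally show "((((compatible {gen (x + x', y, z) - gen (x, y, z) - gen (x', y, z) | x x' y z. True} qscale f \<and>
      compatible {gen (x, y + y', z) - gen (x, y, z) - gen (x, y', z) | x y y' z. True} qscale f) \<and>
      compatible {gen (x, y, z + z') - gen (x, y, z) - gen (x, y, z') | x y z z'. True} qscale f) \<and>
      compatible {gen (sL c x, y, z) - fscale c (gen (x, y, z)) | c x y z. True} qscale f) \<and>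
      compatible {gen (x, sM c y, z) - fscale c (gen (x, y, z)) | c x y z. True} qscale f) \<and>
      compatible {gen (x, y, sN c z) - fscale c (gen (x, y, z)) | c x y z. True} qscale f \<longleftrightarrow>
    compatible (rel_prod (linear_rels sL) (rel_prod (linear_rels sM) (linear_rels sN))) qscale f"
    by (simp only: conj_assoc)
qed

lemma subspace_tensor_null: "module.subspace fscale (tensor_null sM sN)"
  unfolding tensor_null_def by (rule subspace_span)

lemma tsum_tclass:
  assumes "bilinear_map sM sN s F"
  shows "tsum s (tclass (tensor_null sM sN) p) F = lext s (\<lambda>(x, y). F x y) p"
proof -
  note B = bilinear_mapD[OF assms]
  have "compatible (rel_prod (linear_rels sM) (linear_rels sN)) s (\<lambda>(x, y). F x y)"
    by (simp add: compatible_rel_prod B compatible_linear_rels)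
  from compatible_span_eq[OF B(5) this, of "trep (tclass (tensor_null sM sN) p)" p]
  show ?thesis
    using trep_tclass[OF subspace_tensor_null, of sM sN p] by (simp add: tsum_eq_lext tensor_null_eq B)
qed

text \<open>
  The universal bilinear map, with values in the common type of all quotients.
\<close>

definition tens ::
  "('k::comm_ring_1 \<Rightarrow> 'm::ab_group_add \<Rightarrow> 'm) \<Rightarrow> ('k \<Rightarrow> 'n::ab_group_add \<Rightarrow> 'n)
     \<Rightarrow> 'm \<Rightarrow> 'n \<Rightarrow> ('m \<times> 'n, 'k) all_quotients" where
  "tens sM sN x y = qclass (tensor_null sM sN) (gen (x, y))"

lemma bilinear_tens:
  assumes "module sM" "module sN"
  shows "bilinear_map sM sN qscale (tens sM sN)"
  using compatible_qclass[of "rel_prod (linear_rels sM) (linear_rels sN)"]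
  by (simp add: bilinear_map_def tens_def[abs_def] compatible_rel_prod[OF module_qscale] tensor_null_eq[OF assms]
      compatible_linear_rels[OF assms(1) module_qscale] compatible_linear_rels[OF assms(2) module_qscale])

lemma tclass_tensor_eq_iff:
  "tclass (tensor_null sM sN) p = tclass (tensor_null sM sN) q \<longleftrightarrow>
     lext qscale (\<lambda>(x, y). tens sM sN x y) p = lext qscale (\<lambda>(x, y). tens sM sN x y) q"
  by (simp add: tclass_eq_iff[OF subspace_tensor_null] qclass_eq_lext[of _ p] qclass_eq_lext[of _ q]
      tens_def split_def)

text \<open>
  The passage from tensors to bilinear maps: a tensor is determined by the value of the
  universal bilinear map on it.
\<close>

lemma tsum_eq_imp_tensor_eq:
  assumes "t \<in> tspace (tensor_null sM sN)"
    and "tsum qscale t (tens sM sN) = lext qscale (\<lambda>(x, y). tens sM sN x y) p"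
  shows "t = tclass (tensor_null sM sN) p"
  using assms tclass_tensor_eq_iff[of sM sN "trep t" p]
    tclass_trep[OF subspace_tensor_null assms(1)]
  by (simp add: tsum_eq_lext)

text \<open>
  Syntax-directed rules for linearity of an iterated Sweedler sum in one of its variables;
  simplification with them discharges the side conditions of the Sweedler rules.
\<close>

lemma hom_id: "module s \<Longrightarrow> module_hom s s (\<lambda>x. x)"
  by (simp add: module_hom_iff)

lemma hom_tsum:
  assumes "module s" "module t" "\<And>a b. module_hom s t (\<lambda>x. F x a b)"
  shows "module_hom s t (\<lambda>x. tsum t T (\<lambda>a b. F x a b))"
  using compatible_lext_prod[OF assms(2), of "linear_rels s" F "trep T"] assms(3)
  by (simp add: compatible_linear_rels[OF assms(1,2)] tsum_eq_lext)

lemma hom_scale_left: "module t \<Longrightarrow> module_hom s (*) f \<Longrightarrow> module_hom s t (\<lambda>x. t (f x) v)"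
  by (auto simp: module_hom_iff module.scale_left_distrib module.scale_scale)

lemma hom_scale_right: "module_hom s t f \<Longrightarrow> module_hom s t (\<lambda>x. t c (f x))"
  by (auto simp: module_hom_iff module.scale_right_distrib module.scale_scale mult.commute)

lemma hom_times_left: "module_hom s (*) f \<Longrightarrow> module_hom s (*) (\<lambda>x. f x * c)"
  by (rule hom_scale_left[OF module_mult])

lemma hom_times_right: "module_hom s (*) f \<Longrightarrow> module_hom s (*) (\<lambda>x. c * f x)"
  by (rule hom_scale_right)

lemma hom_compose: "module_hom s t f \<Longrightarrow> module_hom t u g \<Longrightarrow> module_hom s u (\<lambda>x. g (f x))"
  by (auto simp: module_hom_iff)

lemma hom_bilinear_left:
  "bilinear_map s t u B \<Longrightarrow> module_hom r s f \<Longrightarrow> module_hom r u (\<lambda>x. B (f x) y)"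
  using hom_compose[of r s f u "\<lambda>x. B x y"] by (simp add: bilinear_mapD)

lemma hom_bilinear_right:
  "bilinear_map s t u B \<Longrightarrow> module_hom r t f \<Longrightarrow> module_hom r u (\<lambda>y. B x (f y))"
  using hom_compose[of r t f u "B x"] by (simp add: bilinear_mapD)

lemma tsum_swap:
  "module s \<Longrightarrow> tsum s t (\<lambda>x y. tsum s u (\<lambda>z w. F x y z w)) =
     tsum s u (\<lambda>z w. tsum s t (\<lambda>x y. F x y z w))"
  unfolding tsum_eq_lext by (rule lext_swap_prod)

lemma tsum_cong: "(\<And>x y. F x y = G x y) \<Longrightarrow> tsum s t (\<lambda>x y. F x y) = tsum s t (\<lambda>x y. G x y)"
  by (simp add: tsum_def)

lemma module_hom_tsum_eq:
  "module_hom s t L \<Longrightarrow> L (tsum s T (\<lambda>x y. F x y)) = tsum t T (\<lambda>x y. L (F x y))"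
  by (simp add: tsum_eq_lext module_hom_lext_eq split_def)

lemma scale_tsum_right: "module s \<Longrightarrow> s c (tsum s T (\<lambda>x y. F x y)) = tsum s T (\<lambda>x y. s c (F x y))"
  by (simp add: tsum_eq_lext lext_scale_fun[symmetric] split_def)

lemma scale_tsum_left: "module s \<Longrightarrow> s (tsum (*) T (\<lambda>x y. f x y)) v = tsum s T (\<lambda>x y. s (f x y) v)"
  by (simp add: tsum_eq_lext scale_lext split_def)

lemma tlinear_in_span:
  assumes "tlinear s (tensor_null s t) \<delta>" "r \<in> linear_rels s"
  shows "lext fscale (\<lambda>m. trep (\<delta> m)) r \<in> tensor_null s t"
proof -
  let ?N = "tensor_null s t"
  note sub = module.subspace_scale[OF module_fscale subspace_tensor_null]
  consider (add) x y where "r = gen (x + y) - gen x - gen y"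
    | (scale) c x where "r = gen (s c x) - fscale c (gen x)"
    using assms(2) by (auto simp: linear_rels_def)
  then show ?thesis
  proof cases
    case add
    have "\<delta> (x + y) = tclass ?N (trep (\<delta> x) + trep (\<delta> y))"
      using assms(1) by (simp add: tlinear_def)
    then show ?thesis
      using trep_tclass[OF subspace_tensor_null, of s t "trep (\<delta> x) + trep (\<delta> y)"]
      by (simp add: add lext_diff[OF module_fscale] lext_add[OF module_fscale] module_fscale diff_diff_eq)
  next
    case scale
    have "\<delta> (s c x) = tclass ?N (fscale c (trep (\<delta> x)))"
      using assms(1) by (simp add: tlinear_def)
    then show ?thesis
      using trep_tclass[OF subspace_tensor_null, of s t "fscale c (trep (\<delta> x))"]
      by (simp add: scale lext_diff[OF module_fscale] lext_fscale[OF module_fscale] module_fscale)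
  qed
qed

lemma counit_in_span_linear_rels:
  assumes "module s" and eq: "lext s (\<lambda>i. s (f i) (g i)) p = m"
  shows "lext fscale (\<lambda>i. fscale (f i) (gen (g i))) p - gen m \<in> module.span fscale (linear_rels s)"
proof -
  let ?q = "\<lambda>i. qclass (module.span fscale (linear_rels s)) (gen i)"
  have "module_hom s qscale ?q"
    using compatible_qclass[of "linear_rels s"]
    by (simp add: compatible_linear_rels[OF assms(1) module_qscale])
  from module_hom_lext_eq[OF this, of "\<lambda>i. s (f i) (g i)" p] this show ?thesis
    unfolding in_span_iff_qclass
    by (simp add: lext_lext[OF module_qscale] module_qscale lext_fscale[OF module_qscale] eq
        module_hom_iff)
qed

context hopf_algebra
begin

abbreviation "rels \<equiv> linear_rels (scl H)"
abbreviation "\<Delta> h \<equiv> trep (comult H h)"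

sublocale C: formal_coalgebra rels \<Delta> "counit H"
proof
  fix h r
  show "lext fscale \<Delta> r \<in> module.span fscale (rel_prod rels rels)" if "r \<in> rels"
    using tlinear_in_span[OF comult_linear that] by (simp add: tensor_null_eq module_scl)
  show "lext fscale (\<lambda>(x, c). lext fscale (\<lambda>(x0, x1). gen (x0, x1, c)) (\<Delta> x)) (\<Delta> h) -
    lext fscale (\<lambda>(x, c). lext fscale (\<lambda>(c1, c2). gen (x, c1, c2)) (\<Delta> c)) (\<Delta> h)
    \<in> module.span fscale (rel_prod rels (rel_prod rels rels))"
    using coassoc[of h]
    unfolding tensor3_null_eq[OF module_scl module_scl module_scl] tclass_eq_iff_diff[OF subspace_span] tsum_eq_lext .
  show "lext fscale (\<lambda>(x, c). fscale (counit H c) (gen x)) (\<Delta> h) - gen h \<in> module.span fscale rels"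
    using counit_in_span_linear_rels[OF module_scl, of "\<lambda>i. counit H (snd i)" fst "\<Delta> h" h] counit_right[of h]
    by (simp add: tsum_eq_lext split_def)
  show "compatible rels (*) (counit H)"
    using counit_linear by (simp add: compatible_linear_rels[OF module_scl module_mult])
  show "lext fscale (\<lambda>(x, c). fscale (counit H x) (gen c)) (\<Delta> h) - gen h \<in> module.span fscale rels"
    using counit_in_span_linear_rels[OF module_scl, of "\<lambda>i. counit H (fst i)" snd "\<Delta> h" h] counit_left[of h]
    by (simp add: tsum_eq_lext split_def)
qed

sublocale C2: formal_coalgebra "rel_prod rels rels" "prod_coact \<Delta> \<Delta>"
  "\<lambda>(g, h). counit H g * counit H h"
  by (rule formal_coalgebra_prod[OF C.formal_coalgebra_axioms C.formal_coalgebra_axioms])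

sublocale C3: formal_coalgebra "rel_prod rels (rel_prod rels rels)" "prod_coact \<Delta> (prod_coact \<Delta> \<Delta>)"
  "\<lambda>(g, h). counit H g * (case h of (h, k) \<Rightarrow> counit H h * counit H k)"
  by (rule formal_coalgebra_prod[OF C.formal_coalgebra_axioms C2.formal_coalgebra_axioms])

end

context comodule_algebra
begin

abbreviation "relsA \<equiv> linear_rels (scl A)"
abbreviation "\<delta> a \<equiv> trep (coact A a)"

sublocale M: formal_comodule relsA \<delta> H.rels H.\<Delta> "counit H"
proof
  fix a r
  show "lext fscale \<delta> r \<in> module.span fscale (rel_prod relsA H.rels)" if "r \<in> relsA"
    using tlinear_in_span[OF coact_linear that] by (simp add: tensor_null_eq H.module_scl A.module_scl)
  show "lext fscale (\<lambda>(x, c). lext fscale (\<lambda>(x0, x1). gen (x0, x1, c)) (\<delta> x)) (\<delta> a) -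
    lext fscale (\<lambda>(x, c). lext fscale (\<lambda>(c1, c2). gen (x, c1, c2)) (H.\<Delta> c)) (\<delta> a)
    \<in> module.span fscale (rel_prod relsA (rel_prod H.rels H.rels))"
    using coact_coassoc[of a]
    unfolding tensor3_null_eq[OF A.module_scl H.module_scl H.module_scl] tclass_eq_iff_diff[OF subspace_span] tsum_eq_lext .
  show "lext fscale (\<lambda>(x, c). fscale (counit H c) (gen x)) (\<delta> a) - gen a \<in> module.span fscale relsA"
    using counit_in_span_linear_rels[OF A.module_scl, of "\<lambda>i. counit H (snd i)" fst "\<delta> a" a] coact_counit[of a]
    by (simp add: tsum_eq_lext split_def)
qed

sublocale M2: formal_comodule "rel_prod relsA relsA" "prod_coact \<delta> \<delta>" "rel_prod H.rels H.rels"
  "prod_coact H.\<Delta> H.\<Delta>" "\<lambda>(g, h). counit H g * counit H h"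
  by (rule formal_comodule_prod[OF M.formal_comodule_axioms M.formal_comodule_axioms])

sublocale M3: formal_comodule "rel_prod relsA (rel_prod relsA relsA)" "prod_coact \<delta> (prod_coact \<delta> \<delta>)"
  "rel_prod H.rels (rel_prod H.rels H.rels)" "prod_coact H.\<Delta> (prod_coact H.\<Delta> H.\<Delta>)"
  "\<lambda>(g, h). counit H g * (case h of (h, k) \<Rightarrow> counit H h * counit H k)"
  by (rule formal_comodule_prod[OF M.formal_comodule_axioms M2.formal_comodule_axioms])

end

section \<open>Sweedler calculus in a Hopf algebra\<close>

context hopf_algebra
begin

abbreviation "sw s h F \<equiv> tsum s (comult H h) F"

lemma compatible_rels_iff: "module s \<Longrightarrow> compatible rels s f \<longleftrightarrow> module_hom (scl H) s f"
  by (rule compatible_linear_rels[OF module_scl])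

lemma sw_cong: "(\<And>x y. F x y = G x y) \<Longrightarrow> sw s h (\<lambda>x y. F x y) = sw s h (\<lambda>x y. G x y)"
  by (rule tsum_cong)

lemma hom_module: "module_hom s t f \<Longrightarrow> module t"
  by (simp add: module_hom_iff)

lemma sw_coassoc:
  assumes "\<And>b c. module_hom (scl H) s (\<lambda>a. F a b c)" "\<And>a c. module_hom (scl H) s (\<lambda>b. F a b c)"
    "\<And>a b. module_hom (scl H) s (F a b)"
  shows "sw s h (\<lambda>x c. sw s x (\<lambda>a b. F a b c)) = sw s h (\<lambda>a x. sw s x (\<lambda>b c. F a b c))"
  unfolding tsum_eq_lext using assms hom_module[OF assms(1)]
  by (intro C.coassoc) (simp_all add: compatible_rels_iff)

lemma sw_counit_left:
  assumes "module_hom (scl H) s f"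
  shows "sw s h (\<lambda>a b. s (counit H a) (f b)) = f h"
  unfolding tsum_eq_lext using assms hom_module[OF assms]
  by (intro C.counit_left) (simp_all add: compatible_rels_iff)

lemma sw_counit_right:
  assumes "module_hom (scl H) s f"
  shows "sw s h (\<lambda>a b. s (counit H b) (f a)) = f h"
  unfolding tsum_eq_lext using assms hom_module[OF assms]
  by (intro C.counit) (simp_all add: compatible_rels_iff)

lemma hom_comult:
  assumes "module_hom s (scl H) g"
    "\<And>b. module_hom (scl H) t (\<lambda>a. F a b)" "\<And>a. module_hom (scl H) t (F a)"
  shows "module_hom s t (\<lambda>x. sw t (g x) (\<lambda>a b. F a b))"
proof (rule hom_compose[OF assms(1)])
  have t: "module t" by (rule hom_module[OF assms(2)])
  show "module_hom (scl H) t (\<lambda>x. sw t x (\<lambda>a b. F a b))"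
    using C.compatible_coact[OF t, of F] assms(2,3)
    by (simp add: compatible_rels_iff[OF t] tsum_eq_lext)
qed

lemma bilinearI_H:
  assumes "\<And>b. module_hom (scl H) s (\<lambda>a. F a b)" "\<And>a. module_hom (scl H) s (F a)"
  shows "bilinear_map (scl H) (scl H) s F"
  using assms by (simp add: bilinear_map_def)

lemma sw_mult:
  assumes "\<And>b. module_hom (scl H) s (\<lambda>a. F a b)" "\<And>a. module_hom (scl H) s (F a)"
  shows "sw s (mult H g h) F =
    sw s g (\<lambda>g1 g2. sw s h (\<lambda>h1 h2. F (mult H g1 h1) (mult H g2 h2)))"
  using hom_module[OF assms(1)]
  unfolding comult_mult tsum_tclass[OF bilinearI_H[OF assms]]
  by (simp add: tsum_eq_lext lext_lext split_def)

lemma sw_unity: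
  assumes "\<And>b. module_hom (scl H) s (\<lambda>a. F a b)" "\<And>a. module_hom (scl H) s (F a)"
  shows "sw s (unity H) F = F (unity H) (unity H)"
  using hom_module[OF assms(1)]
  by (simp add: comult_unity tsum_tclass[OF bilinearI_H[OF assms]])

lemma hom_mult_left: "module_hom s (scl H) f \<Longrightarrow> module_hom s (scl H) (\<lambda>x. mult H (f x) y)"
  by (rule hom_bilinear_left[OF mult_bilinear])

lemma hom_mult_right: "module_hom s (scl H) f \<Longrightarrow> module_hom s (scl H) (\<lambda>x. mult H y (f x))"
  by (rule hom_bilinear_right[OF mult_bilinear])

lemma hom_antipode: "module_hom s (scl H) f \<Longrightarrow> module_hom s (scl H) (\<lambda>x. antipode H (f x))"
  by (rule hom_compose[OF _ antipode_linear])

lemma hom_counit: "module_hom s (scl H) f \<Longrightarrow> module_hom s (*) (\<lambda>x. counit H (f x))"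
  by (rule hom_compose[OF _ counit_linear])

lemmas hom_H = module_scl module_mult module_qscale hom_id[OF module_scl]
  hom_tsum hom_comult hom_mult_left hom_mult_right hom_antipode hom_counit
  hom_scale_left[OF module_scl] hom_scale_right[of _ "scl H"]
  hom_scale_left[OF module_qscale] hom_scale_right[of _ qscale] hom_times_left hom_times_right

lemma sw_antipode_left:
  assumes "module_hom (scl H) s L"
  shows "sw s h (\<lambda>a b. L (mult H (antipode H a) b)) = s (counit H h) (L (unity H))"
  using assms
  by (simp add: module_hom_tsum_eq[OF assms, symmetric] antipode_left module_hom_iff)

lemma sw_antipode_right:
  assumes "module_hom (scl H) s L"
  shows "sw s h (\<lambda>a b. L (mult H a (antipode H b))) = s (counit H h) (L (unity H))"
  using assms
  by (simp add: module_hom_tsum_eq[OF assms, symmetric] antipode_right module_hom_iff)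

lemma counit_antipode: "counit H (antipode H h) = counit H h"
proof -
  have "counit H (antipode H h) =
      sw (*) h (\<lambda>a b. counit H b * counit H (antipode H a))"
    by (rule sw_counit_right[symmetric]) (simp add: hom_H)
  also have "\<dots> = sw (*) h (\<lambda>a b. counit H (mult H (antipode H a) b))"
    by (simp add: counit_mult mult.commute)
  also have "\<dots> = counit H h"
    by (simp add: sw_antipode_left[OF counit_linear] counit_unity)
  finally show ?thesis .
qed

text \<open>
  In Sweedler notation both sides are the sum of \<open>G h\<^sub>1 h\<^sub>2 h\<^sub>3 h\<^sub>4\<close>.  On the right, \<open>h\<^sub>2\<close> and
  \<open>h\<^sub>3\<close> arise from splitting one element, so that a contraction of these neighbours, such as
  \<open>S(h\<^sub>2) h\<^sub>3\<close>, can be applied to them.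
\<close>

lemma sw_split4:
  assumes "\<And>b c d. module_hom (scl H) s (\<lambda>a. G a b c d)" "\<And>a c d. module_hom (scl H) s (\<lambda>b. G a b c d)"
    "\<And>a b d. module_hom (scl H) s (\<lambda>c. G a b c d)" "\<And>a b c. module_hom (scl H) s (G a b c)"
  shows "sw s h (\<lambda>x y. sw s x (\<lambda>a b. sw s y (\<lambda>c d. G a b c d))) =
         sw s h (\<lambda>a x. sw s x (\<lambda>y d. sw s y (\<lambda>b c. G a b c d)))"
proof -
  have s: "module s" by (rule hom_module[OF assms(1)])
  have "sw s h (\<lambda>x y. sw s x (\<lambda>a b. sw s y (\<lambda>c d. G a b c d))) =
    sw s h (\<lambda>a x. sw s x (\<lambda>b y. sw s y (\<lambda>c d. G a b c d)))"
    by (rule sw_coassoc) (simp_all add: hom_H assms s)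
  also have "\<dots> = sw s h (\<lambda>a x. sw s x (\<lambda>y d. sw s y (\<lambda>b c. G a b c d)))"
    by (intro sw_cong sw_coassoc[symmetric]) (simp_all add: assms)
  finally show ?thesis .
qed

text \<open>
  The sum of \<open>G h\<^sub>1 h\<^sub>2 h\<^sub>3 h\<^sub>4 h\<^sub>5\<close>, with the three middle factors isolated on the right.
\<close>

lemma sw_split5:
  assumes "\<And>b c d e. module_hom (scl H) s (\<lambda>a. G a b c d e)"
    "\<And>a c d e. module_hom (scl H) s (\<lambda>b. G a b c d e)"
    "\<And>a b d e. module_hom (scl H) s (\<lambda>c. G a b c d e)"
    "\<And>a b c e. module_hom (scl H) s (\<lambda>d. G a b c d e)"
    "\<And>a b c d. module_hom (scl H) s (G a b c d)"
  shows "sw s h (\<lambda>x t. sw s t (\<lambda>c y. sw s x (\<lambda>a b. sw s y (\<lambda>d e. G a b c d e)))) =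
         sw s h (\<lambda>a x. sw s x (\<lambda>y e. sw s y (\<lambda>b t. sw s t (\<lambda>c d. G a b c d e))))"
proof -
  have s: "module s" by (rule hom_module[OF assms(1)])
  have "sw s h (\<lambda>x t. sw s t (\<lambda>c y. sw s x (\<lambda>a b. sw s y (\<lambda>d e. G a b c d e)))) =
    sw s h (\<lambda>x t. sw s x (\<lambda>a b. sw s t (\<lambda>c y. sw s y (\<lambda>d e. G a b c d e))))"
    by (intro sw_cong tsum_swap s)
  also have "\<dots> = sw s h (\<lambda>x t. sw s x (\<lambda>a b. sw s t (\<lambda>y e. sw s y (\<lambda>c d. G a b c d e))))"
    by (intro sw_cong sw_coassoc[symmetric]) (simp_all add: assms)
  also have "\<dots> = sw s h (\<lambda>a x. sw s x (\<lambda>y e. sw s y (\<lambda>b t. sw s t (\<lambda>c d. G a b c d e))))"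
    by (rule sw_split4) (simp_all add: hom_H assms s)
  finally show ?thesis .
qed

text \<open>
  The antipode reverses the coproduct.  Both \<open>\<Delta>(S(h))\<close> and \<open>S(h\<^sub>2) \<otimes> S(h\<^sub>1)\<close> are convolution
  inverse to \<open>\<Delta>\<close> in the maps from \<open>H\<close> to \<open>H \<otimes> H\<close>: their product with \<open>\<Delta>\<close> in between, the sum of
  \<open>\<Delta>(S(h\<^sub>1)) \<Delta>(h\<^sub>2) (S(h\<^sub>4) \<otimes> S(h\<^sub>3))\<close>, collapses to either of them.
\<close>

lemma sw_antipode:
  assumes F: "\<And>b. module_hom (scl H) s (\<lambda>a. F a b)" "\<And>a. module_hom (scl H) s (F a)"
  shows "sw s (antipode H h) F = sw s h (\<lambda>a b. F (antipode H b) (antipode H a))"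
proof -
  have s: "module s" by (rule hom_module[OF F(1)])
  let ?m = "mult H" and ?S = "antipode H" and ?e = "counit H"
  have F1: "module_hom u s (\<lambda>x. F (f x) y)" "module_hom u s (\<lambda>x. F y (f x))"
    if "module_hom u (scl H) f" for u f y
    using hom_compose[OF that F(1)] hom_compose[OF that F(2)] by simp_all
  note lin = hom_H s F1
  let ?J = "\<lambda>x1 x2 p1 p2 q1 q2. F (?m (?m x1 p1) (?S q2)) (?m (?m x2 p2) (?S q1))"
  let ?K = "\<lambda>a p q. sw s (?S a) (\<lambda>x1 x2. sw s p (\<lambda>p1 p2. sw s q (\<lambda>q1 q2. ?J x1 x2 p1 p2 q1 q2)))"
  let ?G = "\<lambda>u q. sw s u (\<lambda>u1 u2. sw s q (\<lambda>q1 q2. F (?m u1 (?S q2)) (?m u2 (?S q1))))"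
  \<comment> \<open>\<open>\<Delta>(r\<^sub>1) (S(r\<^sub>3) \<otimes> S(r\<^sub>2)) = \<epsilon>(r) 1 \<otimes> 1\<close>, multiplied from the left by \<open>x1 \<otimes> x2\<close>.\<close>
  have inner: "sw s r (\<lambda>p q. sw s p (\<lambda>p1 p2. sw s q (\<lambda>q1 q2. ?J x1 x2 p1 p2 q1 q2))) =
    s (?e r) (F x1 x2)" for r x1 x2
  proof -
    have "sw s r (\<lambda>p q. sw s p (\<lambda>p1 p2. sw s q (\<lambda>q1 q2. ?J x1 x2 p1 p2 q1 q2))) =
      sw s r (\<lambda>p1 t. sw s t (\<lambda>m q2. sw s m (\<lambda>p2 q1. ?J x1 x2 p1 p2 q1 q2)))"
      by (rule sw_split4) (simp_all add: lin)
    also have "\<dots> = sw s r (\<lambda>p1 t. sw s t (\<lambda>m q2. s (?e m) (F (?m (?m x1 p1) (?S q2)) x2)))"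
    proof (intro sw_cong)
      fix p1 m q2
      have "sw s m (\<lambda>p2 q1. ?J x1 x2 p1 p2 q1 q2) =
        sw s m (\<lambda>p2 q1. F (?m (?m x1 p1) (?S q2)) (?m x2 (?m p2 (?S q1))))"
        by (simp add: mult_assoc)
      also have "\<dots> = s (?e m) (F (?m (?m x1 p1) (?S q2)) (?m x2 (unity H)))"
        by (rule sw_antipode_right) (simp add: lin)
      finally show "sw s m (\<lambda>p2 q1. ?J x1 x2 p1 p2 q1 q2) =
        s (?e m) (F (?m (?m x1 p1) (?S q2)) x2)"
        by (simp add: unity_right)
    qed
    also have "\<dots> = sw s r (\<lambda>p1 t. F (?m x1 (?m p1 (?S t))) x2)"
      by (intro sw_cong, subst sw_counit_left) (simp_all add: lin mult_assoc)
    also have "\<dots> = s (?e r) (F (?m x1 (unity H)) x2)"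
      by (rule sw_antipode_right) (simp add: lin)
    finally show ?thesis by (simp add: unity_right)
  qed
  have "sw s (?S h) F = sw s h (\<lambda>a r. s (?e r) (sw s (?S a) (\<lambda>x1 x2. F x1 x2)))"
    by (rule sw_counit_right[symmetric]) (simp add: lin)
  also have "\<dots> = sw s h (\<lambda>a r. sw s (?S a) (\<lambda>x1 x2. sw s r (\<lambda>p q.
      sw s p (\<lambda>p1 p2. sw s q (\<lambda>q1 q2. ?J x1 x2 p1 p2 q1 q2)))))"
    by (simp add: inner scale_tsum_right[OF s])
  also have "\<dots> = sw s h (\<lambda>a r. sw s r (\<lambda>p q. ?K a p q))"
    by (intro sw_cong tsum_swap s)
  also have "\<dots> = sw s h (\<lambda>y q. sw s y (\<lambda>a p. ?K a p q))"
    by (rule sw_coassoc[symmetric]) (simp_all add: lin)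
  also have "\<dots> = sw s h (\<lambda>y q. sw s y (\<lambda>a p. ?G (?m (?S a) p) q))"
    by (intro sw_cong sw_mult[symmetric]) (simp_all add: lin)
  also have "\<dots> = sw s h (\<lambda>y q. s (?e y) (?G (unity H) q))"
    by (intro sw_cong sw_antipode_left) (simp_all add: lin)
  also have "\<dots> = ?G (unity H) h"
    by (rule sw_counit_left) (simp_all add: lin)
  also have "\<dots> = sw s h (\<lambda>q1 q2. F (?S q2) (?S q1))"
    by (subst sw_unity) (simp_all add: lin unity_left)
  finally show ?thesis .
qed

lemma conv_pair:
  assumes "module s"
  shows "conv s B (prod_coact \<Delta> \<Delta>) f g (x, y) =
    sw s x (\<lambda>x1 x2. sw s y (\<lambda>y1 y2. B (f (x1, y1)) (g (x2, y2))))"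
  by (simp add: conv_def lext_prod_coact[OF assms] tsum_eq_lext)

lemma conv_triple:
  assumes "module s"
  shows "conv s B (prod_coact \<Delta> (prod_coact \<Delta> \<Delta>)) f g (x, y, z) =
    sw s x (\<lambda>x1 x2. sw s y (\<lambda>y1 y2. sw s z (\<lambda>z1 z2. B (f (x1, y1, z1)) (g (x2, y2, z2)))))"
  by (simp add: conv_def lext_prod_coact[OF assms] tsum_eq_lext)

end

section \<open>Identities for a 2-cocycle\<close>

locale hopf_cocycle = hopf_algebra H + two_cocycle H \<gamma> \<gamma>'
  for H :: "('k::comm_ring_1, 'h::ab_group_add) hopf" and \<gamma> \<gamma>' :: "'h \<Rightarrow> 'h \<Rightarrow> 'k"
begin

abbreviation "rels2 \<equiv> rel_prod rels rels"
abbreviation "rels3 \<equiv> rel_prod rels (rel_prod rels rels)"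
abbreviation "\<Delta>2 \<equiv> prod_coact \<Delta> \<Delta>"
abbreviation "\<Delta>3 \<equiv> prod_coact \<Delta> (prod_coact \<Delta> \<Delta>)"
abbreviation "\<epsilon>2 \<equiv> \<lambda>(g, h). counit H g * counit H h"
abbreviation "\<epsilon>3 \<equiv> \<lambda>(g, h). counit H g * (case h of (h, k) \<Rightarrow> counit H h * counit H k)"

lemmas hom_cocycle = hom_H
  hom_bilinear_left[OF bilinear] hom_bilinear_right[OF bilinear]
  hom_bilinear_left[OF inverse_bilinear] hom_bilinear_right[OF inverse_bilinear]

lemmas compatible_iff = compatible_rel_prod compatible_rels_iff

lemma conv_inverse:
  "conv (*) (*) \<Delta>2 (\<lambda>(g, h). \<gamma> g h) (\<lambda>(g, h). \<gamma>' g h) = \<epsilon>2"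
  "conv (*) (*) \<Delta>2 (\<lambda>(g, h). \<gamma>' g h) (\<lambda>(g, h). \<gamma> g h) = \<epsilon>2"
  by (auto simp: fun_eq_iff conv_pair[OF module_mult] inverse_right inverse_left)

text \<open>
  On triples, a factor \<open>f(g, h) \<epsilon>(k)\<close> or \<open>\<epsilon>(g) f(h, k)\<close> of a convolution leaves the third or the
  first argument of the other factor untouched.
\<close>

lemma conv_ignore_third_left:
  assumes "\<And>g h. module_hom (scl H) s (\<lambda>k. \<phi> (g, h, k))"
  shows "conv s s \<Delta>3 (\<lambda>(g, h, k). counit H k * f g h) \<phi> (g, h, k) =
    sw s g (\<lambda>g1 g2. sw s h (\<lambda>h1 h2. s (f g1 h1) (\<phi> (g2, h2, k))))"
proof -
  have s: "module s" by (rule hom_module[OF assms])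
  show ?thesis
    unfolding conv_triple[OF s]
    by (intro sw_cong)
      (simp add: module.scale_scale[OF s, symmetric] sw_counit_left[OF hom_scale_right[OF assms]])
qed

lemma conv_ignore_third_right:
  assumes "\<And>g h. module_hom (scl H) s (\<lambda>k. \<phi> (g, h, k))"
  shows "conv s (\<lambda>v c. s c v) \<Delta>3 \<phi> (\<lambda>(g, h, k). counit H k * f g h) (g, h, k) =
    sw s g (\<lambda>g1 g2. sw s h (\<lambda>h1 h2. s (f g2 h2) (\<phi> (g1, h1, k))))"
proof -
  have s: "module s" by (rule hom_module[OF assms])
  show ?thesis
    unfolding conv_triple[OF s]
    by (intro sw_cong)
      (simp add: module.scale_scale[OF s, symmetric] sw_counit_right[OF hom_scale_right[OF assms]])
qed

lemma conv_ignore_first_left: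
  assumes "\<And>h k. module_hom (scl H) s (\<lambda>g. \<phi> (g, h, k))"
  shows "conv s s \<Delta>3 (\<lambda>(g, h, k). counit H g * f h k) \<phi> (g, h, k) =
    sw s h (\<lambda>h1 h2. sw s k (\<lambda>k1 k2. s (f h1 k1) (\<phi> (g, h2, k2))))"
proof -
  have s: "module s" by (rule hom_module[OF assms])
  have hom: "module_hom (scl H) s
    (\<lambda>g. sw s h (\<lambda>h1 h2. sw s k (\<lambda>k1 k2. s (f h1 k1) (\<phi> (g, h2, k2)))))"
    by (intro hom_tsum hom_scale_right assms s module_scl)
  show ?thesis
    unfolding conv_triple[OF s]
    using sw_counit_left[of s "\<lambda>g. sw s h (\<lambda>h1 h2. sw s k (\<lambda>k1 k2. s (f h1 k1) (\<phi> (g, h2, k2))))" g]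
    by (simp add: module.scale_scale[OF s, symmetric] scale_tsum_right[OF s, symmetric] hom)
qed

lemma conv_ignore_first_right:
  assumes "\<And>h k. module_hom (scl H) s (\<lambda>g. \<phi> (g, h, k))"
  shows "conv s (\<lambda>v c. s c v) \<Delta>3 \<phi> (\<lambda>(g, h, k). counit H g * f h k) (g, h, k) =
    sw s h (\<lambda>h1 h2. sw s k (\<lambda>k1 k2. s (f h2 k2) (\<phi> (g, h1, k1))))"
proof -
  have s: "module s" by (rule hom_module[OF assms])
  have hom: "module_hom (scl H) s
    (\<lambda>g. sw s h (\<lambda>h1 h2. sw s k (\<lambda>k1 k2. s (f h2 k2) (\<phi> (g, h1, k1)))))"
    by (intro hom_tsum hom_scale_right assms s module_scl)
  show ?thesis
    unfolding conv_triple[OF s]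
    using sw_counit_right[of s "\<lambda>g. sw s h (\<lambda>h1 h2. sw s k (\<lambda>k1 k2. s (f h2 k2) (\<phi> (g, h1, k1))))" g]
    by (simp add: module.scale_scale[OF s, symmetric] scale_tsum_right[OF s, symmetric] hom)
qed

text \<open>
  With these four functionals the cocycle identity becomes
  \<open>third_idle \<gamma> * mult12 \<gamma> = first_idle \<gamma> * mult23 \<gamma>\<close> in the convolution monoid on triples, and
  all four are invertible there.
\<close>

definition "third_idle f = (\<lambda>(g, h, k). counit H k * f g h)"
definition "first_idle f = (\<lambda>(g, h, k). counit H g * f h k)"
definition "mult12 f = (\<lambda>(g, h, k). f (mult H g h) k)"
definition "mult23 f = (\<lambda>(g, h, k). f g (mult H h k))"

lemma compatible_triples:
  assumes "bilinear_map (scl H) (scl H) (*) f"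
  shows "compatible rels3 (*) (third_idle f)" "compatible rels3 (*) (first_idle f)"
    "compatible rels3 (*) (mult12 f)" "compatible rels3 (*) (mult23 f)"
  by (simp_all add: third_idle_def first_idle_def mult12_def mult23_def compatible_iff hom_H
      hom_bilinear_left[OF assms] hom_bilinear_right[OF assms])

lemma conv_triples_inverse:
  assumes f: "bilinear_map (scl H) (scl H) (*) f" and f': "bilinear_map (scl H) (scl H) (*) f'"
    and inv: "conv (*) (*) \<Delta>2 (\<lambda>(g, h). f g h) (\<lambda>(g, h). f' g h) = \<epsilon>2"
  shows "conv (*) (*) \<Delta>3 (third_idle f) (third_idle f') = \<epsilon>3"
    "conv (*) (*) \<Delta>3 (first_idle f) (first_idle f') = \<epsilon>3"
    "conv (*) (*) \<Delta>3 (mult12 f) (mult12 f') = \<epsilon>3"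
    "conv (*) (*) \<Delta>3 (mult23 f) (mult23 f') = \<epsilon>3"
proof -
  note lin = hom_H hom_bilinear_left[OF f] hom_bilinear_right[OF f]
    hom_bilinear_left[OF f'] hom_bilinear_right[OF f']
  have inv: "sw (*) g (\<lambda>g1 g2. sw (*) h (\<lambda>h1 h2. f g1 h1 * f' g2 h2)) = counit H g * counit H h" for g h
    using fun_cong[OF inv, of "(g, h)"] by (simp add: conv_pair[OF module_mult])
  show "conv (*) (*) \<Delta>3 (third_idle f) (third_idle f') = \<epsilon>3"
    unfolding third_idle_def
    by (rule ext, clarify, subst conv_ignore_third_left)
      (simp_all add: lin mult.left_commute[of "f _ _"] scale_tsum_right[OF module_mult, symmetric] inv
        mult.assoc mult.left_commute mult.commute)
  show "conv (*) (*) \<Delta>3 (first_idle f) (first_idle f') = \<epsilon>3"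
    unfolding first_idle_def
    by (rule ext, clarify, subst conv_ignore_first_left)
      (simp_all add: lin mult.left_commute[of "f _ _"] scale_tsum_right[OF module_mult, symmetric] inv)
  show "conv (*) (*) \<Delta>3 (mult12 f) (mult12 f') = \<epsilon>3"
  proof
    fix p :: "'h \<times> 'h \<times> 'h"
    obtain g h k where p: "p = (g, h, k)" by (cases p)
    have "sw (*) (mult H g h) (\<lambda>u1 u2. sw (*) k (\<lambda>k1 k2. f u1 k1 * f' u2 k2)) =
      sw (*) g (\<lambda>g1 g2. sw (*) h (\<lambda>h1 h2. sw (*) k (\<lambda>k1 k2.
        f (mult H g1 h1) k1 * f' (mult H g2 h2) k2)))"
      by (rule sw_mult) (simp_all add: lin)
    then show "conv (*) (*) \<Delta>3 (mult12 f) (mult12 f') p = \<epsilon>3 p"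
      by (simp add: p mult12_def conv_triple[OF module_mult] inv counit_mult mult.assoc)
  qed
  show "conv (*) (*) \<Delta>3 (mult23 f) (mult23 f') = \<epsilon>3"
  proof
    fix p :: "'h \<times> 'h \<times> 'h"
    obtain g h k where p: "p = (g, h, k)" by (cases p)
    have "sw (*) (mult H h k) (\<lambda>u1 u2. f g1 u1 * f' g2 u2) =
      sw (*) h (\<lambda>h1 h2. sw (*) k (\<lambda>k1 k2. f g1 (mult H h1 k1) * f' g2 (mult H h2 k2)))" for g1 g2
      by (rule sw_mult) (simp_all add: lin)
    then show "conv (*) (*) \<Delta>3 (mult23 f) (mult23 f') p = \<epsilon>3 p"
      using inv[of g "mult H h k"]
      by (simp add: p mult23_def conv_triple[OF module_mult] counit_mult)
  qed
qed

lemmas triples_compatible = compatible_triples[OF bilinear] compatible_triples[OF inverse_bilinear]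
lemmas triples_inverse = conv_triples_inverse[OF bilinear inverse_bilinear conv_inverse(1)]
  conv_triples_inverse[OF inverse_bilinear bilinear conv_inverse(2)]

lemma cocycle_conv:
  "conv (*) (*) \<Delta>3 (third_idle \<gamma>) (mult12 \<gamma>) = conv (*) (*) \<Delta>3 (first_idle \<gamma>) (mult23 \<gamma>)"
  unfolding third_idle_def first_idle_def
  by (rule ext, clarify, subst conv_ignore_third_left, simp_all add: mult12_def hom_cocycle,
      subst conv_ignore_first_left, simp_all add: mult23_def hom_cocycle cocycle)

text \<open>
  The cocycle identity with one factor of each side moved to the other side.  Unlike the identity
  itself, these forms contain both \<open>\<gamma>\<close> and \<open>\<gamma>'\<close>, and they lead to the antipode.
\<close>

lemma cocycle_mixed1_conv:
  "conv (*) (*) \<Delta>3 (mult12 \<gamma>) (mult23 \<gamma>') = conv (*) (*) \<Delta>3 (third_idle \<gamma>') (first_idle \<gamma>)"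
  by (rule C3.conv_cross[OF _ _ _ _ _ _ cocycle_conv]) (simp_all add: triples_compatible triples_inverse)

lemma cocycle_mixed2_conv:
  "conv (*) (*) \<Delta>3 (mult23 \<gamma>) (mult12 \<gamma>') = conv (*) (*) \<Delta>3 (first_idle \<gamma>') (third_idle \<gamma>)"
  by (rule C3.conv_cross[OF _ _ _ _ _ _ cocycle_conv[symmetric]])
    (simp_all add: triples_compatible triples_inverse)

text \<open>
  The cocycle identity for \<open>\<gamma>'\<close>, with the factors in the opposite order.
\<close>

lemma cocycle_inverse_conv:
  "conv (*) (*) \<Delta>3 (mult23 \<gamma>') (first_idle \<gamma>') = conv (*) (*) \<Delta>3 (mult12 \<gamma>') (third_idle \<gamma>')"
  by (rule C3.conv_cross[OF _ _ _ _ _ _ cocycle_mixed1_conv])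
    (simp_all add: triples_compatible triples_inverse)

lemma cocycle_mixed1:
  "sw (*) g (\<lambda>g1 g2. sw (*) h (\<lambda>h1 h2. sw (*) k (\<lambda>k1 k2.
     \<gamma> (mult H g1 h1) k1 * \<gamma>' g2 (mult H h2 k2)))) = sw (*) h (\<lambda>h1 h2. \<gamma>' g h1 * \<gamma> h2 k)"
proof -
  have "sw (*) g (\<lambda>g1 g2. sw (*) h (\<lambda>h1 h2. sw (*) k (\<lambda>k1 k2.
     \<gamma> (mult H g1 h1) k1 * \<gamma>' g2 (mult H h2 k2)))) =
    conv (*) (*) \<Delta>3 (third_idle \<gamma>') (first_idle \<gamma>) (g, h, k)"
    by (simp add: cocycle_mixed1_conv[symmetric] conv_triple[OF module_mult] mult12_def mult23_def)
  also have "\<dots> = sw (*) g (\<lambda>g1 g2. sw (*) h (\<lambda>h1 h2. \<gamma>' g1 h1 * (counit H g2 * \<gamma> h2 k)))"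
    unfolding third_idle_def
    by (subst conv_ignore_third_left) (simp_all add: first_idle_def hom_cocycle)
  also have "\<dots> = sw (*) g (\<lambda>g1 g2. counit H g2 * sw (*) h (\<lambda>h1 h2. \<gamma>' g1 h1 * \<gamma> h2 k))"
    by (simp add: scale_tsum_right[OF module_mult] mult.left_commute[of "\<gamma>' _ _"])
  also have "\<dots> = sw (*) h (\<lambda>h1 h2. \<gamma>' g h1 * \<gamma> h2 k)"
    by (rule sw_counit_right) (simp add: hom_cocycle)
  finally show ?thesis .
qed

lemma cocycle_mixed2:
  "sw (*) g (\<lambda>g1 g2. sw (*) h (\<lambda>h1 h2. sw (*) k (\<lambda>k1 k2.
     \<gamma> g1 (mult H h1 k1) * \<gamma>' (mult H g2 h2) k2))) = sw (*) h (\<lambda>h1 h2. \<gamma>' h1 k * \<gamma> g h2)"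
proof -
  have "sw (*) g (\<lambda>g1 g2. sw (*) h (\<lambda>h1 h2. sw (*) k (\<lambda>k1 k2.
     \<gamma> g1 (mult H h1 k1) * \<gamma>' (mult H g2 h2) k2))) =
    conv (*) (*) \<Delta>3 (first_idle \<gamma>') (third_idle \<gamma>) (g, h, k)"
    by (simp add: cocycle_mixed2_conv[symmetric] conv_triple[OF module_mult] mult12_def mult23_def)
  also have "\<dots> = sw (*) h (\<lambda>h1 h2. sw (*) k (\<lambda>k1 k2. \<gamma>' h1 k1 * (counit H k2 * \<gamma> g h2)))"
    unfolding first_idle_def
    by (subst conv_ignore_first_left) (simp_all add: third_idle_def hom_cocycle)
  also have "\<dots> = sw (*) h (\<lambda>h1 h2. sw (*) k (\<lambda>k1 k2. counit H k2 * (\<gamma>' h1 k1 * \<gamma> g h2)))"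
    by (simp add: mult.left_commute[of "\<gamma>' _ _"])
  also have "\<dots> = sw (*) h (\<lambda>h1 h2. \<gamma>' h1 k * \<gamma> g h2)"
    by (intro sw_cong sw_counit_right) (simp add: hom_cocycle)
  finally show ?thesis .
qed

lemma unital_left': "\<gamma>' (unity H) h = counit H h"
proof -
  have "counit H h = sw (*) (unity H) (\<lambda>g1 g2. sw (*) h (\<lambda>h1 h2. \<gamma> g1 h1 * \<gamma>' g2 h2))"
    by (simp add: inverse_right counit_unity)
  also have "\<dots> = sw (*) h (\<lambda>h1 h2. counit H h1 * \<gamma>' (unity H) h2)"
    by (subst sw_unity) (simp_all add: hom_cocycle unital_left)
  also have "\<dots> = \<gamma>' (unity H) h"
    by (rule sw_counit_left) (simp add: hom_cocycle)
  finally show ?thesis ..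
qed

lemma unital_right': "\<gamma>' h (unity H) = counit H h"
proof -
  have "counit H h = sw (*) h (\<lambda>h1 h2. sw (*) (unity H) (\<lambda>g1 g2. \<gamma> h1 g1 * \<gamma>' h2 g2))"
    by (simp add: inverse_right counit_unity)
  also have "\<dots> = sw (*) h (\<lambda>h1 h2. counit H h1 * \<gamma>' h2 (unity H))"
    by (subst sw_unity) (simp_all add: hom_cocycle unital_right)
  also have "\<dots> = \<gamma>' h (unity H)"
    by (rule sw_counit_left) (simp add: hom_cocycle)
  finally show ?thesis ..
qed

text \<open>
  With \<open>u\<close> and its convolution inverse \<open>u'\<close>, the twisted antipode is \<open>u * S * u'\<close>.
\<close>

definition u :: "'h \<Rightarrow> 'k" where
  "u h = sw (*) h (\<lambda>a b. \<gamma> a (antipode H b))"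

definition u' :: "'h \<Rightarrow> 'k" where
  "u' h = sw (*) h (\<lambda>a b. \<gamma>' (antipode H a) b)"

lemma hom_u: "module_hom s (scl H) f \<Longrightarrow> module_hom s (*) (\<lambda>x. u (f x))"
  by (simp add: u_def[abs_def] hom_cocycle)

lemma hom_u': "module_hom s (scl H) f \<Longrightarrow> module_hom s (*) (\<lambda>x. u' (f x))"
  by (simp add: u'_def[abs_def] hom_cocycle)

lemmas hom_all = hom_cocycle hom_u hom_u'

text \<open>
  The mixed cocycle identity at \<open>(z, S(h\<^sub>1), h\<^sub>2)\<close>.  Its left side contains \<open>S(h\<^sub>2) h\<^sub>3\<close>, which
  collapses.
\<close>

lemma cocycle_antipode_right:
  "sw (*) h (\<lambda>a b. \<gamma>' (mult H z (antipode H a)) b) = sw (*) h (\<lambda>a b. \<gamma> z (antipode H a) * u' b)"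
proof -
  let ?m = "mult H" and ?S = "antipode H" and ?e = "counit H"
  let ?G = "\<lambda>a b c d. sw (*) z (\<lambda>z1 z2. \<gamma> z1 (?m (?S b) c) * \<gamma>' (?m z2 (?S a)) d)"
  have "sw (*) h (\<lambda>a b. \<gamma> z (?S a) * u' b) =
    sw (*) h (\<lambda>a b. sw (*) b (\<lambda>c d. \<gamma>' (?S c) d * \<gamma> z (?S a)))"
    by (simp add: u'_def scale_tsum_right[OF module_mult] mult.commute)
  also have "\<dots> = sw (*) h (\<lambda>y d. sw (*) y (\<lambda>a c. \<gamma>' (?S c) d * \<gamma> z (?S a)))"
    by (rule sw_coassoc[symmetric]) (simp_all add: hom_cocycle)
  also have "\<dots> = sw (*) h (\<lambda>y k. sw (*) (?S y) (\<lambda>x1 x2. \<gamma>' x1 k * \<gamma> z x2))"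
    by (intro sw_cong sw_antipode[symmetric]) (simp_all add: hom_cocycle)
  also have "\<dots> = sw (*) h (\<lambda>y k. sw (*) z (\<lambda>z1 z2. sw (*) (?S y) (\<lambda>x1 x2. sw (*) k (\<lambda>k1 k2.
      \<gamma> z1 (?m x1 k1) * \<gamma>' (?m z2 x2) k2))))"
    by (simp add: cocycle_mixed2)
  also have "\<dots> = sw (*) h (\<lambda>y k. sw (*) (?S y) (\<lambda>x1 x2. sw (*) k (\<lambda>k1 k2. sw (*) z (\<lambda>z1 z2.
      \<gamma> z1 (?m x1 k1) * \<gamma>' (?m z2 x2) k2))))"
    by (subst tsum_swap[OF module_mult, of _ "comult H z"]) (intro sw_cong tsum_swap module_mult)
  also have "\<dots> = sw (*) h (\<lambda>y k. sw (*) y (\<lambda>a b. sw (*) k (\<lambda>c d. ?G a b c d)))"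
    by (intro sw_cong sw_antipode) (simp_all add: hom_cocycle)
  also have "\<dots> = sw (*) h (\<lambda>a x. sw (*) x (\<lambda>y d. sw (*) y (\<lambda>b c. ?G a b c d)))"
    by (rule sw_split4) (simp_all add: hom_cocycle)
  also have "\<dots> = sw (*) h (\<lambda>a x. sw (*) x (\<lambda>y d. ?e y * sw (*) z (\<lambda>z1 z2.
      \<gamma> z1 (unity H) * \<gamma>' (?m z2 (?S a)) d)))"
    by (intro sw_cong sw_antipode_left) (simp add: hom_cocycle)
  also have "\<dots> = sw (*) h (\<lambda>a x. sw (*) z (\<lambda>z1 z2. \<gamma> z1 (unity H) * \<gamma>' (?m z2 (?S a)) x))"
    by (intro sw_cong sw_counit_left) (simp add: hom_cocycle)
  also have "\<dots> = sw (*) h (\<lambda>a x. \<gamma>' (?m z (?S a)) x)"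
    unfolding unital_right by (intro sw_cong sw_counit_left) (simp add: hom_cocycle)
  finally show ?thesis ..
qed

text \<open>
  The other mixed identity, at \<open>(z, h\<^sub>1, S(h\<^sub>2))\<close>, with the collapsing product
  \<open>h\<^sub>2 S(h\<^sub>3)\<close>.
\<close>

lemma cocycle_antipode_left:
  "sw (*) h (\<lambda>a b. \<gamma> (mult H z a) (antipode H b)) = sw (*) h (\<lambda>a b. \<gamma>' z a * u b)"
proof -
  let ?m = "mult H" and ?S = "antipode H" and ?e = "counit H"
  let ?G = "\<lambda>a b c d. sw (*) z (\<lambda>z1 z2. \<gamma> (?m z1 a) (?S d) * \<gamma>' z2 (?m b (?S c)))"
  have "sw (*) h (\<lambda>a b. \<gamma>' z a * u b) =
    sw (*) h (\<lambda>a b. sw (*) b (\<lambda>c d. \<gamma>' z a * \<gamma> c (?S d)))"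
    by (simp add: u_def scale_tsum_right[OF module_mult])
  also have "\<dots> = sw (*) h (\<lambda>y k. sw (*) y (\<lambda>a c. \<gamma>' z a * \<gamma> c (?S k)))"
    by (rule sw_coassoc[symmetric]) (simp_all add: hom_cocycle)
  also have "\<dots> = sw (*) h (\<lambda>y k. sw (*) z (\<lambda>z1 z2. sw (*) y (\<lambda>a b. sw (*) (?S k) (\<lambda>k1 k2.
      \<gamma> (?m z1 a) k1 * \<gamma>' z2 (?m b k2)))))"
    by (simp add: cocycle_mixed1)
  also have "\<dots> = sw (*) h (\<lambda>y k. sw (*) y (\<lambda>a b. sw (*) (?S k) (\<lambda>k1 k2. sw (*) z (\<lambda>z1 z2.
      \<gamma> (?m z1 a) k1 * \<gamma>' z2 (?m b k2)))))"
    by (subst tsum_swap[OF module_mult, of _ "comult H z"]) (intro sw_cong tsum_swap module_mult)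
  also have "\<dots> = sw (*) h (\<lambda>y k. sw (*) y (\<lambda>a b. sw (*) k (\<lambda>c d. ?G a b c d)))"
    by (intro sw_cong sw_antipode) (simp_all add: hom_cocycle)
  also have "\<dots> = sw (*) h (\<lambda>a x. sw (*) x (\<lambda>y d. sw (*) y (\<lambda>b c. ?G a b c d)))"
    by (rule sw_split4) (simp_all add: hom_cocycle)
  also have "\<dots> = sw (*) h (\<lambda>a x. sw (*) x (\<lambda>y d. ?e y * sw (*) z (\<lambda>z1 z2.
      \<gamma> (?m z1 a) (?S d) * \<gamma>' z2 (unity H))))"
    by (intro sw_cong sw_antipode_right) (simp add: hom_cocycle)
  also have "\<dots> = sw (*) h (\<lambda>a x. sw (*) z (\<lambda>z1 z2. \<gamma> (?m z1 a) (?S x) * \<gamma>' z2 (unity H)))"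
    by (intro sw_cong sw_counit_left) (simp add: hom_cocycle)
  also have "\<dots> = sw (*) h (\<lambda>a x. sw (*) z (\<lambda>z1 z2. ?e z2 * \<gamma> (?m z1 a) (?S x)))"
    by (simp add: unital_right' mult.commute)
  also have "\<dots> = sw (*) h (\<lambda>a x. \<gamma> (?m z a) (?S x))"
    by (intro sw_cong sw_counit_right) (simp add: hom_cocycle)
  finally show ?thesis ..
qed

text \<open>
  \<open>cocycle_antipode_right\<close> with \<open>z\<close> and \<open>h\<close> the two halves of one coproduct: then
  \<open>z S(h\<^sub>1)\<close> collapses as well.
\<close>

lemma u_inverse_right: "sw (*) h (\<lambda>a b. u a * u' b) = counit H h"
proof -
  let ?m = "mult H" and ?S = "antipode H" and ?e = "counit H"
  have "sw (*) h (\<lambda>y c. u y * u' c) = sw (*) h (\<lambda>y c. sw (*) y (\<lambda>a b. \<gamma> a (?S b) * u' c))"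
    by (simp add: u_def scale_tsum_left[OF module_mult])
  also have "\<dots> = sw (*) h (\<lambda>a t. sw (*) t (\<lambda>b c. \<gamma> a (?S b) * u' c))"
    by (rule sw_coassoc) (simp_all add: hom_all)
  also have "\<dots> = sw (*) h (\<lambda>a t. sw (*) t (\<lambda>b c. \<gamma>' (?m a (?S b)) c))"
    by (simp add: cocycle_antipode_right)
  also have "\<dots> = sw (*) h (\<lambda>y c. sw (*) y (\<lambda>a b. \<gamma>' (?m a (?S b)) c))"
    by (rule sw_coassoc[symmetric]) (simp_all add: hom_all)
  also have "\<dots> = sw (*) h (\<lambda>y c. ?e y * \<gamma>' (unity H) c)"
    by (intro sw_cong sw_antipode_right) (simp add: hom_all)
  also have "\<dots> = \<gamma>' (unity H) h"
    by (rule sw_counit_left) (simp add: hom_all)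
  finally show ?thesis by (simp add: unital_left')
qed

lemma u_inverse_left: "sw (*) h (\<lambda>a b. u' a * u b) = counit H h"
proof -
  let ?m = "mult H" and ?S = "antipode H" and ?e = "counit H"
  have "sw (*) h (\<lambda>y c. u' y * u c) = sw (*) h (\<lambda>y c. sw (*) y (\<lambda>a b. \<gamma>' (?S a) b * u c))"
    by (simp add: u'_def scale_tsum_left[OF module_mult])
  also have "\<dots> = sw (*) h (\<lambda>a t. sw (*) t (\<lambda>b c. \<gamma>' (?S a) b * u c))"
    by (rule sw_coassoc) (simp_all add: hom_all)
  also have "\<dots> = sw (*) h (\<lambda>a t. sw (*) t (\<lambda>b c. \<gamma> (?m (?S a) b) (?S c)))"
    by (simp add: cocycle_antipode_left)
  also have "\<dots> = sw (*) h (\<lambda>y c. sw (*) y (\<lambda>a b. \<gamma> (?m (?S a) b) (?S c)))"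
    by (rule sw_coassoc[symmetric]) (simp_all add: hom_all)
  also have "\<dots> = sw (*) h (\<lambda>y c. ?e y * \<gamma> (unity H) (?S c))"
    by (intro sw_cong sw_antipode_left) (simp add: hom_all)
  also have "\<dots> = \<gamma> (unity H) (?S h)"
    by (rule sw_counit_left) (simp add: hom_all)
  finally show ?thesis by (simp add: unital_left counit_antipode)
qed

end

section \<open>The twisted product\<close>

context hopf_cocycle
begin

abbreviation "tmult \<equiv> twist_mult H \<gamma> \<gamma>'"

text \<open>
  The product \<open>m * \<gamma>'\<close>, so that the twisted product is \<open>\<gamma>\<close> convolved with it.
\<close>

definition right_twist :: "'h \<Rightarrow> 'h \<Rightarrow> 'h" where
  "right_twist g h =
     sw (scl H) g (\<lambda>g1 g2. sw (scl H) h (\<lambda>h1 h2. scl H (\<gamma>' g2 h2) (mult H g1 h1)))"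

lemma hom_right_twist:
  assumes "module_hom s (scl H) f"
  shows "module_hom s (scl H) (\<lambda>x. right_twist (f x) y)" "module_hom s (scl H) (\<lambda>x. right_twist y (f x))"
proof -
  have "module s" using assms by (simp add: module_hom_iff)
  then show "module_hom s (scl H) (\<lambda>x. right_twist (f x) y)" "module_hom s (scl H) (\<lambda>x. right_twist y (f x))"
    using assms by (simp_all add: right_twist_def hom_all)
qed

lemma compatible_cocycle:
  "compatible rels2 (*) (\<lambda>(g, h). \<gamma> g h)" "compatible rels2 (*) (\<lambda>(g, h). \<gamma>' g h)"
  "compatible rels2 (scl H) (\<lambda>(g, h). mult H g h)"
  by (simp_all add: compatible_iff hom_all)

lemma right_twist_conv:
  "(\<lambda>(g, h). right_twist g h) =
     conv (scl H) (\<lambda>v c. scl H c v) \<Delta>2 (\<lambda>(g, h). mult H g h) (\<lambda>(g, h). \<gamma>' g h)"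
  by (auto simp: fun_eq_iff right_twist_def conv_pair[OF module_scl])

lemma twist_mult_eq:
  "tmult g h = sw (scl H) g (\<lambda>g1 g2. sw (scl H) h (\<lambda>h1 h2. scl H (\<gamma> g1 h1) (right_twist g2 h2)))"
proof -
  let ?s = "scl H"
  have "tmult g h = sw ?s g (\<lambda>x g3. sw ?s h (\<lambda>y h3. sw ?s x (\<lambda>g1 g2. sw ?s y (\<lambda>h1 h2.
      ?s (\<gamma>' g3 h3) (?s (\<gamma> g1 h1) (mult H g2 h2))))))"
    unfolding twist_mult_def tsum3_def
    by (subst tsum_swap[OF module_scl, of _ "comult H h"])
      (simp add: module.scale_scale[OF module_scl] mult.commute)
  also have "\<dots> = conv ?s (\<lambda>v c. ?s c v) \<Delta>2 (conv ?s ?s \<Delta>2 (\<lambda>(g, h). \<gamma> g h)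
      (\<lambda>(g, h). mult H g h)) (\<lambda>(g, h). \<gamma>' g h) (g, h)"
    by (simp add: conv_pair[OF module_scl] scale_tsum_right[OF module_scl])
  also have "\<dots> = conv ?s ?s \<Delta>2 (\<lambda>(g, h). \<gamma> g h) (\<lambda>(g, h). right_twist g h) (g, h)"
    unfolding right_twist_conv by (rule C2.conv_scale_middle[OF module_scl]) (simp_all add: compatible_cocycle)
  finally show ?thesis by (simp add: conv_pair[OF module_scl])
qed

lemma twist_mult_conv:
  "(\<lambda>(g, h). tmult g h) = conv (scl H) (scl H) \<Delta>2 (\<lambda>(g, h). \<gamma> g h)
     (conv (scl H) (\<lambda>v c. scl H c v) \<Delta>2 (\<lambda>(g, h). mult H g h) (\<lambda>(g, h). \<gamma>' g h))"
  unfolding right_twist_conv[symmetric]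
  by (auto simp: fun_eq_iff twist_mult_eq conv_pair[OF module_scl])

lemma hom_twist_mult:
  assumes "module_hom s (scl H) f"
  shows "module_hom s (scl H) (\<lambda>x. tmult (f x) y)" "module_hom s (scl H) (\<lambda>x. tmult y (f x))"
proof -
  have "module s" using assms by (simp add: module_hom_iff)
  then show "module_hom s (scl H) (\<lambda>x. tmult (f x) y)" "module_hom s (scl H) (\<lambda>x. tmult y (f x))"
    using assms by (simp_all add: twist_mult_eq hom_all hom_right_twist)
qed

lemma bilinear_twist_mult: "bilinear_map (scl H) (scl H) (scl H) tmult"
  by (rule bilinearI_H) (simp_all add: hom_twist_mult hom_id[OF module_scl])

lemma hom_twist_mult_eq:
  assumes "module_hom (scl H) s L"
  shows "L (tmult g h) = sw s g (\<lambda>g1 g2. sw s h (\<lambda>h1 h2. s (\<gamma> g1 h1)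
    (sw s g2 (\<lambda>g1 g2. sw s h2 (\<lambda>h1 h2. s (\<gamma>' g2 h2) (L (mult H g1 h1)))))))"
  using module_hom.scale[OF assms]
  by (simp add: twist_mult_eq right_twist_def module_hom_tsum_eq[OF assms])

text \<open>
  On triples, both products of three factors are conjugates of the untwisted one: by the left
  and by the right side of the cocycle identity.
\<close>

lemma twist_mult_assoc: "tmult (tmult g h) k = tmult g (tmult h k)"
proof -
  let ?s = "scl H"
  let ?l = "conv ?s ?s \<Delta>3" and ?r = "conv ?s (\<lambda>v c. ?s c v) \<Delta>3"
  let ?m3 = "\<lambda>(g, h, k). mult H (mult H g h) k"
  note lin = hom_all hom_twist_mult hom_right_twist
  have [simp]: "mult12 f (g, h, k) = f (mult H g h) k" "mult23 f (g, h, k) = f g (mult H h k)"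
    for f :: "'h \<Rightarrow> 'h \<Rightarrow> 'k" and g h k
    by (simp_all add: mult12_def mult23_def)
  have left: "(\<lambda>(g, h, k). tmult (mult H g h) k) = ?l (mult12 \<gamma>) (?r ?m3 (mult12 \<gamma>'))"
  proof
    fix p :: "'h \<times> 'h \<times> 'h"
    obtain g h k where p: "p = (g, h, k)" by (cases p)
    have R: "right_twist (mult H g h) k = ?r ?m3 (mult12 \<gamma>') (g, h, k)" for g h k
      unfolding right_twist_def conv_triple[OF module_scl] by (subst sw_mult) (simp_all add: lin)
    have "tmult (mult H g h) k = sw ?s g (\<lambda>g1 g2. sw ?s h (\<lambda>h1 h2. sw ?s k (\<lambda>k1 k2.
        ?s (\<gamma> (mult H g1 h1) k1) (right_twist (mult H g2 h2) k2))))"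
      unfolding twist_mult_eq by (subst sw_mult) (simp_all add: lin)
    then show "(case p of (g, h, k) \<Rightarrow> tmult (mult H g h) k) = ?l (mult12 \<gamma>) (?r ?m3 (mult12 \<gamma>')) p"
      by (simp add: p R conv_triple[OF module_scl, of ?s "mult12 \<gamma>"])
  qed
  have right: "(\<lambda>(g, h, k). tmult g (mult H h k)) = ?l (mult23 \<gamma>) (?r ?m3 (mult23 \<gamma>'))"
  proof
    fix p :: "'h \<times> 'h \<times> 'h"
    obtain g h k where p: "p = (g, h, k)" by (cases p)
    have R: "right_twist g (mult H h k) = ?r ?m3 (mult23 \<gamma>') (g, h, k)" for g h k
      unfolding right_twist_def conv_triple[OF module_scl]
      by (intro sw_cong, subst sw_mult) (simp_all add: lin mult_assoc)
    have "tmult g (mult H h k) = sw ?s g (\<lambda>g1 g2. sw ?s h (\<lambda>h1 h2. sw ?s k (\<lambda>k1 k2.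
        ?s (\<gamma> g1 (mult H h1 k1)) (right_twist g2 (mult H h2 k2)))))"
      unfolding twist_mult_eq by (intro sw_cong, subst sw_mult) (simp_all add: lin)
    then show "(case p of (g, h, k) \<Rightarrow> tmult g (mult H h k)) = ?l (mult23 \<gamma>) (?r ?m3 (mult23 \<gamma>')) p"
      by (simp add: p R conv_triple[OF module_scl, of ?s "mult23 \<gamma>"])
  qed
  have m3: "compatible rels3 ?s ?m3"
    by (simp add: compatible_iff lin)
  have "tmult (tmult g h) k = ?l (third_idle \<gamma>) (?r (\<lambda>(g, h, k). tmult (mult H g h) k) (third_idle \<gamma>')) (g, h, k)"
  proof -
    let ?X = "?r (\<lambda>(g, h, k). tmult (mult H g h) k) (third_idle \<gamma>')"
    have X: "?X (g, h, k) = sw ?s g (\<lambda>g1 g2. sw ?s h (\<lambda>h1 h2.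
        ?s (\<gamma>' g2 h2) (tmult (mult H g1 h1) k)))" for g h k
      unfolding third_idle_def by (subst conv_ignore_third_right) (simp_all add: lin)
    have "?l (third_idle \<gamma>) ?X (g, h, k) =
        sw ?s g (\<lambda>g1 g2. sw ?s h (\<lambda>h1 h2. ?s (\<gamma> g1 h1) (?X (g2, h2, k))))"
      unfolding third_idle_def[of \<gamma>] by (rule conv_ignore_third_left) (simp add: X lin)
    then show ?thesis
      by (simp add: X hom_twist_mult_eq[of ?s "\<lambda>x. tmult x k"] lin)
  qed
  also have "\<dots> = ?l (conv (*) (*) \<Delta>3 (third_idle \<gamma>) (mult12 \<gamma>))
      (?r ?m3 (conv (*) (*) \<Delta>3 (mult12 \<gamma>') (third_idle \<gamma>'))) (g, h, k)"
    unfolding left by (rule C3.conv_sandwich[OF module_scl]) (simp_all add: triples_compatible m3)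
  also have "\<dots> = ?l (conv (*) (*) \<Delta>3 (first_idle \<gamma>) (mult23 \<gamma>))
      (?r ?m3 (conv (*) (*) \<Delta>3 (mult23 \<gamma>') (first_idle \<gamma>'))) (g, h, k)"
    by (simp add: cocycle_conv cocycle_inverse_conv)
  also have "\<dots> = ?l (first_idle \<gamma>) (?r (\<lambda>(g, h, k). tmult g (mult H h k)) (first_idle \<gamma>')) (g, h, k)"
    unfolding right by (rule C3.conv_sandwich[OF module_scl, symmetric]) (simp_all add: triples_compatible m3)
  also have "\<dots> = tmult g (tmult h k)"
  proof -
    let ?X = "?r (\<lambda>(g, h, k). tmult g (mult H h k)) (first_idle \<gamma>')"
    have X: "?X (g, h, k) = sw ?s h (\<lambda>h1 h2. sw ?s k (\<lambda>k1 k2.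
        ?s (\<gamma>' h2 k2) (tmult g (mult H h1 k1))))" for g h k
      unfolding first_idle_def by (subst conv_ignore_first_right) (simp_all add: lin)
    have "?l (first_idle \<gamma>) ?X (g, h, k) =
        sw ?s h (\<lambda>h1 h2. sw ?s k (\<lambda>k1 k2. ?s (\<gamma> h1 k1) (?X (g, h2, k2))))"
      unfolding first_idle_def[of \<gamma>] by (rule conv_ignore_first_left) (simp add: X lin)
    then show ?thesis
      by (simp add: X hom_twist_mult_eq[of ?s "\<lambda>x. tmult g x"] lin)
  qed
  finally show ?thesis .
qed

lemma right_twist_unity: "right_twist (unity H) h = h" "right_twist h (unity H) = h"
proof -
  have "right_twist (unity H) h = sw (scl H) h (\<lambda>h1 h2. scl H (counit H h2) h1)"
    unfolding right_twist_def by (subst sw_unity) (simp_all add: hom_all unital_left' unity_left)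
  then show "right_twist (unity H) h = h" by (simp add: counit_right)
  have "right_twist h (unity H) = sw (scl H) h (\<lambda>h1 h2. scl H (counit H h2) h1)"
    unfolding right_twist_def
    by (intro sw_cong, subst sw_unity) (simp_all add: hom_all unital_right' unity_right)
  then show "right_twist h (unity H) = h" by (simp add: counit_right)
qed

lemma twist_mult_unity: "tmult (unity H) h = h" "tmult h (unity H) = h"
proof -
  note lin = hom_all hom_right_twist
  have "tmult (unity H) h = sw (scl H) h (\<lambda>h1 h2. scl H (counit H h1) h2)"
    unfolding twist_mult_eq
    by (subst sw_unity) (simp_all add: lin unital_left right_twist_unity)
  then show "tmult (unity H) h = h" by (simp add: counit_left)
  have "tmult h (unity H) = sw (scl H) h (\<lambda>h1 h2. scl H (counit H h1) h2)"
    unfolding twist_mult_eq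
    by (intro sw_cong, subst sw_unity) (simp_all add: lin unital_right right_twist_unity)
  then show "tmult h (unity H) = h" by (simp add: counit_left)
qed

text \<open>
  The coproduct of a twisted product: \<open>\<Delta>\<close> is multiplicative for the untwisted product, and the
  scalar factors \<open>\<gamma>\<close> and \<open>\<gamma>'\<close> pass through.
\<close>

lemma sw_twist_mult:
  assumes T: "bilinear_map (scl H) (scl H) s T"
  shows "sw s (tmult g h) T =
    conv s s \<Delta>2 (\<lambda>(g, h). \<gamma> g h) (conv s (\<lambda>v c. s c v) \<Delta>2
      (conv s T \<Delta>2 (\<lambda>(g, h). mult H g h) (\<lambda>(g, h). mult H g h)) (\<lambda>(g, h). \<gamma>' g h)) (g, h)"
proof -
  note B = bilinear_mapD[OF T]
  have "module_hom (scl H) s (\<lambda>x. sw s x (\<lambda>a b. T a b))"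
    by (rule hom_comult) (simp_all add: hom_id module_scl B)
  moreover have "sw s (mult H g h) T = conv s T \<Delta>2 (\<lambda>(g, h). mult H g h) (\<lambda>(g, h). mult H g h) (g, h)" for g h
    by (simp add: conv_pair[OF B(5)] sw_mult B)
  ultimately show ?thesis
    using hom_twist_mult_eq[of s "\<lambda>x. sw s x (\<lambda>a b. T a b)" g h]
    by (simp add: conv_pair[OF B(5), of _ "\<lambda>(g, h). \<gamma> g h"] conv_pair[OF B(5), of _ _ "\<lambda>(g, h). \<gamma>' g h"]
        conv_pair[OF B(5), of "\<lambda>v c. s c v"])
qed

lemma comult_twist_mult:
  "comult H (tmult g h) = tclass (tensor_null (scl H) (scl H))
     (tsum fscale (comult H g) (\<lambda>g1 g2. tsum fscale (comult H h) (\<lambda>h1 h2.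
        gen (tmult g1 h1, tmult g2 h2))))"
proof (rule tsum_eq_imp_tensor_eq)
  let ?s = "scl H"
  let ?T = "tens ?s ?s"
  let ?g = "\<lambda>(g, h). \<gamma> g h" and ?g' = "\<lambda>(g, h). \<gamma>' g h" and ?m = "\<lambda>(g, h). mult H g h"
  let ?N = "conv ?s (\<lambda>v c. ?s c v) \<Delta>2 ?m ?g'"
  note q = module_qscale
  have T: "bilinear_map ?s ?s qscale ?T" by (rule bilinear_tens[OF module_scl module_scl])
  have N: "compatible rels2 ?s ?N"
    by (rule C2.compatible_conv[OF bilinear_scale_flip[OF module_scl]]) (simp_all add: compatible_cocycle)
  show "comult H (tmult g h) \<in> tspace (tensor_null ?s ?s)"
    using comult_linear by (simp add: tlinear_def)
  have "lext qscale (\<lambda>(x, y). ?T x y) (tsum fscale (comult H g) (\<lambda>g1 g2.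
      tsum fscale (comult H h) (\<lambda>h1 h2. gen (tmult g1 h1, tmult g2 h2)))) =
    conv qscale ?T \<Delta>2 (\<lambda>(g, h). tmult g h) (\<lambda>(g, h). tmult g h) (g, h)"
    by (simp add: tsum_eq_lext lext_lext[OF q] split_def q conv_def lext_prod_coact[OF q])
  also have "\<dots> = conv qscale qscale \<Delta>2 ?g (conv qscale ?T \<Delta>2 ?N (conv ?s ?s \<Delta>2 ?g ?N)) (g, h)"
    unfolding twist_mult_conv
    by (rule C2.conv_scale_pull_left[OF T])
      (simp_all add: compatible_cocycle N C2.compatible_conv[OF bilinear_scale[OF module_scl]])
  also have "conv qscale ?T \<Delta>2 ?N (conv ?s ?s \<Delta>2 ?g ?N) = conv qscale ?T \<Delta>2 ?m ?N"
    by (intro ext conv_cancel_middle[OF C2.formal_comodule_axioms C2.formal_coalgebra_axioms T])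
      (simp_all add: compatible_cocycle N conv_inverse)
  also have "\<dots> = conv qscale (\<lambda>v c. qscale c v) \<Delta>2 (conv qscale ?T \<Delta>2 ?m ?m) ?g'"
    by (intro ext C2.conv_scale_pull_right[OF T]) (simp_all add: compatible_cocycle)
  finally show "tsum qscale (comult H (tmult g h)) ?T = lext qscale (\<lambda>(x, y). ?T x y)
      (tsum fscale (comult H g) (\<lambda>g1 g2.
      tsum fscale (comult H h) (\<lambda>h1 h2. gen (tmult g1 h1, tmult g2 h2))))"
    by (simp add: sw_twist_mult[OF T])
qed

lemma counit_twist_mult: "counit H (tmult g h) = counit H g * counit H h"
proof -
  have "counit H (tmult g h) = sw (*) g (\<lambda>g1 g2. sw (*) h (\<lambda>h1 h2. \<gamma> g1 h1 *
      sw (*) g2 (\<lambda>a b. sw (*) h2 (\<lambda>c d. counit H a * (counit H c * \<gamma>' b d)))))"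
    by (subst hom_twist_mult_eq[OF counit_linear]) (simp add: counit_mult mult_ac)
  also have "\<dots> = sw (*) g (\<lambda>g1 g2. sw (*) h (\<lambda>h1 h2. \<gamma> g1 h1 *
      sw (*) g2 (\<lambda>a b. counit H a * \<gamma>' b h2)))"
    by (simp add: scale_tsum_right[OF module_mult, symmetric] sw_counit_left[of "(*)"] hom_all)
  also have "\<dots> = sw (*) g (\<lambda>g1 g2. sw (*) h (\<lambda>h1 h2. \<gamma> g1 h1 * \<gamma>' g2 h2))"
    by (simp add: sw_counit_left[of "(*)"] hom_all)
  finally show ?thesis by (simp add: inverse_right)
qed

end

section \<open>The twisted antipode\<close>

context hopf_cocycle
begin

text \<open>
  The product \<open>\<gamma> * m\<close>, the counterpart of \<open>right_twist\<close> for products with an antipode on the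
  right.
\<close>

definition left_twist :: "'h \<Rightarrow> 'h \<Rightarrow> 'h" where
  "left_twist g h =
     sw (scl H) g (\<lambda>g1 g2. sw (scl H) h (\<lambda>h1 h2. scl H (\<gamma> g1 h1) (mult H g2 h2)))"

lemma hom_left_twist:
  assumes "module_hom s (scl H) f"
  shows "module_hom s (scl H) (\<lambda>x. left_twist (f x) y)" "module_hom s (scl H) (\<lambda>x. left_twist y (f x))"
proof -
  have "module s" using assms by (simp add: module_hom_iff)
  then show "module_hom s (scl H) (\<lambda>x. left_twist (f x) y)" "module_hom s (scl H) (\<lambda>x. left_twist y (f x))"
    using assms by (simp_all add: left_twist_def hom_all)
qed

lemma twist_mult_eq_left:
  "tmult g h = sw (scl H) g (\<lambda>g1 g2. sw (scl H) h (\<lambda>h1 h2. scl H (\<gamma>' g2 h2) (left_twist g1 h1)))"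
proof -
  let ?s = "scl H"
  have "tmult g h = conv ?s ?s \<Delta>2 (\<lambda>(g, h). \<gamma> g h)
      (conv ?s (\<lambda>v c. ?s c v) \<Delta>2 (\<lambda>(g, h). mult H g h) (\<lambda>(g, h). \<gamma>' g h)) (g, h)"
    unfolding twist_mult_conv[symmetric] by simp
  also have "\<dots> = conv ?s (\<lambda>v c. ?s c v) \<Delta>2 (conv ?s ?s \<Delta>2 (\<lambda>(g, h). \<gamma> g h)
      (\<lambda>(g, h). mult H g h)) (\<lambda>(g, h). \<gamma>' g h) (g, h)"
    by (rule C2.conv_scale_middle[symmetric, OF module_scl]) (simp_all add: compatible_cocycle)
  finally show ?thesis by (simp add: conv_pair[OF module_scl] left_twist_def)
qed

abbreviation "tantipode \<equiv> twist_antipode H \<gamma> \<gamma>'"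

lemma twist_antipode_eq:
  "tantipode h = sw (scl H) h (\<lambda>x c. sw (scl H) x (\<lambda>p q. scl H (u p) (scl H (u' c) (antipode H q))))"
  unfolding twist_antipode_def tsum3_def Let_def u_def[symmetric] u'_def[symmetric]
  by (simp add: module.scale_scale[OF module_scl])

lemma hom_twist_antipode:
  assumes "module_hom s (scl H) f"
  shows "module_hom s (scl H) (\<lambda>x. tantipode (f x))"
  using assms by (simp add: twist_antipode_eq hom_all)

lemmas hom_twist = hom_all hom_right_twist hom_left_twist hom_twist_mult hom_twist_antipode

text \<open>
  Expanding \<open>u'\<close>, the sum is \<open>\<gamma>'(S(h\<^sub>2), h\<^sub>3) \<gamma>(S(h\<^sub>1), h\<^sub>4)\<close>.  Since \<open>S\<close> reverses the coproduct,
  this nested arrangement is the convolution \<open>\<gamma>' * \<gamma>\<close> at \<open>(S(h\<^sub>1), h\<^sub>2)\<close>.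
\<close>

lemma u'_cancel: "sw (*) h (\<lambda>b t. sw (*) t (\<lambda>c d. u' c * \<gamma> (antipode H b) d)) = counit H h"
proof -
  let ?S = "antipode H"
  have "sw (*) h (\<lambda>b t. sw (*) t (\<lambda>c d. u' c * \<gamma> (?S b) d)) =
    sw (*) h (\<lambda>a t. sw (*) t (\<lambda>y d. sw (*) y (\<lambda>b c. \<gamma>' (?S b) c * \<gamma> (?S a) d)))"
    by (simp add: u'_def scale_tsum_left[OF module_mult])
  also have "\<dots> = sw (*) h (\<lambda>x k. sw (*) x (\<lambda>a b. sw (*) k (\<lambda>c d. \<gamma>' (?S b) c * \<gamma> (?S a) d)))"
    by (rule sw_split4[symmetric]) (simp_all add: hom_twist)
  also have "\<dots> = sw (*) h (\<lambda>x k. sw (*) (?S x) (\<lambda>a b. sw (*) k (\<lambda>c d. \<gamma>' a c * \<gamma> b d)))"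
    by (intro sw_cong sw_antipode[symmetric]) (simp_all add: hom_twist)
  also have "\<dots> = sw (*) h (\<lambda>x k. counit H x * counit H k)"
    by (simp add: inverse_left counit_antipode)
  also have "\<dots> = counit H h"
    by (rule sw_counit_left) (simp add: hom_twist)
  finally show ?thesis .
qed

lemma u_cancel: "sw (*) h (\<lambda>b t. sw (*) t (\<lambda>c d. u c * \<gamma>' b (antipode H d))) = counit H h"
proof -
  let ?S = "antipode H"
  have "sw (*) h (\<lambda>b t. sw (*) t (\<lambda>c d. u c * \<gamma>' b (?S d))) =
    sw (*) h (\<lambda>a t. sw (*) t (\<lambda>y d. sw (*) y (\<lambda>b c. \<gamma> b (?S c) * \<gamma>' a (?S d))))"
    by (simp add: u_def scale_tsum_left[OF module_mult])
  also have "\<dots> = sw (*) h (\<lambda>x k. sw (*) x (\<lambda>a b. sw (*) k (\<lambda>c d. \<gamma> b (?S c) * \<gamma>' a (?S d))))"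
    by (rule sw_split4[symmetric]) (simp_all add: hom_twist)
  also have "\<dots> = sw (*) h (\<lambda>x k. sw (*) x (\<lambda>a b. sw (*) (?S k) (\<lambda>c d. \<gamma> b d * \<gamma>' a c)))"
    by (intro sw_cong sw_antipode[symmetric]) (simp_all add: hom_twist)
  also have "\<dots> = sw (*) h (\<lambda>x k. counit H x * counit H k)"
    using inverse_left by (simp add: counit_antipode mult.commute)
  also have "\<dots> = counit H h"
    by (rule sw_counit_left) (simp add: hom_twist)
  finally show ?thesis .
qed

text \<open>
  The part of \<open>S\<^sub>\<gamma>(h\<^sub>1) \<cdot>\<^sub>\<gamma> h\<^sub>2\<close> without its leading factor \<open>u\<close>.  The sums nest around their
  middle: first \<open>u'\<close> cancels against the \<open>\<gamma>\<close> of the twisted product, then \<open>S(h\<^sub>2) h\<^sub>3\<close>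
  collapses, and the remaining \<open>\<gamma>'\<close> is again \<open>u'\<close>, which \<open>u\<close> can cancel.
\<close>

lemma twist_mult_antipode_left:
  "sw (scl H) h (\<lambda>a t. sw (scl H) t (\<lambda>m k. scl H (u' m) (tmult (antipode H a) k))) =
     scl H (u' h) (unity H)"
proof -
  let ?S = "antipode H" and ?s = "scl H" and ?e = "counit H"
  let ?G = "\<lambda>a b c d e. ?s (u' c) (?s (\<gamma> (?S b) d) (right_twist (?S a) e))"
  have tmult: "tmult (?S a) k =
    sw ?s a (\<lambda>a1 a2. sw ?s k (\<lambda>k1 k2. ?s (\<gamma> (?S a2) k1) (right_twist (?S a1) k2)))" for a k
    unfolding twist_mult_eq by (rule sw_antipode) (simp_all add: hom_twist)
  have rt: "right_twist (?S a) k =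
    sw ?s a (\<lambda>a1 a2. sw ?s k (\<lambda>k1 k2. ?s (\<gamma>' (?S a1) k2) (mult H (?S a2) k1)))" for a k
    unfolding right_twist_def by (rule sw_antipode) (simp_all add: hom_twist)
  have "sw ?s h (\<lambda>a t. sw ?s t (\<lambda>m k. ?s (u' m) (tmult (?S a) k))) =
    sw ?s h (\<lambda>x t. sw ?s t (\<lambda>c y. sw ?s x (\<lambda>a b. sw ?s y (\<lambda>d e. ?G a b c d e))))"
    by (simp add: tmult scale_tsum_right[OF module_scl])
  also have "\<dots> = sw ?s h (\<lambda>a x. sw ?s x (\<lambda>y e. sw ?s y (\<lambda>b t. sw ?s t (\<lambda>c d. ?G a b c d e))))"
    by (rule sw_split5) (simp_all add: hom_twist)
  also have "\<dots> = sw ?s h (\<lambda>a x. sw ?s x (\<lambda>y e. ?s (?e y) (right_twist (?S a) e)))"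
    by (simp add: u'_cancel[symmetric] scale_tsum_left[OF module_scl] module.scale_scale[OF module_scl])
  also have "\<dots> = sw ?s h (\<lambda>a x. right_twist (?S a) x)"
    by (intro sw_cong sw_counit_left) (simp add: hom_twist)
  also have "\<dots> = sw ?s h (\<lambda>x y. sw ?s x (\<lambda>a b. sw ?s y (\<lambda>c d. ?s (\<gamma>' (?S a) d) (mult H (?S b) c))))"
    by (simp add: rt)
  also have "\<dots> = sw ?s h (\<lambda>a x. sw ?s x (\<lambda>y d. sw ?s y (\<lambda>b c. ?s (\<gamma>' (?S a) d) (mult H (?S b) c))))"
    by (rule sw_split4) (simp_all add: hom_twist)
  also have "\<dots> = sw ?s h (\<lambda>a x. sw ?s x (\<lambda>y d. ?s (?e y) (?s (\<gamma>' (?S a) d) (unity H))))"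
    by (intro sw_cong sw_antipode_left) (simp add: hom_twist)
  also have "\<dots> = sw ?s h (\<lambda>a x. ?s (\<gamma>' (?S a) x) (unity H))"
    by (intro sw_cong sw_counit_left) (simp add: hom_twist)
  also have "\<dots> = ?s (u' h) (unity H)"
    by (simp add: u'_def scale_tsum_left[OF module_scl])
  finally show ?thesis .
qed

lemma twist_mult_antipode_right:
  "sw (scl H) h (\<lambda>a t. sw (scl H) t (\<lambda>m k. scl H (u m) (tmult a (antipode H k)))) =
     scl H (u h) (unity H)"
proof -
  let ?S = "antipode H" and ?s = "scl H" and ?e = "counit H"
  let ?G = "\<lambda>a b c d e. ?s (u c) (?s (\<gamma>' b (?S d)) (left_twist a (?S e)))"
  have tmult: "tmult a (?S k) =
    sw ?s a (\<lambda>a1 a2. sw ?s k (\<lambda>k1 k2. ?s (\<gamma>' a2 (?S k1)) (left_twist a1 (?S k2))))" for a k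
    unfolding twist_mult_eq_left by (intro sw_cong sw_antipode) (simp_all add: hom_twist)
  have lt: "left_twist a (?S k) =
    sw ?s a (\<lambda>a1 a2. sw ?s k (\<lambda>k1 k2. ?s (\<gamma> a1 (?S k2)) (mult H a2 (?S k1))))" for a k
    unfolding left_twist_def by (intro sw_cong sw_antipode) (simp_all add: hom_twist)
  have "sw ?s h (\<lambda>a t. sw ?s t (\<lambda>m k. ?s (u m) (tmult a (?S k)))) =
    sw ?s h (\<lambda>x t. sw ?s t (\<lambda>c y. sw ?s x (\<lambda>a b. sw ?s y (\<lambda>d e. ?G a b c d e))))"
    by (simp add: tmult scale_tsum_right[OF module_scl])
  also have "\<dots> = sw ?s h (\<lambda>a x. sw ?s x (\<lambda>y e. sw ?s y (\<lambda>b t. sw ?s t (\<lambda>c d. ?G a b c d e))))"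
    by (rule sw_split5) (simp_all add: hom_twist)
  also have "\<dots> = sw ?s h (\<lambda>a x. sw ?s x (\<lambda>y e. ?s (?e y) (left_twist a (?S e))))"
    by (simp add: u_cancel[symmetric] scale_tsum_left[OF module_scl] module.scale_scale[OF module_scl])
  also have "\<dots> = sw ?s h (\<lambda>a x. left_twist a (?S x))"
    by (intro sw_cong sw_counit_left) (simp add: hom_twist)
  also have "\<dots> = sw ?s h (\<lambda>x y. sw ?s x (\<lambda>a b. sw ?s y (\<lambda>c d. ?s (\<gamma> a (?S d)) (mult H b (?S c)))))"
    by (simp add: lt)
  also have "\<dots> = sw ?s h (\<lambda>a x. sw ?s x (\<lambda>y d. sw ?s y (\<lambda>b c. ?s (\<gamma> a (?S d)) (mult H b (?S c)))))"
    by (rule sw_split4) (simp_all add: hom_twist)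
  also have "\<dots> = sw ?s h (\<lambda>a x. sw ?s x (\<lambda>y d. ?s (?e y) (?s (\<gamma> a (?S d)) (unity H))))"
    by (intro sw_cong sw_antipode_right) (simp add: hom_twist)
  also have "\<dots> = sw ?s h (\<lambda>a x. ?s (\<gamma> a (?S x)) (unity H))"
    by (intro sw_cong sw_counit_left) (simp add: hom_twist)
  also have "\<dots> = ?s (u h) (unity H)"
    by (simp add: u_def scale_tsum_left[OF module_scl])
  finally show ?thesis .
qed

lemma twist_antipode_left:
  "sw (scl H) h (\<lambda>a b. tmult (tantipode a) b) = scl H (counit H h) (unity H)"
proof -
  let ?S = "antipode H" and ?s = "scl H" and ?e = "counit H"
  have tantipode: "tantipode a = sw ?s a (\<lambda>p y. sw ?s y (\<lambda>q c. ?s (u p) (?s (u' c) (?S q))))" for a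
    unfolding twist_antipode_eq by (rule sw_coassoc) (simp_all add: hom_twist)
  have lin: "module_hom ?s ?s (\<lambda>x. tmult x b)" for b
    by (simp add: hom_twist)
  have "sw ?s h (\<lambda>a b. tmult (tantipode a) b) =
    sw ?s h (\<lambda>a b. sw ?s a (\<lambda>p y. sw ?s y (\<lambda>q c. ?s (u p) (?s (u' c) (tmult (?S q) b)))))"
    using module_hom.scale[OF lin] by (simp add: tantipode module_hom_tsum_eq[OF lin])
  also have "\<dots> =
    sw ?s h (\<lambda>p z. sw ?s z (\<lambda>y b. sw ?s y (\<lambda>q c. ?s (u p) (?s (u' c) (tmult (?S q) b)))))"
    by (rule sw_coassoc) (simp_all add: hom_twist)
  also have "\<dots> =
    sw ?s h (\<lambda>p z. sw ?s z (\<lambda>q t. sw ?s t (\<lambda>c b. ?s (u p) (?s (u' c) (tmult (?S q) b)))))"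
    by (intro sw_cong sw_coassoc) (simp_all add: hom_twist)
  also have "\<dots> = sw ?s h (\<lambda>p z. ?s (u p) (?s (u' z) (unity H)))"
    by (simp add: scale_tsum_right[OF module_scl, symmetric] twist_mult_antipode_left)
  also have "\<dots> = ?s (?e h) (unity H)"
    by (simp add: scale_tsum_left[OF module_scl, symmetric] u_inverse_right module.scale_scale[OF module_scl])
  finally show ?thesis .
qed

lemma twist_antipode_right:
  "sw (scl H) h (\<lambda>a b. tmult a (tantipode b)) = scl H (counit H h) (unity H)"
proof -
  let ?S = "antipode H" and ?s = "scl H" and ?e = "counit H"
  have lin: "module_hom ?s ?s (\<lambda>x. tmult a x)" for a
    by (simp add: hom_twist)
  have "sw ?s h (\<lambda>a b. tmult a (tantipode b)) =
    sw ?s h (\<lambda>a b. sw ?s b (\<lambda>x c. sw ?s x (\<lambda>p q. ?s (u' c) (?s (u p) (tmult a (?S q))))))"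
    using module_hom.scale[OF lin]
    by (simp add: twist_antipode_eq module_hom_tsum_eq[OF lin] module.scale_left_commute[OF module_scl])
  also have "\<dots> =
    sw ?s h (\<lambda>y c. sw ?s y (\<lambda>a x. sw ?s x (\<lambda>p q. ?s (u' c) (?s (u p) (tmult a (?S q))))))"
    by (rule sw_coassoc[symmetric]) (simp_all add: hom_twist)
  also have "\<dots> = sw ?s h (\<lambda>y c. ?s (u' c) (?s (u y) (unity H)))"
    by (simp add: scale_tsum_right[OF module_scl, symmetric] twist_mult_antipode_right)
  also have "\<dots> = sw ?s h (\<lambda>y c. ?s (u y) (?s (u' c) (unity H)))"
    by (intro sw_cong module.scale_left_commute[OF module_scl])
  also have "\<dots> = ?s (?e h) (unity H)"
    by (simp add: scale_tsum_left[OF module_scl, symmetric] u_inverse_right module.scale_scale[OF module_scl])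
  finally show ?thesis .
qed

theorem hopf_algebra_twist: "hopf_algebra (twist_hopf H \<gamma> \<gamma>')"
proof (intro hopf_algebra.intro K_algebra.intro hopf_algebra_axioms.intro)
  show "bilinear_map (scl (twist_hopf H \<gamma> \<gamma>')) (scl (twist_hopf H \<gamma> \<gamma>')) (scl (twist_hopf H \<gamma> \<gamma>'))
    (mult (twist_hopf H \<gamma> \<gamma>'))"
    by (simp add: twist_hopf_def bilinear_twist_mult)
  show "module_hom (scl (twist_hopf H \<gamma> \<gamma>')) (scl (twist_hopf H \<gamma> \<gamma>')) (antipode (twist_hopf H \<gamma> \<gamma>'))"
    using hom_twist_antipode[OF hom_id[OF module_scl]] by (simp add: twist_hopf_def)
qed (simp_all add: twist_hopf_def module_scl twist_mult_assoc twist_mult_unity comult_linear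
    counit_linear coassoc counit_left counit_right comult_twist_mult comult_unity
    counit_twist_mult counit_unity twist_antipode_left twist_antipode_right)

end

section \<open>The twisted comodule algebra\<close>

locale comodule_cocycle = hopf_cocycle H \<gamma> \<gamma>' + comodule_algebra H A
  for H :: "('k::comm_ring_1, 'h::ab_group_add) hopf" and \<gamma> \<gamma>' :: "'h \<Rightarrow> 'h \<Rightarrow> 'k"
    and A :: "('k, 'a::ab_group_add, 'h) comod_alg"
begin

abbreviation "ca s a F \<equiv> tsum s (coact A a) F"
abbreviation "\<delta>2 \<equiv> prod_coact \<delta> \<delta>"
abbreviation "\<delta>3 \<equiv> prod_coact \<delta> (prod_coact \<delta> \<delta>)"

lemma compatible_relsA_iff: "module s \<Longrightarrow> compatible relsA s f \<longleftrightarrow> module_hom (scl A) s f"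
  by (rule compatible_linear_rels[OF A.module_scl])

lemma ca_cong: "(\<And>x y. F x y = G x y) \<Longrightarrow> ca s a (\<lambda>x y. F x y) = ca s a (\<lambda>x y. G x y)"
  by (rule tsum_cong)

lemma ca_coassoc:
  assumes "\<And>b c. module_hom (scl A) s (\<lambda>a. F a b c)" "\<And>a c. module_hom (scl H) s (\<lambda>b. F a b c)"
    "\<And>a b. module_hom (scl H) s (F a b)"
  shows "ca s m (\<lambda>x c. ca s x (\<lambda>a b. F a b c)) = ca s m (\<lambda>a x. sw s x (\<lambda>b c. F a b c))"
  unfolding tsum_eq_lext using assms hom_module[OF assms(1)]
  by (intro M.coassoc) (simp_all add: compatible_rels_iff compatible_relsA_iff)

lemma ca_counit:
  assumes "module_hom (scl A) s f"
  shows "ca s m (\<lambda>a b. s (counit H b) (f a)) = f m"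
  unfolding tsum_eq_lext using assms hom_module[OF assms]
  by (intro M.counit) (simp_all add: compatible_relsA_iff)

lemma hom_coact:
  assumes "module_hom s (scl A) g"
    "\<And>b. module_hom (scl A) t (\<lambda>a. F a b)" "\<And>a. module_hom (scl H) t (F a)"
  shows "module_hom s t (\<lambda>x. ca t (g x) (\<lambda>a b. F a b))"
proof (rule hom_compose[OF assms(1)])
  have t: "module t" by (rule hom_module[OF assms(2)])
  show "module_hom (scl A) t (\<lambda>x. ca t x (\<lambda>a b. F a b))"
    using M.compatible_coact[OF t, of F] assms(2,3)
    by (simp add: compatible_rels_iff[OF t] compatible_relsA_iff[OF t] tsum_eq_lext)
qed

lemma bilinearI_A:
  assumes "\<And>b. module_hom (scl A) s (\<lambda>a. F a b)" "\<And>a. module_hom (scl H) s (F a)"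
  shows "bilinear_map (scl A) (scl H) s F"
  using assms by (simp add: bilinear_map_def)

lemma ca_mult:
  assumes "\<And>b. module_hom (scl A) s (\<lambda>a. F a b)" "\<And>a. module_hom (scl H) s (F a)"
  shows "ca s (mult A a b) F =
    ca s a (\<lambda>a0 a1. ca s b (\<lambda>b0 b1. F (mult A a0 b0) (mult H a1 b1)))"
  using hom_module[OF assms(1)]
  unfolding coact_mult tsum_tclass[OF bilinearI_A[OF assms]]
  by (simp add: tsum_eq_lext lext_lext split_def)

lemma ca_coinvariant:
  assumes "b \<in> coinvariants H A"
    and "\<And>b. module_hom (scl A) s (\<lambda>a. F a b)" "\<And>a. module_hom (scl H) s (F a)"
  shows "ca s b F = F b (unity H)"
  using hom_module[OF assms(2)] assms(1)
  by (simp add: coinvariants_def tsum_tclass[OF bilinearI_A[OF assms(2,3)]])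

lemma unity_coinvariant: "unity A \<in> coinvariants H A"
  by (simp add: coinvariants_def coact_unity)

lemma hom_multA_left: "module_hom s (scl A) f \<Longrightarrow> module_hom s (scl A) (\<lambda>x. mult A (f x) y)"
  by (rule hom_bilinear_left[OF A.mult_bilinear])

lemma hom_multA_right: "module_hom s (scl A) f \<Longrightarrow> module_hom s (scl A) (\<lambda>x. mult A y (f x))"
  by (rule hom_bilinear_right[OF A.mult_bilinear])

lemmas hom_A = hom_twist A.module_scl hom_id[OF A.module_scl] hom_coact hom_multA_left hom_multA_right
  hom_scale_left[OF A.module_scl] hom_scale_right[of _ "scl A"]

lemma conv_pairA:
  assumes "module s"
  shows "conv s B \<delta>2 f g (x, y) =
    ca s x (\<lambda>x1 x2. ca s y (\<lambda>y1 y2. B (f (x1, y1)) (g (x2, y2))))"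
  by (simp add: conv_def lext_prod_coact[OF assms] tsum_eq_lext)

lemma conv_tripleA:
  assumes "module s"
  shows "conv s B \<delta>3 f g (x, y, z) =
    ca s x (\<lambda>x1 x2. ca s y (\<lambda>y1 y2. ca s z (\<lambda>z1 z2. B (f (x1, y1, z1)) (g (x2, y2, z2)))))"
  by (simp add: conv_def lext_prod_coact[OF assms] tsum_eq_lext)

text \<open>
  The product of the twisted comodule algebra; a constant of its own because \<open>twist_comod_alg\<close>
  hides it in a record update.
\<close>

definition tmultA :: "'a \<Rightarrow> 'a \<Rightarrow> 'a" where
  "tmultA a b = ca (scl A) a (\<lambda>a0 a1. ca (scl A) b (\<lambda>b0 b1. scl A (\<gamma>' a1 b1) (mult A a0 b0)))"

lemma mult_twist_comod_alg: "mult (twist_comod_alg \<gamma>' A) = tmultA"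
  by (simp add: fun_eq_iff twist_comod_alg_def tmultA_def)

lemma hom_tmultA:
  assumes "module_hom s (scl A) f"
  shows "module_hom s (scl A) (\<lambda>x. tmultA (f x) y)" "module_hom s (scl A) (\<lambda>x. tmultA y (f x))"
proof -
  have "module s" using assms by (simp add: module_hom_iff)
  then show "module_hom s (scl A) (\<lambda>x. tmultA (f x) y)" "module_hom s (scl A) (\<lambda>x. tmultA y (f x))"
    using assms by (simp_all add: tmultA_def hom_A)
qed

lemma compatible_multA: "compatible (rel_prod relsA relsA) (scl A) (\<lambda>(a, b). mult A a b)"
  by (simp add: compatible_rel_prod compatible_relsA_iff hom_A)

lemma tmultA_conv:
  "(\<lambda>(a, b). tmultA a b) =
     conv (scl A) (\<lambda>v c. scl A c v) \<delta>2 (\<lambda>(a, b). mult A a b) (\<lambda>(g, h). \<gamma>' g h)"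
  by (auto simp: fun_eq_iff tmultA_def conv_pairA[OF A.module_scl])

lemma hom_tmultA_eq:
  assumes "module_hom (scl A) s L"
  shows "L (tmultA a b) = ca s a (\<lambda>a0 a1. ca s b (\<lambda>b0 b1. s (\<gamma>' a1 b1) (L (mult A a0 b0))))"
  using module_hom.scale[OF assms] by (simp add: tmultA_def module_hom_tsum_eq[OF assms])

text \<open>
  A coinvariant element contributes \<open>1\<close> to one argument of \<open>\<gamma>'\<close>, and \<open>\<gamma>'\<close> is unital.  This
  covers the unit of the twisted algebra, its product on coinvariants and the balancing relations of
  the tensor product.
\<close>

lemma tmultA_coinvariant:
  assumes b: "b \<in> coinvariants H A"
  shows "tmultA a b = mult A a b" "tmultA b a = mult A b a"
proof -
  have "tmultA a b = ca (scl A) a (\<lambda>a0 a1. scl A (counit H a1) (mult A a0 b))"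
    unfolding tmultA_def by (intro ca_cong, subst ca_coinvariant[OF b]) (simp_all add: hom_A unital_right')
  then show "tmultA a b = mult A a b"
    using ca_counit[of "scl A" "\<lambda>x. mult A x b" a] by (simp add: hom_A)
  have "tmultA b a = ca (scl A) a (\<lambda>a0 a1. scl A (counit H a1) (mult A b a0))"
    unfolding tmultA_def by (subst ca_coinvariant[OF b]) (simp_all add: hom_A unital_left')
  then show "tmultA b a = mult A b a"
    using ca_counit[of "scl A" "\<lambda>x. mult A b x" a] by (simp add: hom_A)
qed

text \<open>
  On triples, the two products are the untwisted one convolved from the right with the two sides
  of the cocycle identity for \<open>\<gamma>'\<close>.
\<close>

lemma tmultA_assoc: "tmultA (tmultA a b) c = tmultA a (tmultA b c)"
proof -
  let ?s = "scl A"
  let ?r = "conv ?s (\<lambda>v c. ?s c v) \<delta>3"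
  let ?m3 = "\<lambda>(a, b, c). mult A (mult A a b) c"
  note lin = hom_A hom_tmultA
  have m3: "compatible (rel_prod relsA (rel_prod relsA relsA)) ?s ?m3"
    by (simp add: compatible_rel_prod compatible_relsA_iff lin)
  have left: "(\<lambda>(a, b, c). tmultA (mult A a b) c) = ?r ?m3 (mult12 \<gamma>')"
  proof
    fix p :: "'a \<times> 'a \<times> 'a"
    obtain a b c where p: "p = (a, b, c)" by (cases p)
    have "tmultA (mult A a b) c = ?r ?m3 (mult12 \<gamma>') (a, b, c)"
      unfolding tmultA_def conv_tripleA[OF A.module_scl] by (subst ca_mult) (simp_all add: lin mult12_def)
    then show "(case p of (a, b, c) \<Rightarrow> tmultA (mult A a b) c) = ?r ?m3 (mult12 \<gamma>') p"
      by (simp add: p)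
  qed
  have right: "(\<lambda>(a, b, c). tmultA a (mult A b c)) = ?r ?m3 (mult23 \<gamma>')"
  proof
    fix p :: "'a \<times> 'a \<times> 'a"
    obtain a b c where p: "p = (a, b, c)" by (cases p)
    have "tmultA a (mult A b c) = ?r ?m3 (mult23 \<gamma>') (a, b, c)"
      unfolding tmultA_def conv_tripleA[OF A.module_scl]
      by (intro ca_cong, subst ca_mult) (simp_all add: lin mult23_def A.mult_assoc)
    then show "(case p of (a, b, c) \<Rightarrow> tmultA a (mult A b c)) = ?r ?m3 (mult23 \<gamma>') p"
      by (simp add: p)
  qed
  have "tmultA (tmultA a b) c = ca ?s a (\<lambda>a0 a1. ca ?s b (\<lambda>b0 b1. ?s (\<gamma>' a1 b1) (tmultA (mult A a0 b0) c)))"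
    by (rule hom_tmultA_eq) (simp add: lin)
  also have "\<dots> = ca ?s a (\<lambda>a0 a1. ca ?s b (\<lambda>b0 b1. ca ?s c (\<lambda>c0 c1.
      ?s (counit H c1) (?s (\<gamma>' a1 b1) (tmultA (mult A a0 b0) c0)))))"
    by (intro ca_cong ca_counit[symmetric]) (simp add: lin)
  also have "\<dots> = ?r (\<lambda>(a, b, c). tmultA (mult A a b) c) (third_idle \<gamma>') (a, b, c)"
    by (simp add: conv_tripleA[OF A.module_scl] third_idle_def module.scale_scale[OF A.module_scl])
  also have "\<dots> = ?r ?m3 (conv (*) (*) \<Delta>3 (mult12 \<gamma>') (third_idle \<gamma>')) (a, b, c)"
    unfolding left by (rule M3.conv_scale_right[OF A.module_scl m3]) (simp_all add: triples_compatible)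
  also have "\<dots> = ?r ?m3 (conv (*) (*) \<Delta>3 (mult23 \<gamma>') (first_idle \<gamma>')) (a, b, c)"
    by (simp add: cocycle_inverse_conv)
  also have "\<dots> = ?r (\<lambda>(a, b, c). tmultA a (mult A b c)) (first_idle \<gamma>') (a, b, c)"
    unfolding right
    by (rule M3.conv_scale_right[OF A.module_scl m3, symmetric]) (simp_all add: triples_compatible)
  also have "\<dots> = ca ?s a (\<lambda>a0 a1. ?s (counit H a1) (ca ?s b (\<lambda>b0 b1. ca ?s c (\<lambda>c0 c1.
      ?s (\<gamma>' b1 c1) (tmultA a0 (mult A b0 c0))))))"
    by (simp add: conv_tripleA[OF A.module_scl] first_idle_def scale_tsum_right[OF A.module_scl]
        module.scale_scale[OF A.module_scl])
  also have "\<dots> = ca ?s b (\<lambda>b0 b1. ca ?s c (\<lambda>c0 c1. ?s (\<gamma>' b1 c1) (tmultA a (mult A b0 c0))))"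
    by (rule ca_counit) (simp add: lin)
  also have "\<dots> = tmultA a (tmultA b c)"
    by (rule hom_tmultA_eq[symmetric]) (simp add: lin)
  finally show ?thesis .
qed

text \<open>
  The factor \<open>\<gamma>'\<close> from the product on \<open>A\<close> cancels the left factor \<open>\<gamma>\<close> of the product on \<open>H\<close>.
\<close>

lemma coact_tmultA:
  "coact A (tmultA a b) = tclass (tensor_null (scl A) (scl H))
     (tsum fscale (coact A a) (\<lambda>a0 a1. tsum fscale (coact A b) (\<lambda>b0 b1.
        gen (tmultA a0 b0, tmult a1 b1))))"
proof (rule tsum_eq_imp_tensor_eq)
  let ?s = "scl H" and ?t = "scl A"
  let ?T = "tens ?t ?s"
  let ?g = "\<lambda>(g, h). \<gamma> g h" and ?g' = "\<lambda>(g, h). \<gamma>' g h" and ?m = "\<lambda>(g, h). mult H g h"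
  let ?mA = "\<lambda>(a, b). mult A a b"
  let ?N = "conv ?s (\<lambda>v c. ?s c v) \<Delta>2 ?m ?g'"
  note q = module_qscale
  have T: "bilinear_map ?t ?s qscale ?T" by (rule bilinear_tens[OF A.module_scl module_scl])
  have N: "compatible rels2 ?s ?N"
    by (rule C2.compatible_conv[OF bilinear_scale_flip[OF module_scl]]) (simp_all add: compatible_cocycle)
  show "coact A (tmultA a b) \<in> tspace (tensor_null ?t ?s)"
    using coact_linear by (simp add: tlinear_def)
  have L: "module_hom ?t qscale (\<lambda>x. ca qscale x (\<lambda>a b. ?T a b))"
    by (rule hom_coact) (simp_all add: hom_id A.module_scl bilinear_mapD[OF T])
  have *: "ca qscale (mult A a b) ?T = conv qscale ?T \<delta>2 ?mA ?m (a, b)" for a b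
    by (simp add: conv_pairA[OF q] ca_mult bilinear_mapD[OF T])
  have "lext qscale (\<lambda>(x, y). ?T x y) (tsum fscale (coact A a) (\<lambda>a0 a1.
      tsum fscale (coact A b) (\<lambda>b0 b1. gen (tmultA a0 b0, tmult a1 b1)))) =
    conv qscale ?T \<delta>2 (\<lambda>(a, b). tmultA a b) (\<lambda>(g, h). tmult g h) (a, b)"
    by (simp add: tsum_eq_lext lext_lext[OF q] split_def q conv_def lext_prod_coact[OF q])
  also have "\<dots> = conv qscale ?T \<delta>2 ?mA ?N (a, b)"
    unfolding twist_mult_conv tmultA_conv
    by (rule conv_cancel_middle[OF M2.formal_comodule_axioms C2.formal_coalgebra_axioms T])
      (simp_all add: compatible_cocycle compatible_multA N conv_inverse)
  also have "\<dots> = conv qscale (\<lambda>v c. qscale c v) \<delta>2 (conv qscale ?T \<delta>2 ?mA ?m) ?g' (a, b)"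
    by (rule M2.conv_scale_pull_right[OF T]) (simp_all add: compatible_cocycle compatible_multA)
  also have "\<dots> = ca qscale (tmultA a b) ?T"
    using hom_tmultA_eq[OF L, of a b] by (simp add: * conv_pairA[OF q, of _ _ ?g'])
  finally show "ca qscale (tmultA a b) ?T = lext qscale (\<lambda>(x, y). ?T x y)
      (tsum fscale (coact A a) (\<lambda>a0 a1. tsum fscale (coact A b) (\<lambda>b0 b1.
        gen (tmultA a0 b0, tmult a1 b1))))"
    by simp
qed

theorem comodule_algebra_twist: "comodule_algebra (twist_hopf H \<gamma> \<gamma>') (twist_comod_alg \<gamma>' A)"
proof (intro comodule_algebra.intro hopf_algebra_twist K_algebra.intro comodule_algebra_axioms.intro)
  have "bilinear_map (scl A) (scl A) (scl A) tmultA"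
    by (simp add: bilinear_map_def hom_tmultA hom_id[OF A.module_scl])
  then show "bilinear_map (scl (twist_comod_alg \<gamma>' A)) (scl (twist_comod_alg \<gamma>' A))
      (scl (twist_comod_alg \<gamma>' A)) (mult (twist_comod_alg \<gamma>' A))"
    unfolding mult_twist_comod_alg by (simp add: twist_comod_alg_def)
qed (unfold mult_twist_comod_alg, simp_all add: twist_comod_alg_def twist_hopf_def A.module_scl
    tmultA_assoc tmultA_coinvariant unity_coinvariant A.unity_left A.unity_right
    coact_linear coact_coassoc coact_counit coact_tmultA coact_unity)

section \<open>The canonical map of the twisted extension\<close>

abbreviation "AH \<equiv> tensor_null (scl A) (scl H)"
abbreviation "T \<equiv> tens (scl A) (scl H)"

lemma T_bilinear: "bilinear_map (scl A) (scl H) qscale T"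
  by (rule bilinear_tens[OF A.module_scl module_scl])

lemma tensor_eqI:
  assumes "t \<in> tspace AH" "t' \<in> tspace AH" "tsum qscale t T = tsum qscale t' T"
  shows "t = t'"
  using tsum_eq_imp_tensor_eq[OF assms(1), of "trep t'"] assms(3)
    tclass_trep[OF subspace_tensor_null assms(2)]
  by (simp add: tsum_eq_lext)

text \<open>
  Precomposition of a bilinear map with \<open>z \<otimes> h \<mapsto> f(z\<^sub>1, h\<^sub>1) z\<^sub>0 \<otimes> h\<^sub>2\<close>; \<open>tensor_act\<close> is the
  underlying map of tensors.
\<close>

definition act ::
  "('h \<Rightarrow> 'h \<Rightarrow> 'k) \<Rightarrow> ('k \<Rightarrow> 'v::ab_group_add \<Rightarrow> 'v) \<Rightarrow> ('a \<Rightarrow> 'h \<Rightarrow> 'v) \<Rightarrow> 'a \<Rightarrow> 'h \<Rightarrow> 'v" where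
  "act f s F z h = ca s z (\<lambda>z0 z1. sw s h (\<lambda>h1 h2. s (f z1 h1) (F z0 h2)))"

definition tensor_act :: "('h \<Rightarrow> 'h \<Rightarrow> 'k) \<Rightarrow> ('a \<times> 'h \<Rightarrow>\<^sub>0 'k) set \<Rightarrow> ('a \<times> 'h \<Rightarrow>\<^sub>0 'k) set" where
  "tensor_act f t = tclass AH (tsum fscale t (act f fscale (\<lambda>z h. gen (z, h))))"

lemma tensor_act_in: "tensor_act f t \<in> tspace AH"
  by (simp add: tensor_act_def tspace_def)

lemma bilinear_act:
  assumes f: "bilinear_map (scl H) (scl H) (*) f" and F: "bilinear_map (scl A) (scl H) s F"
  shows "bilinear_map (scl A) (scl H) s (act f s F)"
proof -
  note lin = hom_A bilinear_mapD[OF F] hom_bilinear_left[OF F] hom_bilinear_right[OF F]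
    hom_bilinear_left[OF f] hom_bilinear_right[OF f] hom_scale_left[OF bilinear_mapD(5)[OF F]]
    hom_scale_right[of _ s]
  show ?thesis
    by (rule bilinearI_A) (simp_all add: act_def[abs_def] lin)
qed

lemma tsum_tensor_act:
  assumes F: "bilinear_map (scl A) (scl H) s F"
  shows "tsum s (tensor_act f t) F = tsum s t (act f s F)"
proof -
  have s: "module s" using bilinear_mapD[OF F] by simp
  show ?thesis
    unfolding tensor_act_def tsum_tclass[OF F]
    by (simp add: tsum_eq_lext act_def lext_lext[OF s] split_def lext_fscale[OF s] s)
qed

text \<open>
  Composition of these maps is convolution with respect to the coproduct of \<open>H\<close> in the first
  variable and the opposite coproduct in the second.
\<close>

lemma act_act:
  assumes f: "bilinear_map (scl H) (scl H) (*) f" and g: "bilinear_map (scl H) (scl H) (*) g"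
    and F: "bilinear_map (scl A) (scl H) s F"
  shows "act g s (act f s F) z h =
    act (\<lambda>z h. sw (*) z (\<lambda>z1 z2. sw (*) h (\<lambda>h1 h2. f z1 h2 * g z2 h1))) s F z h"
proof -
  note s = bilinear_mapD(5)[OF F]
  note lin = hom_A hom_bilinear_left[OF F] hom_bilinear_right[OF F]
    hom_bilinear_left[OF f] hom_bilinear_right[OF f]
    hom_bilinear_left[OF g] hom_bilinear_right[OF g] hom_scale_left[OF s]
    hom_scale_right[of _ s] s
  let ?J = "\<lambda>z0 z1 z2 h1 h2 h3. s (f z1 h2 * g z2 h1) (F z0 h3)"
  have "act g s (act f s F) z h = ca s z (\<lambda>x z2. sw s h (\<lambda>h1 r. ca s x (\<lambda>z0 z1. sw s r (\<lambda>h2 h3.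
      ?J z0 z1 z2 h1 h2 h3))))"
    by (simp add: act_def scale_tsum_right[OF s] module.scale_scale[OF s] mult.commute)
  also have "\<dots> = ca s z (\<lambda>x z2. ca s x (\<lambda>z0 z1. sw s h (\<lambda>h1 r. sw s r (\<lambda>h2 h3.
      ?J z0 z1 z2 h1 h2 h3))))"
    by (intro ca_cong tsum_swap s)
  also have "\<dots> = ca s z (\<lambda>x z2. ca s x (\<lambda>z0 z1. sw s h (\<lambda>y h3. sw s y (\<lambda>h1 h2.
      ?J z0 z1 z2 h1 h2 h3))))"
    by (intro ca_cong sw_coassoc[symmetric]) (simp_all add: lin)
  also have "\<dots> = ca s z (\<lambda>z0 w. sw s w (\<lambda>z1 z2. sw s h (\<lambda>y h3. sw s y (\<lambda>h1 h2.
      ?J z0 z1 z2 h1 h2 h3))))"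
    by (rule ca_coassoc) (simp_all add: lin)
  also have "\<dots> = ca s z (\<lambda>z0 w. sw s h (\<lambda>y h3. sw s w (\<lambda>z1 z2. sw s y (\<lambda>h1 h2.
      ?J z0 z1 z2 h1 h2 h3))))"
    by (intro ca_cong tsum_swap s)
  also have "\<dots> = act (\<lambda>z h. sw (*) z (\<lambda>z1 z2. sw (*) h (\<lambda>h1 h2. f z1 h2 * g z2 h1))) s F z h"
    by (simp add: act_def scale_tsum_left[OF s])
  finally show ?thesis .
qed

lemma tensor_act_comp:
  assumes f: "bilinear_map (scl H) (scl H) (*) f" and g: "bilinear_map (scl H) (scl H) (*) g"
  shows "tensor_act f (tensor_act g t) =
    tensor_act (\<lambda>z h. sw (*) z (\<lambda>z1 z2. sw (*) h (\<lambda>h1 h2. f z1 h2 * g z2 h1))) t"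
  by (intro tensor_eqI tensor_act_in)
    (simp add: tsum_tensor_act T_bilinear bilinear_act[OF f] act_act[OF f g T_bilinear] cong: tsum_cong)

lemma tensor_act_counit:
  assumes "t \<in> tspace AH"
  shows "tensor_act (\<lambda>z h. counit H z * counit H h) t = t"
proof (intro tensor_eqI tensor_act_in assms)
  note T = T_bilinear and q = module_qscale
  have "act (\<lambda>z h. counit H z * counit H h) qscale T z h = T z h" for z h
  proof -
    have "sw qscale h (\<lambda>h1 h2. qscale (counit H h1) (T z0 h2)) = T z0 h" for z0
      by (rule sw_counit_left) (rule bilinear_mapD[OF T])
    moreover have "ca qscale z (\<lambda>z0 z1. qscale (counit H z1) (T z0 h)) = T z h"
      by (rule ca_counit) (rule bilinear_mapD[OF T])
    ultimately show ?thesis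
      unfolding act_def
      by (simp add: module.scale_scale[OF q, symmetric] scale_tsum_right[OF q, symmetric])
  qed
  then show "tsum qscale (tensor_act (\<lambda>z h. counit H z * counit H h) t) T = tsum qscale t T"
    by (simp add: tsum_tensor_act T cong: tsum_cong)
qed

lemma bij_tensor_act:
  assumes f: "bilinear_map (scl H) (scl H) (*) f" and g: "bilinear_map (scl H) (scl H) (*) g"
    and "\<And>z h. sw (*) z (\<lambda>z1 z2. sw (*) h (\<lambda>h1 h2. f z1 h2 * g z2 h1)) = counit H z * counit H h"
      "\<And>z h. sw (*) z (\<lambda>z1 z2. sw (*) h (\<lambda>h1 h2. g z1 h2 * f z2 h1)) = counit H z * counit H h"
  shows "bij_betw (tensor_act f) (tspace AH) (tspace AH)"
  by (rule bij_betw_byWitness[where f' = "tensor_act g"])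
    (auto simp: tensor_act_in tensor_act_comp[OF f g] tensor_act_comp[OF g f] assms(3,4) tensor_act_counit)

text \<open>
  The functional whose action on \<open>A \<otimes> H\<close> turns the canonical map into the twisted one.
\<close>

definition galois_twist :: "'h \<Rightarrow> 'h \<Rightarrow> 'k" where
  "galois_twist z h = sw (*) h (\<lambda>a b. \<gamma>' (mult H z (antipode H a)) b)"

text \<open>
  The map factors into the actions of \<open>\<gamma>(z, S(h))\<close> and of \<open>\<epsilon>(z) u'(h)\<close>.  In the composition
  law the coproduct of the second variable is reversed, and \<open>S\<close> reverses it back, so that
  \<open>\<gamma>'(z, S(h))\<close> inverts the first factor; \<open>\<epsilon>(z) u(h)\<close> inverts the second.
\<close>

lemma bij_galois_twist: "bij_betw (tensor_act galois_twist) (tspace AH) (tspace AH)"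
proof -
  let ?S = "antipode H" and ?e = "counit H"
  let ?f = "\<lambda>z h. \<gamma> z (?S h)" and ?f' = "\<lambda>z h. \<gamma>' z (?S h)"
  let ?v = "\<lambda>z h. ?e z * u' h" and ?v' = "\<lambda>z h. ?e z * u h"
  have bil: "bilinear_map (scl H) (scl H) (*) ?f" "bilinear_map (scl H) (scl H) (*) ?f'"
    "bilinear_map (scl H) (scl H) (*) ?v" "bilinear_map (scl H) (scl H) (*) ?v'"
    by (auto intro!: bilinearI_H simp: hom_A)
  have S: "sw (*) z (\<lambda>z1 z2. sw (*) h (\<lambda>h1 h2. a z1 (?S h2) * b z2 (?S h1))) = ?e z * ?e h"
    if "bilinear_map (scl H) (scl H) (*) a" "bilinear_map (scl H) (scl H) (*) b"
      "\<And>z h. sw (*) z (\<lambda>z1 z2. sw (*) h (\<lambda>h1 h2. a z1 h1 * b z2 h2)) = ?e z * ?e h" for a b z h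
  proof -
    have "sw (*) z (\<lambda>z1 z2. sw (*) h (\<lambda>h1 h2. a z1 (?S h2) * b z2 (?S h1))) =
      sw (*) z (\<lambda>z1 z2. sw (*) (?S h) (\<lambda>h1 h2. a z1 h1 * b z2 h2))"
      by (intro sw_cong sw_antipode[symmetric])
        (simp_all add: hom_A hom_bilinear_right[OF that(1)] hom_bilinear_right[OF that(2)])
    then show ?thesis by (simp add: that(3) counit_antipode)
  qed
  have E: "sw (*) z (\<lambda>z1 z2. sw (*) h (\<lambda>h1 h2. (?e z1 * a h2) * (?e z2 * b h1))) = ?e z * ?e h"
    if "\<And>h. sw (*) h (\<lambda>h1 h2. b h1 * a h2) = ?e h" for a b z h
  proof -
    have "sw (*) z (\<lambda>z1 z2. sw (*) h (\<lambda>h1 h2. (?e z1 * a h2) * (?e z2 * b h1))) =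
      sw (*) z (\<lambda>z1 z2. ?e z1 * (?e z2 * sw (*) h (\<lambda>h1 h2. b h1 * a h2)))"
      by (simp add: scale_tsum_right[OF module_mult] mult_ac)
    also have "\<dots> = ?e z * ?e h"
      unfolding that by (rule sw_counit_left) (simp add: hom_A)
    finally show ?thesis .
  qed
  have "bij_betw (tensor_act ?f) (tspace AH) (tspace AH)"
    by (rule bij_tensor_act[OF bil(1,2)]) (intro S bilinear inverse_bilinear inverse_left inverse_right)+
  moreover have "bij_betw (tensor_act ?v) (tspace AH) (tspace AH)"
    by (rule bij_tensor_act[OF bil(3,4)]) (intro E u_inverse_left u_inverse_right)+
  ultimately have "bij_betw (tensor_act ?v \<circ> tensor_act ?f) (tspace AH) (tspace AH)"
    by (rule bij_betw_trans)
  moreover have "(\<lambda>z h. sw (*) z (\<lambda>z1 z2. sw (*) h (\<lambda>h1 h2. (?e z1 * u' h2) * \<gamma> z2 (?S h1)))) =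
      galois_twist"
  proof (intro ext)
    fix z h
    have "sw (*) z (\<lambda>z1 z2. sw (*) h (\<lambda>h1 h2. (?e z1 * u' h2) * \<gamma> z2 (?S h1))) =
      sw (*) z (\<lambda>z1 z2. ?e z1 * sw (*) h (\<lambda>h1 h2. \<gamma> z2 (?S h1) * u' h2))"
      by (simp add: scale_tsum_right[OF module_mult] mult_ac)
    also have "\<dots> = sw (*) h (\<lambda>h1 h2. \<gamma> z (?S h1) * u' h2)"
      by (rule sw_counit_left) (simp add: hom_A)
    finally show "sw (*) z (\<lambda>z1 z2. sw (*) h (\<lambda>h1 h2. (?e z1 * u' h2) * \<gamma> z2 (?S h1))) =
      galois_twist z h"
      by (simp add: galois_twist_def cocycle_antipode_right)
  qed
  ultimately show ?thesis
    by (simp add: comp_def tensor_act_comp[OF bil(3,1)])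
qed

text \<open>
  Substituting \<open>z = g h\<^sub>1\<close> removes the antipode: this recovers \<open>a\<^sub>1\<close> from \<open>a\<^sub>1 a'\<^sub>1\<close> and \<open>a'\<^sub>2\<close>.
\<close>

lemma galois_twist_mult: "sw (*) h (\<lambda>h1 h2. galois_twist (mult H g h1) h2) = \<gamma>' g h"
proof -
  let ?S = "antipode H" and ?m = "mult H"
  have "sw (*) h (\<lambda>h1 h2. galois_twist (?m g h1) h2) =
    sw (*) h (\<lambda>a t. sw (*) t (\<lambda>b c. \<gamma>' (?m g (?m a (?S b))) c))"
    by (simp add: galois_twist_def mult_assoc)
  also have "\<dots> = sw (*) h (\<lambda>y c. sw (*) y (\<lambda>a b. \<gamma>' (?m g (?m a (?S b))) c))"
    by (rule sw_coassoc[symmetric]) (simp_all add: hom_A)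
  also have "\<dots> = sw (*) h (\<lambda>y c. counit H y * \<gamma>' (?m g (unity H)) c)"
    by (intro sw_cong sw_antipode_right) (simp add: hom_A)
  also have "\<dots> = \<gamma>' g h"
    unfolding unity_right by (rule sw_counit_left) (simp add: hom_A)
  finally show ?thesis .
qed

lemma bilinear_galois_twist: "bilinear_map (scl H) (scl H) (*) galois_twist"
  by (rule bilinearI_H) (simp_all add: galois_twist_def[abs_def] hom_A)

text \<open>
  Comparison of the two canonical maps.  The coaction is multiplicative on \<open>a a'\<^sub>0\<close>, and the
  antipode in \<open>galois_twist\<close> cancels the part of it that comes from \<open>a'\<close>, which leaves
  \<open>\<gamma>'(a\<^sub>1, a'\<^sub>1)\<close>, the factor of the twisted product.
\<close>

lemma canonical_map_twist:
  "canonical_map (twist_hopf H \<gamma> \<gamma>') (twist_comod_alg \<gamma>' A) t =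
     tensor_act galois_twist (canonical_map H A t)"
proof (rule tensor_eqI[OF _ tensor_act_in])
  let ?s = "qscale :: 'k \<Rightarrow> ('a \<times> 'h, 'k) all_quotients \<Rightarrow> _"
  let ?m = "mult A" and ?v = galois_twist
  note T = T_bilinear and q = module_qscale
  note vT = bilinear_act[OF bilinear_galois_twist T]
  note lin = hom_A hom_tmultA hom_bilinear_left[OF T] hom_bilinear_right[OF T]
    hom_bilinear_left[OF bilinear_galois_twist] hom_bilinear_right[OF bilinear_galois_twist]
    bilinear_mapD(1,2)[OF T]
  have twisted: "canonical_map (twist_hopf H \<gamma> \<gamma>') (twist_comod_alg \<gamma>' A) t =
    tclass AH (tsum fscale t (\<lambda>a a'. tsum fscale (coact A a') (\<lambda>a0 a1. gen (tmultA a a0, a1))))"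
    unfolding canonical_map_def mult_twist_comod_alg by (simp add: twist_comod_alg_def twist_hopf_def)
  show "canonical_map (twist_hopf H \<gamma> \<gamma>') (twist_comod_alg \<gamma>' A) t \<in> tspace AH"
    by (simp add: twisted tspace_def)
  have key: "ca ?s a' (\<lambda>x r. act ?v ?s T (?m a x) r) = ca ?s a' (\<lambda>x r. T (tmultA a x) r)" for a a'
  proof -
    have "ca ?s a' (\<lambda>x r. act ?v ?s T (?m a x) r) =
      ca ?s a' (\<lambda>x r. ca ?s a (\<lambda>b0 b1. ca ?s x (\<lambda>x0 x1. sw ?s r (\<lambda>h1 h2.
        ?s (?v (mult H b1 x1) h1) (T (?m b0 x0) h2)))))"
      unfolding act_def by (intro ca_cong ca_mult) (simp_all add: lin)
    also have "\<dots> = ca ?s a (\<lambda>b0 b1. ca ?s a' (\<lambda>x r. ca ?s x (\<lambda>x0 x1. sw ?s r (\<lambda>h1 h2.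
        ?s (?v (mult H b1 x1) h1) (T (?m b0 x0) h2)))))"
      by (rule tsum_swap[OF q])
    also have "\<dots> = ca ?s a (\<lambda>b0 b1. ca ?s a' (\<lambda>x0 w. sw ?s w (\<lambda>x1 r. sw ?s r (\<lambda>h1 h2.
        ?s (?v (mult H b1 x1) h1) (T (?m b0 x0) h2)))))"
      by (intro ca_cong ca_coassoc) (simp_all add: lin)
    also have "\<dots> = ca ?s a (\<lambda>b0 b1. ca ?s a' (\<lambda>x0 w. sw ?s w (\<lambda>y h2. sw ?s y (\<lambda>x1 h1.
        ?s (?v (mult H b1 x1) h1) (T (?m b0 x0) h2)))))"
      by (intro ca_cong sw_coassoc[symmetric]) (simp_all add: lin)
    also have "\<dots> = ca ?s a (\<lambda>b0 b1. ca ?s a' (\<lambda>x0 w. sw ?s w (\<lambda>y h2.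
        ?s (\<gamma>' b1 y) (T (?m b0 x0) h2))))"
      by (simp add: scale_tsum_left[OF q, symmetric] galois_twist_mult)
    also have "\<dots> = ca ?s a (\<lambda>b0 b1. ca ?s a' (\<lambda>x r. ca ?s x (\<lambda>x0 y.
        ?s (\<gamma>' b1 y) (T (?m b0 x0) r))))"
      by (intro ca_cong ca_coassoc[symmetric]) (simp_all add: lin)
    also have "\<dots> = ca ?s a' (\<lambda>x r. ca ?s a (\<lambda>b0 b1. ca ?s x (\<lambda>x0 y.
        ?s (\<gamma>' b1 y) (T (?m b0 x0) r))))"
      by (rule tsum_swap[OF q])
    also have "\<dots> = ca ?s a' (\<lambda>x r. T (tmultA a x) r)"
      by (intro ca_cong hom_tmultA_eq[symmetric]) (simp add: lin)
    finally show ?thesis .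
  qed
  have "tsum ?s (canonical_map (twist_hopf H \<gamma> \<gamma>') (twist_comod_alg \<gamma>' A) t) T =
    tsum ?s t (\<lambda>a a'. ca ?s a' (\<lambda>a0 a1. T (tmultA a a0) a1))"
    unfolding twisted tsum_tclass[OF T] by (simp add: tsum_eq_lext lext_lext[OF q] split_def q)
  also have "\<dots> = tsum ?s t (\<lambda>a a'. ca ?s a' (\<lambda>a0 a1. act ?v ?s T (?m a a0) a1))"
    by (simp add: key)
  also have "\<dots> = tsum ?s (canonical_map H A t) (act ?v ?s T)"
    unfolding canonical_map_def tsum_tclass[OF vT] by (simp add: tsum_eq_lext lext_lext[OF q] split_def q)
  also have "\<dots> = tsum ?s (tensor_act ?v (canonical_map H A t)) T"
    by (rule tsum_tensor_act[OF T, symmetric])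
  finally show "tsum ?s (canonical_map (twist_hopf H \<gamma> \<gamma>') (twist_comod_alg \<gamma>' A) t) T =
    tsum ?s (tensor_act ?v (canonical_map H A t)) T" .
qed

lemma coinvariants_twist: "coinvariants (twist_hopf H \<gamma> \<gamma>') (twist_comod_alg \<gamma>' A) = coinvariants H A"
  by (simp add: coinvariants_def twist_hopf_def twist_comod_alg_def)

lemma balanced_null_twist:
  assumes "B \<subseteq> coinvariants H A"
  shows "balanced_null (twist_comod_alg \<gamma>' A) B = balanced_null A B"
proof -
  have eq: "tmultA a b = mult A a b \<and> tmultA b a = mult A b a" if "b \<in> B" for a b
    using assms that tmultA_coinvariant by blast
  have "{gen (tmultA a b, a') - gen (a, tmultA b a') | a b a'. b \<in> B} =
    ({gen (mult A a b, a') - gen (a, mult A b a') | a b a'. b \<in> B} :: ('a \<times> 'a \<Rightarrow>\<^sub>0 'k) set)"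
    by (intro Collect_cong) (metis eq)
  then show ?thesis
    unfolding balanced_null_def mult_twist_comod_alg by (simp add: twist_comod_alg_def)
qed

theorem hopf_galois_twist:
  assumes "hopf_galois_extension H A"
  shows "hopf_galois_extension (twist_hopf H \<gamma> \<gamma>') (twist_comod_alg \<gamma>' A)"
proof (intro hopf_galois_extension.intro comodule_algebra_twist hopf_galois_extension_axioms.intro)
  have "bij_betw (canonical_map H A) (tspace (balanced_null A (coinvariants H A))) (tspace AH)"
    using assms by (rule hopf_galois_extension.canonical_map_bij)
  from bij_betw_trans[OF this bij_galois_twist]
  have "bij_betw (tensor_act galois_twist \<circ> canonical_map H A)
    (tspace (balanced_null A (coinvariants H A))) (tspace AH)" .
  also have "tensor_act galois_twist \<circ> canonical_map H A =
    canonical_map (twist_hopf H \<gamma> \<gamma>') (twist_comod_alg \<gamma>' A)"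
    by (rule ext) (simp add: canonical_map_twist)
  finally have "bij_betw (canonical_map (twist_hopf H \<gamma> \<gamma>') (twist_comod_alg \<gamma>' A))
    (tspace (balanced_null A (coinvariants H A))) (tspace AH)" .
  then show "bij_betw (canonical_map (twist_hopf H \<gamma> \<gamma>') (twist_comod_alg \<gamma>' A))
    (tspace (balanced_null (twist_comod_alg \<gamma>' A)
      (coinvariants (twist_hopf H \<gamma> \<gamma>') (twist_comod_alg \<gamma>' A))))
    (tspace (tensor_null (scl (twist_comod_alg \<gamma>' A)) (scl (twist_hopf H \<gamma> \<gamma>'))))"
    by (simp add: coinvariants_twist balanced_null_twist) (simp add: twist_comod_alg_def twist_hopf_def)
qed

end

theorem corollary4p4:
  fixes H :: "('k::comm_ring_1, 'h::ab_group_add) hopf"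
    and A :: "('k, 'a::ab_group_add, 'h) comod_alg"
    and B :: "'a set"
    and \<gamma> \<gamma>' :: "'h \<Rightarrow> 'h \<Rightarrow> 'k"
  assumes "complex_or_complex_fps TYPE('k)"
    and "hopf_algebra H"
    and "bij (antipode H)"
    and "comodule_algebra H A"
    and "B = coinvariants H A"
    and "two_cocycle H \<gamma> \<gamma>'"
    and "hopf_galois_extension H A"
  shows "coinvariants (twist_hopf H \<gamma> \<gamma>') (twist_comod_alg \<gamma>' A) = B
    \<and> (\<forall>b\<in>B. \<forall>b'\<in>B. mult (twist_comod_alg \<gamma>' A) b b' = mult A b b')
    \<and> hopf_galois_extension (twist_hopf H \<gamma> \<gamma>') (twist_comod_alg \<gamma>' A)"
proof -
  interpret comodule_cocycle H \<gamma> \<gamma>' A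
    using assms(2,4,6) by (intro comodule_cocycle.intro hopf_cocycle.intro)
  show ?thesis
    using assms(5) coinvariants_twist tmultA_coinvariant(1) hopf_galois_twist[OF assms(7)]
    by (auto simp: mult_twist_comod_alg)
qed

end
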